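(* There are absolute constants $c,C>0$ such that the following holds. Let $R\ge1$ and $\delta\in(0,1)$, and assume $m\ge c\,L^{11}d(\log m)^5\log(L/\delta)R^2$. Then with probability at least $1-\delta$ over $\mathbf W(0)$, for all $\mathbf W\in\mathcal B_R(\mathbf W(0))$ and all $l\in[L]$, $$\sup_{\mathbf x\in\mathcal X}\|h^l(\mathbf x)-h^l_0(\mathbf x)\|_2\le C\,L^2\sqrt{\frac{\log m}{m}}\,R.$$
   Context: Network: $d,m,L$ are positive integers, $m$ even, $L\ge2$ (implicit in the initialization). $\sigma(t)=\max\{t,0\}$ entrywise. $\mathcal W=\mathbb R^{m\times d}\times(\mathbb R^{m\times m})^{L-1}$ with elements $\mathbf W=(\mathbf W^1,\dots,\mathbf W^L)$; $(\mathbf w_r^l)^\top$ is the $r$-th row of $\mathbf W^l$. For $\mathbf x\in\mathcal X=S^{d-1}$ (unit sphere of $\mathbb R^d$): $h^0(\mathbf x)=\mathbf x$, $h^l(\mathbf x)=\sqrt{2/m}\,\sigma(\mathbf W^l h^{l-1}(\mathbf x))$ for $l\in[L]$; $h^l_0(\mathbf x)$ is the same quantity computed with $\mathbf W=\mathbf W(0)$. Initialization: $\mathbf W(0)$ is random: all rows $\mathbf w^l_r(0)$ with $l\le L-1$, $r\in[m]$, and $\mathbf w^L_r(0)$ with $r\le m/2$, are independent standard Gaussian vectors ($\mathcal N(0,\mathbf I_d)$ for $l=1$, $\mathcal N(0,\mathbf I_m)$ for $l\ge 2$), and $\mathbf w^L_{r+m/2}(0)=\mathbf w^L_r(0)$ for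 $r\le m/2$. $\mathcal B_R(\mathbf W)=\{\widetilde{\mathbf W}\in\mathcal W:\max_{l}\|\mathbf W^l-\widetilde{\mathbf W}^l\|_2\le R\}$ (spectral norm). *)

theory Defs
  imports "HOL-Probability.Probability" "Jordan_Normal_Form.Matrix"
begin

unbundle no vec_syntax

text \<open>The widths \<open>d\<close>, \<open>m\<close> and the depth \<open>L\<close> are quantified inside the scope of the absolute
  constants, so vectors and matrices carry their dimensions as numbers (not as types). Vector
  entries and matrix rows are numbered from 0, layers from 1.\<close>

definition vec_norm2 :: "real Matrix.vec \<Rightarrow> real" where
  "vec_norm2 v = L2_set (vec_index v) {..<dim_vec v}"

definition unit_sphere :: "nat \<Rightarrow> real Matrix.vec set" where
  "unit_sphere d = {x \<in> carrier_vec d. vec_norm2 x = 1}"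

definition spectral_norm :: "real Matrix.mat \<Rightarrow> real" where
  "spectral_norm A = (SUP x\<in>{x \<in> carrier_vec (dim_col A). vec_norm2 x \<le> 1}. vec_norm2 (A *\<^sub>v x))"

definition fan_in :: "nat \<Rightarrow> nat \<Rightarrow> nat \<Rightarrow> nat" where
  "fan_in d m l = (if l = 1 then d else m)"

definition weight_space :: "nat \<Rightarrow> nat \<Rightarrow> nat \<Rightarrow> (nat \<Rightarrow> real Matrix.mat) set" where
  "weight_space d m L = (\<Pi>\<^sub>E l\<in>{1..L}. carrier_mat m (fan_in d m l))"

definition weight_ball ::
    "nat \<Rightarrow> nat \<Rightarrow> nat \<Rightarrow> real \<Rightarrow> (nat \<Rightarrow> real Matrix.mat) \<Rightarrow> (nat \<Rightarrow> real Matrix.mat) set" where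
  "weight_ball d m L R W =
     {V \<in> weight_space d m L. (MAX l\<in>{1..L}. spectral_norm (W l - V l)) \<le> R}"

definition relu :: "real \<Rightarrow> real" where
  "relu t = max t 0"

primrec hidden :: "nat \<Rightarrow> (nat \<Rightarrow> real Matrix.mat) \<Rightarrow> nat \<Rightarrow> real Matrix.vec \<Rightarrow> real Matrix.vec" where
  "hidden m W 0 x = x"
| "hidden m W (Suc l) x = sqrt (2 / real m) \<cdot>\<^sub>v map_vec relu (W (Suc l) *\<^sub>v hidden m W l x)"

definition std_gaussian_vec :: "nat \<Rightarrow> (nat \<Rightarrow> real) measure" where
  "std_gaussian_vec n = (\<Pi>\<^sub>M j\<in>{..<n}. density lborel std_normal_density)"

text \<open>The pairs \<open>(l, r)\<close> of layer and row that are sampled; in the last layer only the first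
  half of the rows is.\<close>

definition free_rows :: "nat \<Rightarrow> nat \<Rightarrow> (nat \<times> nat) set" where
  "free_rows m L = {1..L - 1} \<times> {..<m} \<union> {L} \<times> {..<m div 2}"

text \<open>The sample space is the canonical one: a sample \<open>\<omega>\<close> maps each pair in \<open>free_rows\<close> to a row
  vector, and these rows are independent standard Gaussians under the product measure.\<close>

definition init_measure :: "nat \<Rightarrow> nat \<Rightarrow> nat \<Rightarrow> (nat \<times> nat \<Rightarrow> nat \<Rightarrow> real) measure" where
  "init_measure d m L = (\<Pi>\<^sub>M (l, r)\<in>free_rows m L. std_gaussian_vec (fan_in d m l))"

definition init_weights ::
    "nat \<Rightarrow> nat \<Rightarrow> nat \<Rightarrow> (nat \<times> nat \<Rightarrow> nat \<Rightarrow> real) \<Rightarrow> nat \<Rightarrow> real Matrix.mat" where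
  "init_weights d m L \<omega> = (\<lambda>l\<in>{1..L}. Matrix.mat m (fan_in d m l)
     (\<lambda>(r, j). \<omega> (l, if l = L \<and> m div 2 \<le> r then r - m div 2 else r) j))"

lemma prob_space_std_gaussian_vec: "prob_space (std_gaussian_vec n)"
  unfolding std_gaussian_vec_def
  by (rule prob_space_PiM, rule prob_space_normal_density) simp

lemma prob_space_init_measure: "prob_space (init_measure d m L)"
  unfolding init_measure_def
  by (rule prob_space_PiM) (simp add: prob_space_std_gaussian_vec split: prod.split)

lemma init_weights_in_weight_space: "init_weights d m L \<omega> \<in> weight_space d m L"
  by (auto simp: init_weights_def weight_space_def)

lemma vec_norm2_nonneg: "0 \<le> vec_norm2 v"
  by (simp add: vec_norm2_def)

lemma vec_norm2_mult_mat_le: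
  assumes "x \<in> carrier_vec (dim_col A)"
  shows "vec_norm2 (A *\<^sub>v x) \<le> (\<Sum>i<dim_row A. \<Sum>j<dim_col A. \<bar>A $$ (i, j)\<bar>) * vec_norm2 x"
proof -
  have entry: "\<bar>x $ j\<bar> \<le> vec_norm2 x" if "j < dim_col A" for j
    using member_le_L2_set[of "{..<dim_vec x}" j "\<lambda>j. \<bar>vec_index x j\<bar>"] that assms
    by (auto simp: vec_norm2_def L2_set_def)
  have "vec_norm2 (A *\<^sub>v x) \<le> (\<Sum>i<dim_row A. \<bar>(A *\<^sub>v x) $ i\<bar>)"
    unfolding vec_norm2_def using L2_set_le_sum_abs[of "vec_index (A *\<^sub>v x)" "{..<dim_row A}"]
    by simp
  also have "\<dots> = (\<Sum>i<dim_row A. \<bar>\<Sum>j<dim_col A. A $$ (i, j) * x $ j\<bar>)"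
    using assms by (intro sum.cong refl) (auto simp: scalar_prod_def atLeast0LessThan)
  also have "\<dots> \<le> (\<Sum>i<dim_row A. \<Sum>j<dim_col A. \<bar>A $$ (i, j)\<bar> * vec_norm2 x)"
    by (intro sum_mono order_trans[OF sum_abs])
      (auto simp: abs_mult intro!: mult_left_mono entry)
  finally show ?thesis by (simp add: sum_distrib_right)
qed

text \<open>The real suprema in this theory are over bounded sets, hence genuine.\<close>

lemma bdd_above_spectral_norm:
  "bdd_above ((\<lambda>x. vec_norm2 (A *\<^sub>v x)) ` {x \<in> carrier_vec (dim_col A). vec_norm2 x \<le> 1})"
proof (rule bdd_aboveI2)
  fix x assume x: "x \<in> {x \<in> carrier_vec (dim_col A). vec_norm2 x \<le> 1}"
  have "vec_norm2 (A *\<^sub>v x) \<le> (\<Sum>i<dim_row A. \<Sum>j<dim_col A. \<bar>A $$ (i, j)\<bar>) * vec_norm2 x"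
    using x by (intro vec_norm2_mult_mat_le) simp
  also have "\<dots> \<le> (\<Sum>i<dim_row A. \<Sum>j<dim_col A. \<bar>A $$ (i, j)\<bar>) * 1"
    using x by (intro mult_left_mono) (auto intro: sum_nonneg)
  finally show "vec_norm2 (A *\<^sub>v x) \<le> (\<Sum>i<dim_row A. \<Sum>j<dim_col A. \<bar>A $$ (i, j)\<bar>)" by simp
qed

lemma hidden_carrier:
  assumes "W \<in> weight_space d m L" "x \<in> carrier_vec d" "1 \<le> l" "l \<le> L"
  shows "hidden m W l x \<in> carrier_vec m"
proof -
  obtain k where l: "l = Suc k" using assms(3) by (cases l) auto
  have "W l \<in> carrier_mat m (fan_in d m l)"
    using assms by (auto simp: weight_space_def PiE_iff)
  then have "dim_row (W (Suc k)) = m" unfolding l by (rule carrier_matD)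
  then show ?thesis unfolding l by (intro carrier_vecI) simp
qed

lemma vec_norm2_smult: "vec_norm2 (c \<cdot>\<^sub>v v) = \<bar>c\<bar> * vec_norm2 v"
proof -
  have "(\<Sum>i<dim_vec v. (c * v $ i)\<^sup>2) = c\<^sup>2 * (\<Sum>i<dim_vec v. (v $ i)\<^sup>2)"
    by (simp add: power_mult_distrib sum_distrib_left)
  then show ?thesis by (simp add: vec_norm2_def L2_set_def real_sqrt_mult)
qed

lemma vec_norm2_relu_le: "vec_norm2 (map_vec relu v) \<le> vec_norm2 v"
proof -
  have "vec_norm2 (map_vec relu v) \<le> L2_set (\<lambda>i. \<bar>v $ i\<bar>) {..<dim_vec v}"
    unfolding vec_norm2_def index_map_vec(2)
    by (intro L2_set_mono) (auto simp: relu_def)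
  then show ?thesis by (simp add: vec_norm2_def L2_set_def)
qed

lemma hidden_bounded:
  assumes W: "W \<in> weight_space d m L" and l: "l \<le> L"
  shows "\<exists>K\<ge>0. \<forall>x\<in>unit_sphere d. vec_norm2 (hidden m W l x) \<le> K"
  using l
proof (induction l)
  case 0
  show ?case by (intro exI[of _ 1]) (auto simp: unit_sphere_def)
next
  case (Suc l)
  then obtain K where K: "K \<ge> 0" "\<And>x. x \<in> unit_sphere d \<Longrightarrow> vec_norm2 (hidden m W l x) \<le> K"
    by auto
  let ?A = "W (Suc l)"
  define S where "S = (\<Sum>i<dim_row ?A. \<Sum>j<dim_col ?A. \<bar>?A $$ (i, j)\<bar>)"
  have S: "0 \<le> S" by (auto simp: S_def intro: sum_nonneg)
  have A: "?A \<in> carrier_mat m (fan_in d m (Suc l))"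
    using W Suc.prems by (auto simp: weight_space_def PiE_iff)
  have "vec_norm2 (hidden m W (Suc l) x) \<le> sqrt (2 / real m) * (S * K)"
    if x: "x \<in> unit_sphere d" for x
  proof -
    have "hidden m W l x \<in> carrier_vec (dim_col ?A)"
      using hidden_carrier[OF W, of x l] A x Suc.prems
      by (cases l) (auto simp: fan_in_def unit_sphere_def)
    then have "vec_norm2 (?A *\<^sub>v hidden m W l x) \<le> S * K"
      unfolding S_def
      by (rule order_trans[OF vec_norm2_mult_mat_le])
        (use K(2)[OF x] S in \<open>auto simp: S_def intro: mult_left_mono\<close>)
    then have "vec_norm2 (map_vec relu (?A *\<^sub>v hidden m W l x)) \<le> S * K"
      by (rule order_trans[OF vec_norm2_relu_le])
    then show ?thesis
      unfolding hidden.simps vec_norm2_smult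
      by (simp add: mult_left_mono)
  qed
  then show ?case using S K by (intro exI[of _ "sqrt (2 / real m) * (S * K)"]) auto
qed

lemma bdd_above_hidden_diff:
  assumes W: "W \<in> weight_space d m L" and V: "V \<in> weight_space d m L" and l: "l \<in> {1..L}"
  shows "bdd_above ((\<lambda>x. vec_norm2 (hidden m W l x - hidden m V l x)) ` unit_sphere d)"
proof -
  obtain K K' where
    K: "\<And>x. x \<in> unit_sphere d \<Longrightarrow> vec_norm2 (hidden m W l x) \<le> K" and
    K': "\<And>x. x \<in> unit_sphere d \<Longrightarrow> vec_norm2 (hidden m V l x) \<le> K'"
    using hidden_bounded[OF W, of l] hidden_bounded[OF V, of l] l by auto
  have "vec_norm2 (hidden m W l x - hidden m V l x) \<le> K + K'" if x: "x \<in> unit_sphere d" for x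
  proof -
    let ?u = "hidden m W l x" and ?v = "hidden m V l x"
    have uv: "dim_vec ?u = m" "dim_vec ?v = m"
      using hidden_carrier[OF W, of x l] hidden_carrier[OF V, of x l] l x
      by (auto simp: unit_sphere_def)
    have "vec_norm2 (?u - ?v) = L2_set (\<lambda>i. ?u $ i + - ?v $ i) {..<m}"
      unfolding vec_norm2_def by (intro L2_set_cong) (auto simp: uv)
    also have "\<dots> \<le> L2_set (\<lambda>i. ?u $ i) {..<m} + L2_set (\<lambda>i. - ?v $ i) {..<m}"
      by (rule L2_set_triangle_ineq)
    also have "\<dots> = vec_norm2 ?u + vec_norm2 ?v"
      by (simp add: vec_norm2_def L2_set_def uv)
    finally show ?thesis using K[OF x] K'[OF x] by linarith
  qed
  then show ?thesis by (rule bdd_aboveI2)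
qed

end

(*
  A layer with Gaussian rows preserves norms up to a factor 1 + O(1/L) on any fixed vector, but an
  adversarial perturbation may pick worst-case vectors, which each layer could amplify by a
  constant. So the difference g_l between the perturbed and the initial activations is not
  propagated layer by layer. Instead it is written as
    g_l = sum_{a <= l} P(a, l) (q_a + e_a),
  where P(a, l) is the network linearised at the initial activations, q_a is the effect of the
  perturbation of layer a, with |q_a| = O(R / sqrt m), and e_a is the linearisation error of the
  ReLU, which lives on the few units whose sign has changed. Take s ~ m / (L^2 ln m). A union
  bound over a net of s-sparse vectors (entropy s ln m << m / L^2) gives |P(a, l) w| <= 4 |w| for
  s-sparse w, and that the next weight matrix times P(a, l), restricted to s rows, has norm at most
  sqrt (m / 2) / (2 L) on such w. The second estimate keeps the sparse errors e_a from feeding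
  each other. Splitting q_a into m / s sparse blocks costs sqrt (m / s) ~ L sqrt (ln m), and
  summing over the L layers gives L^2 sqrt (ln m / m) R.

  All of this is needed only at the points of a grid of inputs, because moving the input to the
  grid is one more perturbation of the first layer. The last layer, whose rows are duplicated,
  only enters through its operator norm.
*)
theory Submission
  imports Defs
begin

section \<open>Seminorms, nets and sparse vectors\<close>

text \<open>The constant 1 / (2 L) in the row estimate closes the induction. Each of the at most L
  earlier layers contributes E = 6 R / sqrt s through e_a and again E through the blocks of q_a, so
  any s preactivations move by at most sqrt (m / 2) E in norm, and the factor sqrt (2 / m) returns
  the same E for the next error. Sparsity of the errors comes out of the same induction. A sign
  flips only where the initial preactivation is below \<beta> = s / (32 m), which the Gaussian
  density allows for at most s / 2 units, or where the shift reaches \<beta>, which its energy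
  allows for at most s / 2 units once m E^2 <= \<beta>^2 s. With s ~ m / (L^2 ln m) the last
  condition reads m >= const L^8 (ln m)^4 R^2.

  The union bounds work because P(a, l) w, for a fixed w, depends only on the layers up to l; given
  these, the rows of layer l + 1 are still independent Gaussians. The ReLU mask is harmless on
  average: y and -y have the same law and at most one of them is active, which is where the 2 in 2 /
  m goes.\<close>

definition dotp :: "nat \<Rightarrow> (nat \<Rightarrow> real) \<Rightarrow> (nat \<Rightarrow> real) \<Rightarrow> real" where
  "dotp n u v = (\<Sum>j<n. u j * v j)"

abbreviation nrm :: "nat \<Rightarrow> (nat \<Rightarrow> real) \<Rightarrow> real" where
  "nrm n v \<equiv> L2_set v {..<n}"

text \<open>Kept abstract so that one net argument serves propagated norms, norms of selected rows
  and plain matrices, and one block argument serves both kinds of propagated norm.\<close>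

definition fun_seminorm :: "((nat \<Rightarrow> real) \<Rightarrow> real) \<Rightarrow> bool" where
  "fun_seminorm q \<longleftrightarrow> (\<forall>u v. q (\<lambda>i. u i + v i) \<le> q u + q v) \<and> (\<forall>c u. q (\<lambda>i. c * u i) = \<bar>c\<bar> * q u)"

section \<open>Elementary estimates for \<open>L2_set\<close>\<close>

lemma L2_set_scale: "L2_set (\<lambda>i. c * f i) A = \<bar>c\<bar> * L2_set f A"
  by (simp add: L2_set_def power_mult_distrib sum_distrib_left[symmetric] real_sqrt_mult)

lemma L2_set_uminus: "L2_set (\<lambda>i. - f i) A = L2_set f A"
  by (simp add: L2_set_def)

lemma L2_set_mono_abs:
  assumes "\<And>i. i \<in> A \<Longrightarrow> \<bar>f i\<bar> \<le> \<bar>g i\<bar>"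
  shows "L2_set f A \<le> L2_set g A"
  unfolding L2_set_def
  by (intro real_sqrt_le_mono sum_mono) (use assms in \<open>auto simp: abs_le_square_iff\<close>)

lemma L2_set_mono_set:
  assumes "finite B" "A \<subseteq> B"
  shows "L2_set f A \<le> L2_set f B"
  unfolding L2_set_def using assms by (intro real_sqrt_le_mono sum_mono2) auto

lemma L2_set_supp:
  assumes "finite B" "A \<subseteq> B" "\<And>i. i \<in> B - A \<Longrightarrow> f i = 0"
  shows "L2_set f B = L2_set f A"
  unfolding L2_set_def using assms by (intro arg_cong[where f=sqrt] sum.mono_neutral_right) auto

lemma sum_abs_le_sqrt_card_L2:
  assumes "finite A"
  shows "(\<Sum>i\<in>A. \<bar>f i\<bar>) \<le> sqrt (real (card A)) * L2_set f A"
  using L2_set_mult_ineq[where A=A and f="\<lambda>_. 1::real" and g=f] assms by (simp add: L2_set_def)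

lemma L2_set_le_const:
  assumes "finite A" "\<And>i. i \<in> A \<Longrightarrow> \<bar>f i\<bar> \<le> c" "0 \<le> c"
  shows "L2_set f A \<le> sqrt (real (card A)) * c"
proof -
  have "L2_set f A \<le> L2_set (\<lambda>_. c) A"
    using assms by (intro L2_set_mono_abs) auto
  also have "\<dots> = sqrt (real (card A)) * c"
    using assms by (simp add: L2_set_def real_sqrt_mult)
  finally show ?thesis .
qed

section \<open>Seminorms on functions with finite support\<close>

lemma fun_seminormD:
  assumes "fun_seminorm q"
  shows "q (\<lambda>i. u i + v i) \<le> q u + q v" "q (\<lambda>i. c * u i) = \<bar>c\<bar> * q u"
  using assms by (auto simp: fun_seminorm_def)

lemma fun_seminorm_zero: "fun_seminorm q \<Longrightarrow> q (\<lambda>i. 0) = 0"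
  using fun_seminormD(2)[of q 0 "\<lambda>_. 0"] by simp

lemma fun_seminorm_nonneg: "fun_seminorm q \<Longrightarrow> 0 \<le> q u"
  using fun_seminormD(1)[of q u "\<lambda>i. -1 * u i"] fun_seminormD(2)[of q "-1" u] fun_seminorm_zero[of
    q]
  by simp

lemma fun_seminorm_sum:
  assumes "fun_seminorm q" "finite K"
  shows "q (\<lambda>i. \<Sum>k\<in>K. f k i) \<le> (\<Sum>k\<in>K. q (f k))"
  using assms(2)
proof induction
  case empty
  then show ?case using fun_seminorm_zero[OF assms(1)] by simp
next
  case (insert x F)
  have "q (\<lambda>i. f x i + (\<Sum>k\<in>F. f k i)) \<le> q (f x) + q (\<lambda>i. \<Sum>k\<in>F. f k i)"
    by (rule fun_seminormD(1)[OF assms(1)])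
  with insert show ?case by simp
qed

text \<open>Expansion in unit vectors. The size of \<open>M\<close> is irrelevant: it is only the
  finite starting value of the iteration in \<open>seminorm_le_of_net\<close>.\<close>

lemma fun_seminorm_bounded:
  assumes q: "fun_seminorm q" and S: "finite S"
  obtains M where "0 \<le> M" "\<And>w. (\<And>i. i \<notin> S \<Longrightarrow> w i = 0) \<Longrightarrow> q w \<le> M * L2_set w S"
proof
  let ?e = "\<lambda>k i. if i = k then 1 else 0 :: real"
  let ?M = "\<Sum>k\<in>S. q (?e k)"
  show "0 \<le> ?M" by (intro sum_nonneg fun_seminorm_nonneg[OF q])
  fix w :: "nat \<Rightarrow> real" assume w: "\<And>i. i \<notin> S \<Longrightarrow> w i = 0"
  have "w = (\<lambda>i. \<Sum>k\<in>S. w k * ?e k i)"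
    using w S by (auto simp: fun_eq_iff if_distrib[of "\<lambda>t. _ * t"] cong: if_cong)
  then have "q w = q (\<lambda>i. \<Sum>k\<in>S. w k * ?e k i)" by simp
  also have "\<dots> \<le> (\<Sum>k\<in>S. q (\<lambda>i. w k * ?e k i))"
    by (rule fun_seminorm_sum[OF q S])
  also have "\<dots> = (\<Sum>k\<in>S. \<bar>w k\<bar> * q (?e k))"
    by (simp only: fun_seminormD(2)[OF q])
  also have "\<dots> \<le> (\<Sum>k\<in>S. L2_set w S * q (?e k))"
  proof (intro sum_mono mult_right_mono fun_seminorm_nonneg[OF q])
    fix k assume "k \<in> S"
    then show "\<bar>w k\<bar> \<le> L2_set w S"
      using member_le_L2_set[of S k "\<lambda>i. \<bar>w i\<bar>"] S by (simp add: L2_set_def)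
  qed
  finally show "q w \<le> ?M * L2_set w S" by (simp add: sum_distrib_left mult.commute)
qed

section \<open>Rounding and integer-lattice nets\<close>

definition rnd :: "real \<Rightarrow> int" where
  "rnd t = (if 0 \<le> t then \<lfloor>t\<rfloor> else \<lceil>t\<rceil>)"

text \<open>The reason for rounding toward zero instead of to the nearest integer: a rounded vector
  is never longer than the original, so net and grid points stay in the unit ball.\<close>

lemma rnd_abs_le: "\<bar>real_of_int (rnd t)\<bar> \<le> \<bar>t\<bar>"
  unfolding rnd_def by (auto; linarith)

lemma rnd_diff_le: "\<bar>t - real_of_int (rnd t)\<bar> \<le> 1"
  unfolding rnd_def by (auto; linarith)

text \<open>A 1/2-net of the unit ball of the coordinate subspace of \<open>S\<close>.
  Cauchy-Schwarz turns the Euclidean ball, scaled by \<open>2 * sqrt (card S)\<close>, into the l1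
  constraint \<open>2 * card S\<close>, and an l1 constraint can be counted coordinate by
  coordinate. The surrounding box makes finiteness immediate.\<close>

definition lattice_net :: "nat set \<Rightarrow> (nat \<Rightarrow> real) set" where
  "lattice_net S = (\<lambda>z i. if i \<in> S then real_of_int (z i) / (2 * sqrt (real (card S))) else 0) `
     {z \<in> S \<rightarrow>\<^sub>E {- (2 * int (card S)) .. 2 * int (card S)}. (\<Sum>i\<in>S. \<bar>z i\<bar>) \<le> 2 * int (card S)}"

text \<open>The full series sums to 1 + 2 (1/2 + 1/4 + ...) = 3. Together with the price 2^2 = 4 per
  coordinate for the l1 budget this is the 12 of \<open>card_lattice_net\<close>.\<close>

lemma sum_half_powers_le: "(\<Sum>k\<in>{- int n .. int n}. (1/2::real) ^ nat \<bar>k\<bar>) \<le> 3"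
proof -
  have "(\<Sum>k\<in>{- int n .. int n}. (1/2::real) ^ nat \<bar>k\<bar>) = 3 - 2 * (1/2) ^ n"
  proof (induction n)
    case 0
    then show ?case by simp
  next
    case (Suc n)
    have "{- int (Suc n) .. int (Suc n)} = insert (- int (Suc n)) (insert (int (Suc n)) {- int n
      .. int n})"
      by auto
    then have "(\<Sum>k\<in>{- int (Suc n) .. int (Suc n)}. (1/2::real) ^ nat \<bar>k\<bar>)
      = (1/2) ^ Suc n + ((1/2) ^ Suc n + (3 - 2 * (1/2) ^ n))"
      using Suc by (simp add: nat_add_distrib)
    then show ?case by simp
  qed
  then show ?thesis by simp
qed

lemma finite_lattice_net: "finite S \<Longrightarrow> finite (lattice_net S)"
  unfolding lattice_net_def
  by (rule finite_imageI, rule finite_subset[OF _ finite_PiE[of S "\<lambda>_. {- (2 * int (card S))..2 *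
    int (card S)}"]]) auto

text \<open>Weighting the integer point \<open>z\<close> by \<open>2 ^ (- \<bar>z\<bar>\<^sub>1)\<close> turns the count into a product of
  geometric sums.\<close>

lemma card_lattice_net:
  assumes S: "finite S"
  shows "real (card (lattice_net S)) \<le> 12 ^ card S"
proof -
  let ?n = "card S"
  let ?Z = "{z \<in> S \<rightarrow>\<^sub>E {- (2 * int ?n) .. 2 * int ?n}. (\<Sum>i\<in>S. \<bar>z i\<bar>) \<le> 2 * int ?n}"
  let ?B = "S \<rightarrow>\<^sub>E {- (2 * int ?n) .. 2 * int ?n}"
  have fB: "finite ?B" using S by (intro finite_PiE) auto
  have "real (card ?Z) * (1/2) ^ (2 * ?n) = (\<Sum>z\<in>?Z. (1/2::real) ^ (2 * ?n))" by simp
  also have "\<dots> \<le> (\<Sum>z\<in>?Z. \<Prod>i\<in>S. (1/2) ^ nat \<bar>z i\<bar>)"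
  proof (intro sum_mono)
    fix z assume z: "z \<in> ?Z"
    have "int (\<Sum>i\<in>S. nat \<bar>z i\<bar>) = (\<Sum>i\<in>S. \<bar>z i\<bar>)" by simp
    moreover have "(\<Sum>i\<in>S. \<bar>z i\<bar>) \<le> 2 * int ?n" using z by blast
    ultimately have le: "(\<Sum>i\<in>S. nat \<bar>z i\<bar>) \<le> 2 * ?n" by linarith
    have "(1/2::real) ^ (2 * ?n) \<le> (1/2) ^ (\<Sum>i\<in>S. nat \<bar>z i\<bar>)"
      using le by (intro power_decreasing) auto
    then show "(1/2::real) ^ (2 * ?n) \<le> (\<Prod>i\<in>S. (1/2) ^ nat \<bar>z i\<bar>)"
      by (simp add: power_sum)
  qed
  also have "\<dots> \<le> (\<Sum>z\<in>?B. \<Prod>i\<in>S. (1/2) ^ nat \<bar>z i\<bar>)"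
    by (intro sum_mono2 fB) (auto intro!: prod_nonneg)
  also have "\<dots> = (\<Prod>i\<in>S. \<Sum>k\<in>{- (2 * int ?n) .. 2 * int ?n}. (1/2::real) ^ nat \<bar>k\<bar>)"
    using prod_sum_PiE[of S "\<lambda>_. {- (2 * int ?n) .. 2 * int ?n}" "\<lambda>_ k. (1/2::real) ^ nat \<bar>k\<bar>"] S
    by simp
  also have "\<dots> \<le> (\<Prod>i\<in>S. 3)"
    using sum_half_powers_le[of "2 * ?n"] by (intro prod_mono conjI sum_nonneg) auto
  finally have le: "real (card ?Z) * (1/2) ^ (2 * ?n) \<le> 3 ^ ?n" by simp
  have four: "(1/2::real) ^ (2 * ?n) = (1/4) ^ ?n" by (simp only: power_mult) (simp add:
    power2_eq_square)
  have "(1/4::real) ^ ?n * 4 ^ ?n = 1" by (simp only: power_mult_distrib[symmetric]) simp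
  then have "real (card ?Z) = (real (card ?Z) * (1/4) ^ ?n) * 4 ^ ?n" by (simp only: mult.assoc)
  also have "\<dots> \<le> 3 ^ ?n * 4 ^ ?n" using le unfolding four by (intro mult_right_mono) auto
  also have "\<dots> = (12::real) ^ ?n" by (simp only: power_mult_distrib[symmetric]) simp
  finally have Z: "real (card ?Z) \<le> 12 ^ ?n" .
  have "card (lattice_net S) \<le> card ?Z"
    unfolding lattice_net_def by (intro card_image_le finite_subset[OF _ fB]) auto
  then have "real (card (lattice_net S)) \<le> real (card ?Z)" by (rule of_nat_mono)
  then show ?thesis using Z by (rule order_trans)
qed

lemma lattice_net_supp: "w \<in> lattice_net S \<Longrightarrow> i \<notin> S \<Longrightarrow> w i = 0"
  unfolding lattice_net_def by (elim imageE) (simp only: if_False)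

text \<open>Rounding moves each coordinate by at most \<open>1 / (2 * sqrt (card S))\<close>, hence
  the whole vector by at most 1/2. That \<open>w'\<close> is no longer than \<open>w\<close> allows
  net estimates that are proportional to the norm.\<close>

lemma lattice_net_approx:
  assumes S: "finite S" "S \<noteq> {}" and w: "\<And>i. i \<notin> S \<Longrightarrow> w i = 0" "L2_set w S \<le> 1"
  obtains w' where "w' \<in> lattice_net S" "L2_set w' S \<le> L2_set w S" "L2_set (\<lambda>i. w i - w' i) S \<le> 1/2"
proof -
  define n where "n = card S"
  have n: "n > 0" using S by (auto simp: n_def card_gt_0_iff)
  define c where "c = 2 * sqrt (real n)"
  have c: "c > 0" using n by (auto simp: c_def)
  define z where "z = (\<lambda>i\<in>S. rnd (c * w i))"
  have zle: "\<bar>real_of_int (z i)\<bar> \<le> c * \<bar>w i\<bar>" if "i \<in> S" for i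
    using rnd_abs_le[of "c * w i"] that c by (simp add: z_def abs_mult)
  have "(\<Sum>i\<in>S. \<bar>real_of_int (z i)\<bar>) \<le> (\<Sum>i\<in>S. c * \<bar>w i\<bar>)"
    by (intro sum_mono zle)
  also have "\<dots> = c * (\<Sum>i\<in>S. \<bar>w i\<bar>)" by (simp add: sum_distrib_left)
  also have "\<dots> \<le> c * (sqrt (real n) * 1)"
    by (intro mult_left_mono order_trans[OF sum_abs_le_sqrt_card_L2[OF S(1)]])
      (use w(2) c mult_left_mono[OF w(2), of "sqrt (real (card S))"] in \<open>auto simp: n_def\<close>)
  also have "\<dots> = 2 * real n" by (simp add: c_def)
  finally have "real_of_int (\<Sum>i\<in>S. \<bar>z i\<bar>) \<le> real_of_int (2 * int n)" by simp
  then have zsum: "(\<Sum>i\<in>S. \<bar>z i\<bar>) \<le> 2 * int n" by linarith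
  have zi: "\<bar>z i\<bar> \<le> 2 * int n" if "i \<in> S" for i
    using member_le_sum[of i S "\<lambda>i. \<bar>z i\<bar>"] S(1) that zsum by auto
  have zPi: "z \<in> S \<rightarrow>\<^sub>E {- (2 * int n) .. 2 * int n}"
  proof (intro PiE_I)
    fix i assume "i \<in> S" then show "z i \<in> {- (2 * int n) .. 2 * int n}" using zi[of i] by auto
  qed (simp add: z_def)
  define w' where "w' = (\<lambda>i. if i \<in> S then real_of_int (z i) / c else 0)"
  have 1: "w' \<in> lattice_net S"
    using zPi zsum unfolding w'_def lattice_net_def c_def n_def by (intro image_eqI[where x=z]) auto
  have 2: "L2_set w' S \<le> L2_set w S"
    using zle c by (intro L2_set_mono_abs) (auto simp: w'_def abs_divide field_simps)
  have "\<bar>w i - w' i\<bar> \<le> 1 / c" if "i \<in> S" for i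
  proof -
    have "\<bar>c * w i - real_of_int (z i)\<bar> \<le> 1" using rnd_diff_le[of "c * w i"] that by (simp add:
      z_def)
    then have "\<bar>c * (w i - w' i)\<bar> \<le> 1" using c that by (simp add: w'_def algebra_simps)
    then have "c * \<bar>w i - w' i\<bar> \<le> 1" using c by (simp only: abs_mult abs_of_pos)
    then show ?thesis using c by (simp add: field_simps)
  qed
  then have "L2_set (\<lambda>i. w i - w' i) S \<le> sqrt (real (card S)) * (1 / c)"
    using c by (intro L2_set_le_const S(1)) auto
  also have "\<dots> = 1/2" using n by (simp add: c_def n_def[symmetric])
  finally show ?thesis using 1 2 that by blast
qed

text \<open>If a bound C holds on the unit ball, then so does K + C / 2: the net point costs K, the
  remainder has norm at most 1/2. The fixed point of this improvement is 2 K.\<close>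

lemma seminorm_le_of_net:
  assumes q: "fun_seminorm q" and S: "finite S" and K: "0 \<le> K"
    and net: "\<And>w. w \<in> lattice_net S \<Longrightarrow> q w \<le> K * L2_set w S"
    and w: "\<And>i. i \<notin> S \<Longrightarrow> w i = 0"
  shows "q w \<le> 2 * K * L2_set w S"
proof (cases "S = {}")
  case True
  then have "w = (\<lambda>_. 0)" using w by auto
  then show ?thesis using fun_seminorm_zero[OF q] True by simp
next
  case False
  obtain M where M: "0 \<le> M" "\<And>w. (\<And>i. i \<notin> S \<Longrightarrow> w i = 0) \<Longrightarrow> q w \<le> M * L2_set w S"
    using fun_seminorm_bounded[OF q S] by blast
  \<comment> \<open>The excess of the constant over its fixed point \<open>2 * K\<close> is halved
    at each round; \<open>n = 0\<close> is the crude bound \<open>M\<close>.\<close>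
  have step: "\<forall>w. (\<forall>i. i \<notin> S \<longrightarrow> w i = 0) \<longrightarrow> q w \<le> (2 * K + M * (1/2) ^ n) * L2_set w S" for n
  proof (induction n)
    case 0
    show ?case
    proof (intro allI impI)
      fix w :: "nat \<Rightarrow> real" assume "\<forall>i. i \<notin> S \<longrightarrow> w i = 0"
      then have "q w \<le> M * L2_set w S" using M(2) by blast
      also have "\<dots> \<le> (2 * K + M * (1/2) ^ 0) * L2_set w S"
        using K by (intro mult_right_mono) auto
      finally show "q w \<le> (2 * K + M * (1/2) ^ 0) * L2_set w S" .
    qed
  next
    case (Suc n)
    let ?C = "2 * K + M * (1/2) ^ n"
    show ?case
    proof (intro allI impI)
      fix w :: "nat \<Rightarrow> real" assume w: "\<forall>i. i \<notin> S \<longrightarrow> w i = 0"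
      define t where "t = L2_set w S"
      have t0: "0 \<le> t" by (simp add: t_def)
      show "q w \<le> (2 * K + M * (1/2) ^ Suc n) * L2_set w S"
      proof (cases "t = 0")
        case True
        have "q w \<le> M * t" using M(2)[of w] w unfolding t_def by blast
        then show ?thesis using True by (simp add: t_def[symmetric])
      next
        case False
        with t0 have t: "t > 0" by simp
        define v where "v = (\<lambda>i. (1/t) * w i)"
        have v0: "v i = 0" if "i \<notin> S" for i using w that by (simp add: v_def)
        have vn: "L2_set v S = 1" using t unfolding v_def L2_set_scale by (simp add:
          t_def[symmetric])
        obtain v' where v': "v' \<in> lattice_net S" "L2_set v' S \<le> L2_set v S" "L2_set (\<lambda>i. v i - v'
          i) S \<le> 1/2"
          by (rule lattice_net_approx[OF S \<open>S \<noteq> {}\<close>, of v]) (use v0 vn in auto)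
        have C0: "0 \<le> ?C" using K M(1) by auto
        have "q v = q (\<lambda>i. v' i + (v i - v' i))" by simp
        also have "\<dots> \<le> q v' + q (\<lambda>i. v i - v' i)" by (rule fun_seminormD(1)[OF q])
        also have "q v' \<le> K * 1"
          using order_trans[OF net[OF v'(1)] mult_left_mono[OF v'(2) K]] vn by simp
        also have "q (\<lambda>i. v i - v' i) \<le> ?C * L2_set (\<lambda>i. v i - v' i) S"
          using Suc.IH v0 lattice_net_supp[OF v'(1)] by auto
        also have "\<dots> \<le> ?C * (1/2)" using v'(3) C0 by (intro mult_left_mono) auto
        finally have qv: "q v \<le> 2 * K + M * (1/2) ^ Suc n" by (simp add: algebra_simps)
        have "w = (\<lambda>i. t * v i)" using t by (auto simp: v_def)
        then have "q w = t * q v" using fun_seminormD(2)[OF q, of t v] t by simp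
        also have "\<dots> \<le> t * (2 * K + M * (1/2) ^ Suc n)" using qv t by (intro mult_left_mono) auto
        finally show ?thesis by (simp add: t_def[symmetric] mult.commute)
      qed
    qed
  qed
  have "(\<lambda>n. (2 * K + M * (1/2) ^ n) * L2_set w S) \<longlonglongrightarrow> (2 * K + M * 0) * L2_set w S"
    by (intro tendsto_intros LIMSEQ_power_zero) auto
  moreover have "q w \<le> (2 * K + M * (1/2) ^ n) * L2_set w S" for n
    using step w by blast
  ultimately have "q w \<le> (2 * K + M * 0) * L2_set w S"
    by (intro LIMSEQ_le_const) auto
  then show ?thesis by simp
qed

text \<open>Cutting \<open>w\<close> into at most \<open>2m/s\<close> blocks costs a factor \<open>sqrt (2m/s)\<close> by Cauchy-Schwarz.\<close>

lemma seminorm_dense_of_sparse: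
  assumes q: "fun_seminorm q" and s: "0 < s" "s \<le> m" and K: "0 \<le> K"
    and sparse: "\<And>S w. S \<subseteq> {..<m} \<Longrightarrow> card S \<le> s \<Longrightarrow> (\<And>i. i \<notin> S \<Longrightarrow> w i = 0) \<Longrightarrow> q w \<le> K * nrm m w"
    and w: "\<And>i. m \<le> i \<Longrightarrow> w i = 0"
  shows "q w \<le> K * sqrt (2 * real m / real s) * nrm m w"
proof -
  \<comment> \<open>The blocks are the index ranges with constant \<open>i div s\<close>; as
    \<open>m\<close> is positive, \<open>N\<close> is m / s rounded up, and \<open>s \<le> m\<close>
    bounds it by 2 m / s.\<close>
  define N where "N = Suc ((m - 1) div s)"
  define B where "B = (\<lambda>k. {i. i < m \<and> i div s = k})"
  have Bsub: "B k \<subseteq> {k * s..<k * s + s}" for k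
  proof
    fix i assume "i \<in> B k"
    then have "i div s = k" by (simp add: B_def)
    then show "i \<in> {k * s..<k * s + s}"
      using s div_mult_mod_eq[of i s] mod_less_divisor[OF s(1), of i]
      by (simp only: atLeastLessThan_iff) linarith
  qed
  have Bcard: "card (B k) \<le> s" for k
    using card_mono[OF _ Bsub[of k]] by simp
  have Bm: "B k \<subseteq> {..<m}" for k by (auto simp: B_def)
  have fB: "finite (B k)" for k using Bm by (rule finite_subset) simp
  let ?w = "\<lambda>k i. if i \<in> B k then w i else 0"
  have "w i = (\<Sum>k<N. ?w k i)" for i
  proof (cases "i < m")
    case True
    then have "i div s < N" unfolding N_def using div_le_mono[of i "m - 1" s] by linarith
    then have "(\<Sum>k<N. ?w k i) = (\<Sum>k\<in>{i div s}. ?w k i)"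
      by (intro sum.mono_neutral_right) (auto simp: B_def)
    then show ?thesis using True by (simp add: B_def)
  next
    case False
    then show ?thesis using w by (simp add: B_def)
  qed
  then have weq: "w = (\<lambda>i. \<Sum>k<N. ?w k i)" by (rule ext)
  have sq: "(\<Sum>k<N. (nrm m (?w k))\<^sup>2) = (nrm m w)\<^sup>2"
  proof -
    have "(\<Sum>k<N. (nrm m (?w k))\<^sup>2) = (\<Sum>k<N. \<Sum>i<m. (?w k i)\<^sup>2)"
      by (simp add: L2_set_def sum_nonneg)
    also have "\<dots> = (\<Sum>i<m. \<Sum>k<N. (?w k i)\<^sup>2)" by (rule sum.swap)
    also have "\<dots> = (\<Sum>i<m. (w i)\<^sup>2)"
    proof (intro sum.cong refl)
      fix i assume "i \<in> {..<m}"
      then have i: "i < m" by simp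
      then have "i div s < N" unfolding N_def using div_le_mono[of i "m - 1" s] by linarith
      then have "(\<Sum>k<N. (?w k i)\<^sup>2) = (\<Sum>k\<in>{i div s}. (?w k i)\<^sup>2)"
        by (intro sum.mono_neutral_right) (auto simp: B_def)
      then show "(\<Sum>k<N. (?w k i)\<^sup>2) = (w i)\<^sup>2" using i by (simp add: B_def)
    qed
    finally show ?thesis by (simp add: L2_set_def sum_nonneg)
  qed
  have "q w \<le> (\<Sum>k<N. q (?w k))"
    by (subst weq) (rule fun_seminorm_sum[OF q], simp)
  also have "\<dots> \<le> (\<Sum>k<N. K * nrm m (?w k))"
    by (intro sum_mono sparse[OF Bm Bcard]) auto
  also have "\<dots> = K * (\<Sum>k<N. \<bar>nrm m (?w k)\<bar>)" by (simp add: sum_distrib_left)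
  also have "\<dots> \<le> K * (sqrt (real N) * L2_set (\<lambda>k. nrm m (?w k)) {..<N})"
    using sum_abs_le_sqrt_card_L2[of "{..<N}" "\<lambda>k. nrm m (?w k)"] K by (intro mult_left_mono) auto
  also have "L2_set (\<lambda>k. nrm m (?w k)) {..<N} = nrm m w"
    unfolding L2_set_def[of "\<lambda>k. nrm m (?w k)"] sq by simp
  also have "K * (sqrt (real N) * nrm m w) \<le> K * (sqrt (2 * real m / real s) * nrm m w)"
  proof (intro mult_left_mono mult_right_mono real_sqrt_le_mono K)
    have "real ((m - 1) div s) \<le> real (m - 1) / real s"
      by (rule of_nat_div_le_of_nat)
    also have "\<dots> \<le> real m / real s - 1 / real s" using s by (simp add: field_simps)
    finally have "real N \<le> 1 + real m / real s" unfolding N_def using s by (simp add: field_simps)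
    also have "\<dots> \<le> 2 * real m / real s" using s by (simp add: field_simps)
    finally show "real N \<le> 2 * real m / real s" .
  qed auto
  finally show ?thesis by (simp add: mult.assoc)
qed

section \<open>Perturbed activations of a well-behaved network\<close>

text \<open>The network on total functions, so that weights, perturbations and inputs lie in fixed
  function spaces with a product topology. Entries beyond a layer's width are junk;
  \<open>dotp\<close> and \<open>nrm\<close> cut them off.\<close>

primrec act :: "nat \<Rightarrow> nat \<Rightarrow> (nat \<Rightarrow> nat \<Rightarrow> nat \<Rightarrow> real) \<Rightarrow> (nat \<Rightarrow> real) \<Rightarrow> nat \<Rightarrow> nat \<Rightarrow> real" where
  "act d m A x 0 = x"
| "act d m A x (Suc l) =
    (\<lambda>r. sqrt (2 / real m) * relu (dotp (fan_in d m (Suc l)) (A (Suc l) r) (act d m A x l)))"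

text \<open>\<open>lin d m A x a w b\<close> inserts \<open>w\<close> after layer \<open>a\<close> and propagates it to layer \<open>b\<close> through the
  network linearised at the input \<open>x\<close>.\<close>

primrec lin :: "nat \<Rightarrow> nat \<Rightarrow> (nat \<Rightarrow> nat \<Rightarrow> nat \<Rightarrow> real) \<Rightarrow> (nat \<Rightarrow> real) \<Rightarrow> nat \<Rightarrow> (nat \<Rightarrow> real) \<Rightarrow>
    nat \<Rightarrow> nat \<Rightarrow> real" where
  "lin d m A x a w 0 = w"
| "lin d m A x a w (Suc b) = (if Suc b \<le> a then w else
    (\<lambda>r. sqrt (2 / real m) * (if dotp (fan_in d m (Suc b)) (A (Suc b) r) (act d m A x b) > 0
       then dotp m (A (Suc b) r) (lin d m A x a w b) else 0)))"

section \<open>Linearity of the linearised propagation\<close>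

lemma lin_le: "b \<le> a \<Longrightarrow> lin d m A x a w b = w"
  by (cases b) auto

lemma dotp_add: "dotp n u (\<lambda>i. v i + w i) = dotp n u v + dotp n u w"
  by (simp add: dotp_def algebra_simps sum.distrib)

lemma dotp_diff: "dotp n u (\<lambda>i. v i - w i) = dotp n u v - dotp n u w"
  by (simp add: dotp_def algebra_simps sum_subtractf)

lemma dotp_scale: "dotp n u (\<lambda>i. c * v i) = c * dotp n u v"
  by (simp add: dotp_def algebra_simps sum_distrib_left)

lemma dotp_sum: "dotp n u (\<lambda>i. \<Sum>k\<in>K. f k i) = (\<Sum>k\<in>K. dotp n u (f k))"
  unfolding dotp_def sum_distrib_left by (rule sum.swap)

lemma dotp_cong: "(\<And>j. j < n \<Longrightarrow> u j = u' j) \<Longrightarrow> (\<And>j. j < n \<Longrightarrow> v j = v' j) \<Longrightarrow> dotp n u v = dotp n u' v'"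
  by (simp add: dotp_def)

lemma dotp_zero_right: "(\<And>j. j < n \<Longrightarrow> v j = 0) \<Longrightarrow> dotp n u v = 0"
  by (simp add: dotp_def)

lemma lin_add: "lin d m A x a (\<lambda>i. u i + v i) b = (\<lambda>i. lin d m A x a u b i + lin d m A x a v b i)"
  by (induction b) (auto simp: dotp_add algebra_simps)

lemma lin_scale: "lin d m A x a (\<lambda>i. c * v i) b = (\<lambda>i. c * lin d m A x a v b i)"
  by (induction b) (auto simp: dotp_scale algebra_simps)

lemma fun_seminorm_lin: "fun_seminorm (\<lambda>w. L2_set (lin d m A x a w b) T)"
  unfolding fun_seminorm_def lin_add lin_scale L2_set_scale by (auto intro: L2_set_triangle_ineq)

lemma fun_seminorm_lin_rows: "fun_seminorm (\<lambda>w. L2_set (\<lambda>r. dotp n (B r) (lin d m A x a w b)) T)"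
  unfolding fun_seminorm_def lin_add lin_scale dotp_add dotp_scale L2_set_scale
  by (auto intro: L2_set_triangle_ineq)

lemma fun_seminorm_rows: "fun_seminorm (\<lambda>w. L2_set (\<lambda>r. dotp n (B r) w) T)"
  unfolding fun_seminorm_def dotp_add dotp_scale L2_set_scale
  by (auto intro: L2_set_triangle_ineq)

lemma L2_set_sum_le:
  fixes f :: "'k \<Rightarrow> nat \<Rightarrow> real"
  assumes "finite K"
  shows "L2_set (\<lambda>i. \<Sum>k\<in>K. f k i) T \<le> (\<Sum>k\<in>K. L2_set (f k) T)"
proof -
  have "fun_seminorm (\<lambda>w. L2_set w T)"
    unfolding fun_seminorm_def L2_set_scale by (auto intro: L2_set_triangle_ineq)
  from fun_seminorm_sum[OF this assms] show ?thesis .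
qed

lemma relu_diff_le: "\<bar>relu (t + p) - relu t\<bar> \<le> \<bar>p\<bar>"
  by (auto simp: relu_def max_def)

text \<open>An increment smaller than the argument cannot change its sign, and ReLU is exactly
  linear on either side of 0. This is what makes the errors sparse.\<close>

lemma relu_linearisation_error:
  "\<bar>relu (t + b) - relu t - (if 0 < t then b else 0)\<bar> \<le> \<bar>b\<bar>"
  "\<bar>b\<bar> < \<bar>t\<bar> \<Longrightarrow> relu (t + b) - relu t - (if 0 < t then b else 0) = 0"
  by (auto simp: relu_def max_def)

text \<open>What the deterministic argument needs at one input. \<open>E\<close> is the budget of
  one layer, \<open>8 * L * E \<le> 1\<close> keeps the perturbed activations below norm 3, and the
  inequality for \<open>\<beta>\<close> says that preactivation shifts of total energy
  \<open>m / 2 * E^2\<close> can reach \<open>\<beta>\<close> on at most s / 2 units.\<close>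

locale good_weights =
  fixes d m L s :: nat and A :: "nat \<Rightarrow> nat \<Rightarrow> nat \<Rightarrow> real" and x :: "nat \<Rightarrow> real"
    and \<beta> E R :: real
  assumes m: "0 < m" and s: "0 < s" "s \<le> m" and L: "2 \<le> L" and R: "0 \<le> R"
    and E: "E = 6 * R / sqrt (real s)" "8 * real L * E \<le> 1"
    and \<beta>: "0 \<le> \<beta>" "real m * E\<^sup>2 \<le> \<beta>\<^sup>2 * real s"
    and act_le: "\<And>l. l < L \<Longrightarrow> nrm (fan_in d m (Suc l)) (act d m A x l) \<le> 2"
    and lin_sparse: "\<And>a b S w. 1 \<le> a \<Longrightarrow> a \<le> b \<Longrightarrow> b < L \<Longrightarrow> S \<subseteq> {..<m} \<Longrightarrow> card S \<le> s \<Longrightarrow>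
      (\<And>i. i \<notin> S \<Longrightarrow> w i = 0) \<Longrightarrow> nrm m (lin d m A x a w b) \<le> 4 * nrm m w"
    and rows_sparse: "\<And>a b S T w. 1 \<le> a \<Longrightarrow> a < b \<Longrightarrow> b < L \<Longrightarrow> S \<subseteq> {..<m} \<Longrightarrow> card S \<le> s \<Longrightarrow>
      T \<subseteq> {..<m} \<Longrightarrow> card T \<le> s \<Longrightarrow> (\<And>i. i \<notin> S \<Longrightarrow> w i = 0) \<Longrightarrow>
      L2_set (\<lambda>r. dotp m (A b r) (lin d m A x a w (b - 1))) T \<le> sqrt (real m / 2) / (2 * real L) *
        nrm m w"
    and few_small: "\<And>b. 1 \<le> b \<Longrightarrow> b < L \<Longrightarrow>
      2 * card {r. r < m \<and> \<bar>dotp (fan_in d m b) (A b r) (act d m A x (b - 1))\<bar> < \<beta>} \<le> s"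
begin

abbreviation "h0 \<equiv> act d m A x"

lemma E_nonneg: "0 \<le> E"
  using E R by simp

text \<open>The perturbation enters as an additive term \<open>p\<close> of the preactivations, not
  as a change of weights, so that a shift of the input can be absorbed into \<open>p 1\<close>; this
  is why \<open>p 1\<close> is allowed \<open>2 * R\<close>.\<close>

lemma perturbed_close:
  fixes h p :: "nat \<Rightarrow> nat \<Rightarrow> real"
  assumes h0: "\<And>j. j < d \<Longrightarrow> h 0 j = x j"
    and hS: "\<And>l r. Suc l < L \<Longrightarrow> r < m \<Longrightarrow>
      h (Suc l) r = sqrt (2 / real m) * relu (dotp (fan_in d m (Suc l)) (A (Suc l) r) (h l) + p
        (Suc l) r)"
    and p1: "nrm m (p 1) \<le> 2 * R"
    and pS: "\<And>l. 1 \<le> l \<Longrightarrow> Suc l < L \<Longrightarrow> nrm m (p (Suc l)) \<le> R * nrm m (h l)"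
    and l: "1 \<le> l" "l < L"
  shows "nrm m (\<lambda>r. h l r - h0 l r) \<le> 8 * real L * E"
proof -
  define c where "c = sqrt (2 / real m)"
  have c: "c > 0" using m by (simp add: c_def)
  define g where "g = (\<lambda>l r. h l r - h0 l r)"
  \<comment> \<open>\<open>al\<close> is the initial preactivation and \<open>be\<close> the shift
    inherited from the layers below.\<close>
  define al where "al = (\<lambda>l r. dotp (fan_in d m l) (A l r) (h0 (l - 1)))"
  define be where "be = (\<lambda>l r. dotp (fan_in d m l) (A l r) (g (l - 1)))"
  \<comment> \<open>\<open>q\<close> is the effect of the fresh perturbation and \<open>e\<close>
    the linearisation error. Both are cut off at \<open>m\<close>, because the estimates for sparse
    vectors require genuine supports inside \<open>{..<m}\<close>.\<close>
  define q where "q = (\<lambda>l r. if r < m then c * (relu (al l r + be l r + p l r) - relu (al l r + be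
    l r)) else 0)"
  define e where "e = (\<lambda>l r. if r < m then c * (relu (al l r + be l r) - relu (al l r) - (if 0 <
    al l r then be l r else 0)) else 0)"
  define f where "f = (\<lambda>l r. e l r + q l r)"
  \<comment> \<open>Both networks start from the same input, so the first layer inherits no
    shift.\<close>
  have be1: "be 1 r = 0" for r
    unfolding be_def by (rule dotp_zero_right) (use h0 in \<open>auto simp: g_def fan_in_def\<close>)
  have g_step: "g (Suc k) r = c * (if 0 < al (Suc k) r then be (Suc k) r else 0) + f (Suc k) r"
    if "Suc k < L" "r < m" for k r
  proof -
    have "dotp (fan_in d m (Suc k)) (A (Suc k) r) (h k) = al (Suc k) r + be (Suc k) r"
      unfolding al_def be_def g_def by (simp add: dotp_diff)
    then show ?thesis
      using hS[OF that] that
      by (simp add: g_def f_def e_def q_def c_def[symmetric] al_def algebra_simps)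
  qed
  \<comment> \<open>Discrete variation of constants: unrolling the affine recursion
    \<open>g_step\<close>, every source term \<open>f a\<close> is carried by the linearised network
    from layer \<open>a\<close> to layer \<open>k\<close>.\<close>
  have decomp: "g k r = (\<Sum>a\<in>{1..k}. lin d m A x a (f a) k r)"
    if "1 \<le> k" "k < L" "r < m" for k r
    using that
  proof (induction k arbitrary: r rule: nat_induct_at_least)
    case base
    show ?case using g_step[of 0 r] base be1 L by (simp add: lin_le)
  next
    case (Suc k)
    have "be (Suc k) r = dotp m (A (Suc k) r) (g k)"
      using Suc.hyps by (simp add: be_def fan_in_def)
    also have "\<dots> = dotp m (A (Suc k) r) (\<lambda>j. \<Sum>a\<in>{1..k}. lin d m A x a (f a) k j)"
      using Suc by (intro dotp_cong) auto
    also have "\<dots> = (\<Sum>a\<in>{1..k}. dotp m (A (Suc k) r) (lin d m A x a (f a) k))"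
      by (rule dotp_sum)
    finally have be: "be (Suc k) r = (\<Sum>a\<in>{1..k}. dotp m (A (Suc k) r) (lin d m A x a (f a) k))" .
    have "c * (if 0 < al (Suc k) r then be (Suc k) r else 0) = (\<Sum>a\<in>{1..k}. lin d m A x a (f a)
      (Suc k) r)"
      unfolding be by (auto simp: sum_distrib_left c_def al_def intro!: sum.cong)
    then show ?case
      using g_step[of k r] Suc.prems Suc.hyps by (simp add: lin_le)
  qed
  let ?Q = "c * (3 * R)"
  \<comment> \<open>The origin of \<open>E\<close>: it is the size 3 R sqrt (2 / m) of a fresh
    effect times the Cauchy-Schwarz loss sqrt (2 m / s) of the block splitting.\<close>
  have QE: "sqrt (2 * real m / real s) * ?Q = E"
  proof -
    have "sqrt (2 * real m / real s) * c = sqrt (4 / real s)"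
      using m s by (simp add: c_def real_sqrt_mult[symmetric])
    also have "\<dots> = 2 / sqrt (real s)" by (simp add: real_sqrt_divide)
    finally show ?thesis by (simp add: E mult.assoc[symmetric])
  qed
  have q_le: "nrm m (q k) \<le> c * nrm m (p k)" for k
  proof -
    have "nrm m (q k) \<le> nrm m (\<lambda>r. c * p k r)"
      using c relu_diff_le by (intro L2_set_mono_abs) (auto simp: q_def abs_mult)
    then show ?thesis using c by (simp add: L2_set_scale)
  qed
  have cE: "c * sqrt (real m / 2) = 1"
    using m by (simp add: c_def real_sqrt_mult[symmetric])
  \<comment> \<open>One strong induction for all four facts. Within a layer the order is: fresh
    effect, inherited shift on any \<open>s\<close> rows, number of sign changes, error, total
    difference.\<close>
  have key: "nrm m (e k) \<le> E \<and> (\<exists>S\<subseteq>{..<m}. card S \<le> s \<and> (\<forall>i. i \<notin> S \<longrightarrow> e k i = 0)) \<and>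
      nrm m (q k) \<le> ?Q \<and> nrm m (g k) \<le> 8 * real L * E" if "1 \<le> k" "k < L" for k
    using that
  proof (induction k rule: less_induct)
    case (less k)
    have IHe: "nrm m (e a) \<le> E" "\<exists>S\<subseteq>{..<m}. card S \<le> s \<and> (\<forall>i. i \<notin> S \<longrightarrow> e a i = 0)"
      "nrm m (q a) \<le> ?Q" "nrm m (g a) \<le> 8 * real L * E" if "1 \<le> a" "a < k" for a
      using less.IH[of a] that less.prems by auto
    have p_le: "nrm m (p k) \<le> 3 * R"
    proof (cases "k = 1")
      case True
      then show ?thesis using p1 R by simp
    next
      case False
      then obtain j where j: "k = Suc j" "1 \<le> j" using less.prems by (cases k) auto
      have "nrm m (h j) = nrm m (\<lambda>r. h0 j r + g j r)" by (simp add: g_def)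
      also have "\<dots> \<le> nrm m (h0 j) + nrm m (g j)" by (rule L2_set_triangle_ineq)
      also have "\<dots> \<le> 2 + 1"
        using act_le[of j] IHe(4)[of j] E(2) j less.prems by (intro add_mono) (auto simp:
          fan_in_def)
      finally have "R * nrm m (h j) \<le> R * 3" using R by (intro mult_left_mono) auto
      then show ?thesis using pS[of j] j less.prems by simp
    qed
    have qk: "nrm m (q k) \<le> ?Q"
      by (rule order_trans[OF q_le mult_left_mono[OF p_le]]) (use c in simp)
    \<comment> \<open>Each earlier layer adds at most \<open>?K * (2 * E)\<close>, half from
      \<open>e a\<close> and half from \<open>q a\<close>. The factor \<open>2 * L\<close> in the
      denominator of \<open>?K\<close> absorbs both the 2 and the number of layers.\<close>
    have rows: "L2_set (be k) T \<le> sqrt (real m / 2) * E" if T: "T \<subseteq> {..<m}" "card T \<le> s" for T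
    proof (cases "k = 1")
      case True
      then show ?thesis using be1 E_nonneg by (simp add: L2_set_def)
    next
      case False
      then obtain j where j: "k = Suc j" "1 \<le> j" using less.prems by (cases k) auto
      let ?K = "sqrt (real m / 2) / (2 * real L)"
      let ?q = "\<lambda>a w. L2_set (\<lambda>r. dotp m (A k r) (lin d m A x a w j)) T"
      have K0: "0 \<le> ?K" by simp
      have sp: "?q a w \<le> ?K * nrm m w" if "a \<in> {1..j}" "S \<subseteq> {..<m}" "card S \<le> s" "\<And>i. i \<notin> S \<Longrightarrow> w i
        = 0" for a S w
        using rows_sparse[of a k S T w] that T j less.prems by auto
      have "L2_set (be k) T = L2_set (\<lambda>r. \<Sum>a\<in>{1..j}. dotp m (A k r) (lin d m A x a (f a) j)) T"
      proof (rule L2_set_cong[OF refl])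
        fix r assume "r \<in> T"
        have "be k r = dotp m (A k r) (g j)" using j by (simp add: be_def fan_in_def)
        also have "\<dots> = dotp m (A k r) (\<lambda>i. \<Sum>a\<in>{1..j}. lin d m A x a (f a) j i)"
          using decomp[of j] j less.prems by (intro dotp_cong) auto
        finally show "be k r = (\<Sum>a\<in>{1..j}. dotp m (A k r) (lin d m A x a (f a) j))"
          by (simp only: dotp_sum)
      qed
      also have "\<dots> \<le> (\<Sum>a\<in>{1..j}. ?q a (f a))" by (rule L2_set_sum_le) simp
      also have "\<dots> \<le> (\<Sum>a\<in>{1..j}. ?K * (2 * E))"
      proof (rule sum_mono)
        fix a assume a: "a \<in> {1..j}"
        have "?q a (f a) \<le> ?q a (e a) + ?q a (q a)"
          unfolding f_def by (rule fun_seminormD(1)[OF fun_seminorm_lin_rows])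
        also have "?q a (e a) \<le> ?K * nrm m (e a)"
          using IHe(2)[of a] a j sp[OF a] by auto
        also have "\<dots> \<le> ?K * E" using IHe(1)[of a] a j K0 by (intro mult_left_mono) auto
        also have "?q a (q a) \<le> ?K * sqrt (2 * real m / real s) * nrm m (q a)"
          by (rule seminorm_dense_of_sparse[OF fun_seminorm_lin_rows s K0])
            (use sp[OF a] in \<open>auto simp: q_def\<close>)
        also have "\<dots> \<le> ?K * sqrt (2 * real m / real s) * ?Q"
          using IHe(3)[of a] a j K0 by (intro mult_left_mono) auto
        also have "\<dots> = ?K * E" by (simp only: mult.assoc QE)
        finally show "?q a (f a) \<le> ?K * (2 * E)" by (simp add: algebra_simps)
      qed
      also have "\<dots> = real j * (?K * (2 * E))" by simp
      also have "\<dots> \<le> real L * (?K * (2 * E))"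
        using j less.prems E_nonneg by (intro mult_right_mono) auto
      also have "\<dots> = sqrt (real m / 2) * E" using L by simp
      finally show ?thesis .
    qed
    let ?T1 = "{r. r < m \<and> \<bar>al k r\<bar> < \<beta>}"
    \<comment> \<open>The condition \<open>be k r \<noteq> 0\<close> keeps the energy of a nonempty
      subset positive when \<open>\<beta>\<close> is 0, which the strict comparison below relies
      on.\<close>
    let ?T2 = "{r. r < m \<and> \<beta> \<le> \<bar>be k r\<bar> \<and> be k r \<noteq> 0}"
    have T2: "2 * card ?T2 \<le> s"
    proof (rule ccontr)
      assume "\<not> 2 * card ?T2 \<le> s"
      then have big: "s < 2 * card ?T2" by simp
      \<comment> \<open>The row estimate covers at most \<open>s\<close> rows, so a too large set is
        first thinned to between s / 2 and s rows.\<close>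
      obtain T where T: "T \<subseteq> ?T2" "card T \<le> s" "s < 2 * card T"
      proof (cases "card ?T2 \<le> s")
        case True
        then show ?thesis using that[of ?T2] big by auto
      next
        case False
        then obtain T where "T \<subseteq> ?T2" "card T = s"
          using obtain_subset_with_card_n[of s ?T2] by auto
        then show ?thesis using that[of T] s by auto
      qed
      have fT: "finite T" using T(1) by (rule finite_subset) simp
      have Tne: "T \<noteq> {}" using T(3) by auto
      have "(L2_set (be k) T)\<^sup>2 \<le> (sqrt (real m / 2) * E)\<^sup>2"
        using rows[of T] T by (intro power_mono) auto
      then have up: "(\<Sum>r\<in>T. (be k r)\<^sup>2) \<le> real m / 2 * E\<^sup>2"
        by (simp add: L2_set_def sum_nonneg power_mult_distrib)
      have pos: "0 < (\<Sum>r\<in>T. (be k r)\<^sup>2)"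
        using T(1) Tne fT by (intro sum_pos) auto
      have "real (card T) * \<beta>\<^sup>2 = (\<Sum>r\<in>T. \<beta>\<^sup>2)" by simp
      also have "\<dots> \<le> (\<Sum>r\<in>T. (be k r)\<^sup>2)"
      proof (rule sum_mono)
        fix r assume "r \<in> T"
        then have "\<beta> \<le> \<bar>be k r\<bar>" using T(1) by auto
        then have "\<beta>\<^sup>2 \<le> \<bar>be k r\<bar>\<^sup>2" using \<beta>(1) by (intro power_mono) auto
        then show "\<beta>\<^sup>2 \<le> (be k r)\<^sup>2" by simp
      qed
      finally have lo: "real (card T) * \<beta>\<^sup>2 \<le> real m / 2 * E\<^sup>2" using up by linarith
      have "\<beta>\<^sup>2 * real s < \<beta>\<^sup>2 * (2 * real (card T))"
      proof (rule mult_strict_left_mono)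
        show "real s < 2 * real (card T)" using T(3) by linarith
        have "0 < real m * E\<^sup>2" using pos up by linarith
        then have "0 < \<beta>\<^sup>2 * real s" using \<beta>(2) by linarith
        then show "0 < \<beta>\<^sup>2" using s by (simp add: zero_less_mult_iff)
      qed
      then show False using lo \<beta>(2) by (simp add: algebra_simps)
    qed
    \<comment> \<open>A superset of the sign changes. On it either \<open>al\<close> is below
      \<open>\<beta>\<close> or \<open>be\<close> is at least \<open>\<beta>\<close>, and each
      alternative accounts for at most s / 2 units.\<close>
    define S where "S = {r. r < m \<and> \<bar>al k r\<bar> \<le> \<bar>be k r\<bar> \<and> be k r \<noteq> 0}"
    have Sm: "S \<subseteq> {..<m}" by (auto simp: S_def)
    have "card S \<le> card (?T1 \<union> ?T2)" by (intro card_mono) (auto simp: S_def)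
    also have "\<dots> \<le> card ?T1 + card ?T2" by (rule card_Un_le)
    finally have Sc: "card S \<le> s"
      using T2 few_small[OF less.prems] unfolding al_def by linarith
    have eS: "e k i = 0" if "i \<notin> S" for i
    proof (cases "i < m \<and> be k i \<noteq> 0")
      case True
      then have "\<bar>be k i\<bar> < \<bar>al k i\<bar>" using that by (auto simp: S_def)
      then show ?thesis using relu_linearisation_error(2) by (simp add: e_def)
    next
      case False
      then show ?thesis by (auto simp: e_def)
    qed
    have "nrm m (e k) = L2_set (e k) S"
      by (rule L2_set_supp) (use Sm eS in auto)
    also have "\<dots> \<le> L2_set (\<lambda>r. c * be k r) S"
      using c relu_linearisation_error(1) by (intro L2_set_mono_abs) (auto simp: e_def abs_mult)
    also have "\<dots> = c * L2_set (be k) S" using c by (simp add: L2_set_scale)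
    also have "\<dots> \<le> c * (sqrt (real m / 2) * E)"
      using rows[OF Sm Sc] c by (intro mult_left_mono) auto
    also have "\<dots> = E" using cE by (simp add: mult.assoc[symmetric])
    finally have ek: "nrm m (e k) \<le> E" .
    have fa: "nrm m (e a) \<le> E" "\<exists>S\<subseteq>{..<m}. card S \<le> s \<and> (\<forall>i. i \<notin> S \<longrightarrow> e a i = 0)"
      "nrm m (q a) \<le> ?Q" if "a \<in> {1..k}" for a
    proof -
      have "a = k \<or> 1 \<le> a \<and> a < k" using that by auto
      then show "nrm m (e a) \<le> E" "\<exists>S\<subseteq>{..<m}. card S \<le> s \<and> (\<forall>i. i \<notin> S \<longrightarrow> e a i = 0)"
        "nrm m (q a) \<le> ?Q"
        using IHe[of a] ek qk Sm Sc eS by blast+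
    qed
    have "nrm m (g k) = nrm m (\<lambda>r. \<Sum>a\<in>{1..k}. lin d m A x a (f a) k r)"
      using decomp[of k] less.prems by (intro L2_set_cong) auto
    also have "\<dots> \<le> (\<Sum>a\<in>{1..k}. nrm m (lin d m A x a (f a) k))" by (rule L2_set_sum_le) simp
    \<comment> \<open>Four \<open>E\<close> from the sparse error directly, four from the fresh
      effect after the block splitting, where \<open>QE\<close> applies.\<close>
    also have "\<dots> \<le> (\<Sum>a\<in>{1..k}. 8 * E)"
    proof (rule sum_mono)
      fix a assume a: "a \<in> {1..k}"
      have sp: "nrm m (lin d m A x a w k) \<le> 4 * nrm m w"
        if "S \<subseteq> {..<m}" "card S \<le> s" "\<And>i. i \<notin> S \<Longrightarrow> w i = 0" for S w
        using lin_sparse[of a k S w] that a less.prems by auto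
      have "nrm m (lin d m A x a (f a) k) \<le> nrm m (lin d m A x a (e a) k) + nrm m (lin d m A x a
        (q a) k)"
        unfolding f_def by (rule fun_seminormD(1)[OF fun_seminorm_lin])
      also have "nrm m (lin d m A x a (e a) k) \<le> 4 * nrm m (e a)"
        using fa(2)[OF a] sp by auto
      also have "\<dots> \<le> 4 * E" using fa(1)[OF a] by simp
      also have "nrm m (lin d m A x a (q a) k) \<le> 4 * sqrt (2 * real m / real s) * nrm m (q a)"
        by (rule seminorm_dense_of_sparse[OF fun_seminorm_lin s, of 4])
          (use sp in \<open>auto simp: q_def\<close>)
      also have "\<dots> \<le> 4 * sqrt (2 * real m / real s) * ?Q"
        using fa(3)[OF a] by (intro mult_left_mono) auto
      also have "\<dots> = 4 * E" by (simp only: mult.assoc QE)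
      finally show "nrm m (lin d m A x a (f a) k) \<le> 8 * E" by simp
    qed
    also have "\<dots> = real k * (8 * E)" by simp
    also have "\<dots> \<le> real L * (8 * E)" using less.prems E_nonneg by (intro mult_right_mono) auto
    finally have "nrm m (g k) \<le> 8 * real L * E" by simp
    with ek qk Sm Sc eS show ?case by blast
  qed
  from key[OF l] show ?thesis by (simp add: g_def)
qed

end

section \<open>Gaussian vectors\<close>

abbreviation "std_normal_measure \<equiv> density lborel (\<lambda>x. ennreal (std_normal_density x))"

section \<open>Linear functionals of a standard Gaussian vector\<close>

lemma measurable_dotp_gaussian[measurable]: "(\<lambda>y. dotp n y v) \<in> borel_measurable (std_gaussian_vec
  n)"
  unfolding dotp_def std_gaussian_vec_def by measurable

lemma measurable_component_gaussian:
  assumes "j < n"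
  shows "(\<lambda>y. y j) \<in> measurable (std_gaussian_vec n) std_normal_measure"
  unfolding std_gaussian_vec_def by (rule measurable_component_singleton) (use assms in simp)

lemma distributed_component:
  assumes "j < n"
  shows "distributed (std_gaussian_vec n) lborel (\<lambda>y. y j) (normal_density 0 1)"
proof -
  have "distr (std_gaussian_vec n) std_normal_measure (\<lambda>y. y j) = std_normal_measure"
    unfolding std_gaussian_vec_def
    by (rule distr_PiM_component) (use assms in \<open>auto intro: prob_space_normal_density\<close>)
  moreover have "distr (std_gaussian_vec n) lborel (\<lambda>y. y j) = distr (std_gaussian_vec n)
    std_normal_measure (\<lambda>y. y j)"
    by (rule distr_cong) auto
  moreover have "(\<lambda>y. y j) \<in> borel_measurable (std_gaussian_vec n)"
    using measurable_component_gaussian[OF assms] by simp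
  ultimately show ?thesis by (simp add: distributed_def)
qed

lemma indep_vars_components:
  "prob_space.indep_vars (std_gaussian_vec n) (\<lambda>_. std_normal_measure) (\<lambda>j y. y j) {..<n}"
\<comment> \<open>The characterisation of independence by the joint law needs a nonempty index
  set.\<close>
proof (cases "n = 0")
  case True
  interpret prob_space "std_gaussian_vec n" by (rule prob_space_std_gaussian_vec)
  show ?thesis unfolding indep_vars_def indep_sets_def using True by auto
next
  case False
  let ?G = "std_gaussian_vec n"
  interpret prob_space ?G by (rule prob_space_std_gaussian_vec)
  have c: "distr ?G std_normal_measure (\<lambda>y. y j) = std_normal_measure" if "j < n" for j
    unfolding std_gaussian_vec_def
    by (rule distr_PiM_component) (use that in \<open>auto intro: prob_space_normal_density\<close>)
  have "distr ?G (Pi\<^sub>M {..<n} (\<lambda>_. std_normal_measure)) (\<lambda>y. \<lambda>j\<in>{..<n}. y j) = distr ?G ?G (\<lambda>y. y)"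
    by (rule distr_cong) (auto simp: std_gaussian_vec_def space_PiM fun_eq_iff PiE_iff
      extensional_def)
  also have "\<dots> = ?G" by (rule distr_id)
  also have "\<dots> = Pi\<^sub>M {..<n} (\<lambda>j. distr ?G std_normal_measure (\<lambda>y. y j))"
    unfolding std_gaussian_vec_def[of n]
    by (rule PiM_cong) (use c in \<open>auto simp: std_gaussian_vec_def\<close>)
  finally have eq: "distr ?G (Pi\<^sub>M {..<n} (\<lambda>_. std_normal_measure)) (\<lambda>y. \<lambda>j\<in>{..<n}. y j)
      = Pi\<^sub>M {..<n} (\<lambda>j. distr ?G std_normal_measure (\<lambda>y. y j))" .
  show ?thesis
  proof (subst indep_vars_iff_distr_eq_PiM')
    show "{..<n} \<noteq> {}" using False by auto
    show "random_variable std_normal_measure (\<lambda>y. y j)" if "j \<in> {..<n}" for j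
      using that by (intro measurable_component_gaussian) simp
  qed (rule eq)
qed

lemma distributed_dotp:
  assumes v: "nrm n v \<noteq> 0"
  shows "distributed (std_gaussian_vec n) lborel (\<lambda>y. dotp n y v) (normal_density 0 (nrm n v))"
proof -
  let ?G = "std_gaussian_vec n"
  interpret prob_space ?G by (rule prob_space_std_gaussian_vec)
  \<comment> \<open>A zero coefficient would give a degenerate normal variable without density, so
    only the support of \<open>v\<close> enters the sum.\<close>
  define I where "I = {j \<in> {..<n}. v j \<noteq> 0}"
  have Isub: "I \<subseteq> {..<n}" by (auto simp: I_def)
  have fI: "finite I" using Isub by (rule finite_subset) simp
  have Ine: "I \<noteq> {}"
  proof
    assume "I = {}"
    then have "nrm n v = L2_set v {}" by (intro L2_set_supp) (auto simp: I_def)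
    with v show False by simp
  qed
  have "indep_vars (\<lambda>_. borel) (\<lambda>j y. v j * y j) {..<n}"
    by (rule indep_vars_compose2[OF indep_vars_components, of "\<lambda>j t. v j * t"]) simp
  then have ind: "indep_vars (\<lambda>_. borel) (\<lambda>j y. v j * y j) I"
    by (rule indep_vars_subset[OF _ Isub])
  have comp: "distributed ?G lborel (\<lambda>y. v j * y j) (normal_density 0 \<bar>v j\<bar>)" if "j \<in> I" for j
  proof -
    have "distributed ?G lborel (\<lambda>y. 0 + v j * y j) (normal_density (0 + v j * 0) (\<bar>v j\<bar> * 1))"
      by (rule normal_density_affine[OF distributed_component]) (use that in \<open>auto simp: I_def\<close>)
    then show ?thesis by simp
  qed
  have "distributed ?G lborel (\<lambda>y. \<Sum>j\<in>I. v j * y j) (normal_density (\<Sum>j\<in>I. 0) (sqrt (\<Sum>j\<in>I. \<bar>v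
    j\<bar>\<^sup>2)))"
    by (rule sum_indep_normal[OF fI Ine ind _ comp]) (auto simp: I_def)
  moreover have "(\<Sum>j\<in>I. v j * y j) = dotp n y v" for y
    unfolding dotp_def by (rule sum.mono_neutral_cong_left) (auto simp: I_def)
  moreover have "sqrt (\<Sum>j\<in>I. \<bar>v j\<bar>\<^sup>2) = nrm n v"
    unfolding L2_set_def by (intro arg_cong[where f=sqrt] sum.mono_neutral_cong_left) (auto simp:
      I_def)
  ultimately show ?thesis by simp
qed

section \<open>Exponential moments of one row\<close>

lemma nn_integral_normal_density: "0 < \<sigma> \<Longrightarrow> (\<integral>\<^sup>+x. ennreal (normal_density \<mu> \<sigma> x) \<partial>lborel) = 1"
  by (subst nn_integral_eq_integral) auto

lemma nn_integral_dotp: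
  assumes v: "nrm n v \<noteq> 0" and f: "f \<in> borel_measurable borel"
  shows "(\<integral>\<^sup>+y. f (dotp n y v) \<partial>std_gaussian_vec n) = (\<integral>\<^sup>+x. ennreal (normal_density 0 (nrm n v)
    x) * f x \<partial>lborel)"
  by (rule distributed_nn_integral[OF distributed_dotp[OF v], symmetric]) (use f in simp)

text \<open>Multiplying the centred normal density of deviation \<sigma> by the exponential gives,
  up to the stated factor, the normal density of variance
  \<open>\<sigma>\<^sup>2 / (1 - 2 * t)\<close>, which integrates to 1.\<close>

lemma mgf_dotp_square:
  assumes v: "nrm n v \<noteq> 0" and t: "t < 1/2"
  shows "(\<integral>\<^sup>+y. ennreal (exp (t * (dotp n y v / nrm n v)\<^sup>2)) \<partial>std_gaussian_vec n) = ennreal (1 /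
    sqrt (1 - 2 * t))"
proof -
  define \<sigma> where "\<sigma> = nrm n v"
  have \<sigma>: "\<sigma> > 0" using v L2_set_nonneg[of v "{..<n}"] unfolding \<sigma>_def by linarith
  define \<tau> where "\<tau> = \<sigma> / sqrt (1 - 2 * t)"
  have \<tau>: "\<tau> > 0" using \<sigma> t by (simp add: \<tau>_def)
  have \<tau>2: "\<tau>\<^sup>2 = \<sigma>\<^sup>2 / (1 - 2 * t)" using t by (simp add: \<tau>_def power_divide)
  have pt: "normal_density 0 \<sigma> x * exp (t * (x / \<sigma>)\<^sup>2) = 1 / sqrt (1 - 2 * t) * normal_density 0 \<tau>
    x" for x
  proof -
    have e: "- (x\<^sup>2) / (2 * \<sigma>\<^sup>2) + t * (x / \<sigma>)\<^sup>2 = - (x\<^sup>2) / (2 * \<tau>\<^sup>2)"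
      using \<sigma> t unfolding \<tau>2 by (simp add: power_divide field_simps)
    have "sqrt (2 * pi * \<tau>\<^sup>2) = sqrt (2 * pi * \<sigma>\<^sup>2) / sqrt (1 - 2 * t)"
      unfolding \<tau>2 by (simp add: real_sqrt_divide real_sqrt_mult)
    then have s: "1 / sqrt (2 * pi * \<sigma>\<^sup>2) = 1 / sqrt (1 - 2 * t) * (1 / sqrt (2 * pi * \<tau>\<^sup>2))"
      using t \<sigma> by (simp add: field_simps)
    have "normal_density 0 \<sigma> x * exp (t * (x / \<sigma>)\<^sup>2) = 1 / sqrt (2 * pi * \<sigma>\<^sup>2) * (exp (- (x\<^sup>2) /
      (2 * \<sigma>\<^sup>2)) * exp (t * (x / \<sigma>)\<^sup>2))"
      by (simp add: normal_density_def)
    also have "\<dots> = 1 / sqrt (2 * pi * \<sigma>\<^sup>2) * exp (- (x\<^sup>2) / (2 * \<tau>\<^sup>2))"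
      by (simp only: exp_add[symmetric] e)
    also have "\<dots> = 1 / sqrt (1 - 2 * t) * normal_density 0 \<tau> x"
      unfolding s by (simp add: normal_density_def)
    finally show ?thesis .
  qed
  have "(\<integral>\<^sup>+y. ennreal (exp (t * (dotp n y v / \<sigma>)\<^sup>2)) \<partial>std_gaussian_vec n)
      = (\<integral>\<^sup>+x. ennreal (normal_density 0 \<sigma> x) * ennreal (exp (t * (x / \<sigma>)\<^sup>2)) \<partial>lborel)"
    unfolding \<sigma>_def by (rule nn_integral_dotp[OF v]) measurable
  also have "\<dots> = (\<integral>\<^sup>+x. ennreal (1 / sqrt (1 - 2 * t)) * ennreal (normal_density 0 \<tau> x) \<partial>lborel)"
    by (intro nn_integral_cong) (use t in \<open>simp add: ennreal_mult[symmetric] pt\<close>)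
  also have "\<dots> = ennreal (1 / sqrt (1 - 2 * t)) * 1"
    by (subst nn_integral_cmult) (auto simp: nn_integral_normal_density[OF \<tau>])
  finally show ?thesis by (simp add: \<sigma>_def)
qed

text \<open>The density is at most 1 / (2 \<sigma>), so the event has probability at most b; with e
  - 1 <= 2 the moment is at most 1 + 2 b. For \<open>nrm n v = 0\<close> the strict inequality makes
  the event empty.\<close>

lemma small_ball_mgf:
  assumes b: "0 \<le> b"
  shows "(\<integral>\<^sup>+y. ennreal (exp (if \<bar>dotp n y v\<bar> < b * nrm n v then 1 else 0)) \<partial>std_gaussian_vec n) \<le>
    ennreal (exp (2 * b))"
proof (cases "nrm n v = 0")
  case True
  interpret prob_space "std_gaussian_vec n" by (rule prob_space_std_gaussian_vec)
  show ?thesis using b by (simp add: True emeasure_space_1)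
next
  case False
  define \<sigma> where "\<sigma> = nrm n v"
  have \<sigma>: "\<sigma> > 0" using False L2_set_nonneg[of v "{..<n}"] unfolding \<sigma>_def by linarith
  have nd: "normal_density 0 \<sigma> x \<le> 1 / (2 * \<sigma>)" for x
  proof -
    have "2 * \<sigma> = sqrt (4 * \<sigma>\<^sup>2)" using \<sigma> by (simp add: real_sqrt_mult)
    also have "\<dots> \<le> sqrt (2 * pi * \<sigma>\<^sup>2)" using pi_ge_two by (intro real_sqrt_le_mono
      mult_right_mono) auto
    finally have "1 / sqrt (2 * pi * \<sigma>\<^sup>2) \<le> 1 / (2 * \<sigma>)" using \<sigma> by (intro divide_left_mono) auto
    moreover have "exp (- (x\<^sup>2) / (2 * \<sigma>\<^sup>2)) \<le> 1" by simp
    ultimately have "1 / sqrt (2 * pi * \<sigma>\<^sup>2) * exp (- (x\<^sup>2) / (2 * \<sigma>\<^sup>2)) \<le> 1 / (2 * \<sigma>) * 1"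
      using \<sigma> by (intro mult_mono) auto
    then show ?thesis by (simp add: normal_density_def)
  qed
  let ?A = "{-(b * \<sigma>)<..<b * \<sigma>}"
  have "(\<integral>\<^sup>+y. ennreal (exp (if \<bar>dotp n y v\<bar> < b * \<sigma> then 1 else 0)) \<partial>std_gaussian_vec n)
      = (\<integral>\<^sup>+x. ennreal (normal_density 0 \<sigma> x) * ennreal (exp (if \<bar>x\<bar> < b * \<sigma> then 1 else 0))
        \<partial>lborel)"
    unfolding \<sigma>_def by (rule nn_integral_dotp[OF False]) measurable
  also have "\<dots> \<le> (\<integral>\<^sup>+x. ennreal (normal_density 0 \<sigma> x) + ennreal (1 / \<sigma>) * indicator ?A x \<partial>lborel)"
  proof (rule nn_integral_mono)
    fix x
    have "normal_density 0 \<sigma> x * exp (if \<bar>x\<bar> < b * \<sigma> then 1 else 0) \<le> normal_density 0 \<sigma> x + 1 / \<sigma>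
      * indicator ?A x"
    proof (cases "\<bar>x\<bar> < b * \<sigma>")
      case True
      then have "x \<in> ?A" by auto
      moreover have "normal_density 0 \<sigma> x * exp 1 \<le> normal_density 0 \<sigma> x * 3"
        using exp_le by (intro mult_left_mono) auto
      moreover have "normal_density 0 \<sigma> x * 2 \<le> 1 / \<sigma>"
        using nd[of x] \<sigma> by (simp add: field_simps)
      ultimately show ?thesis using True by simp
    next
      case False
      then show ?thesis using \<sigma> by simp
    qed
    then have "ennreal (normal_density 0 \<sigma> x * exp (if \<bar>x\<bar> < b * \<sigma> then 1 else 0)) \<le> ennreal
      (normal_density 0 \<sigma> x + 1 / \<sigma> * indicator ?A x)"
      by (rule ennreal_leI)
    also have "\<dots> = ennreal (normal_density 0 \<sigma> x) + ennreal (1 / \<sigma>) * indicator ?A x"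
      using \<sigma> by (cases "x \<in> ?A") (auto simp: ennreal_plus)
    finally show "ennreal (normal_density 0 \<sigma> x) * ennreal (exp (if \<bar>x\<bar> < b * \<sigma> then 1 else 0))
        \<le> ennreal (normal_density 0 \<sigma> x) + ennreal (1 / \<sigma>) * indicator ?A x"
      by (simp add: ennreal_mult)
  qed
  also have "\<dots> = 1 + ennreal (1 / \<sigma>) * emeasure lborel ?A"
    by (subst nn_integral_add) (auto simp: nn_integral_normal_density[OF \<sigma>]
      nn_integral_cmult_indicator)
  also have "emeasure lborel ?A = ennreal (2 * (b * \<sigma>))"
    using b \<sigma> by simp
  also have "1 + ennreal (1 / \<sigma>) * ennreal (2 * (b * \<sigma>)) = ennreal (1 + 2 * b)"
    using b \<sigma> by (simp add: ennreal_mult[symmetric] ennreal_plus)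
  also have "\<dots> \<le> ennreal (exp (2 * b))"
    using exp_ge_add_one_self[of "2 * b"] by (intro ennreal_leI) simp
  finally show ?thesis by (simp add: \<sigma>_def)
qed

text \<open>Symmetry of the Gaussian law. \<open>compose\<close> restricts the negated function to
  \<open>{..<n}\<close>, so that it stays in the extensional space of the product measure.\<close>

lemma nn_integral_gaussian_uminus:
  assumes f: "f \<in> borel_measurable (std_gaussian_vec n)"
  shows "(\<integral>\<^sup>+y. f (compose {..<n} uminus y) \<partial>std_gaussian_vec n) = (\<integral>\<^sup>+y. f y \<partial>std_gaussian_vec n)"
proof -
  let ?N = "std_normal_measure"
  have prob: "prob_space ?N" by (rule prob_space_normal_density) simp
  interpret N: prob_space ?N by (rule prob)
  have "distributed ?N lborel (\<lambda>x. x) (normal_density 0 1)"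
    by (simp add: distributed_def) (rule distr_id2, simp)
  from N.normal_density_affine[OF this, of "-1" 0]
  have "distr ?N lborel uminus = ?N" by (simp add: distributed_def)
  moreover have "distr ?N ?N uminus = distr ?N lborel uminus" by (rule distr_cong) auto
  ultimately have u: "distr ?N ?N uminus = ?N" by simp
  have comp: "compose {..<n} uminus \<in> measurable (std_gaussian_vec n) (std_gaussian_vec n)"
    unfolding std_gaussian_vec_def compose_def by measurable
  have "distr (std_gaussian_vec n) (std_gaussian_vec n) (compose {..<n} uminus) = Pi\<^sub>M {..<n} (\<lambda>_.
    distr ?N ?N uminus)"
    unfolding std_gaussian_vec_def
    by (rule distr_PiM_finite_prob_space') (auto intro: prob)
  then have "distr (std_gaussian_vec n) (std_gaussian_vec n) (compose {..<n} uminus) =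
    std_gaussian_vec n"
    unfolding u by (simp add: std_gaussian_vec_def)
  then have "(\<integral>\<^sup>+y. f y \<partial>std_gaussian_vec n)
      = (\<integral>\<^sup>+y. f y \<partial>distr (std_gaussian_vec n) (std_gaussian_vec n) (compose {..<n} uminus))"
    by simp
  also have "\<dots> = (\<integral>\<^sup>+y. f (compose {..<n} uminus y) \<partial>std_gaussian_vec n)"
    by (rule nn_integral_distr[OF comp]) (use f in simp)
  finally show ?thesis by simp
qed

lemma dotp_uminus: "dotp n (compose {..<n} uminus y) v = - dotp n y v"
  by (simp add: dotp_def compose_def sum_negf)

text \<open>The sign pattern is averaged out by pairing \<open>y\<close> with \<open>-y\<close>, so no joint law of
  \<open>dotp n y u\<close> and \<open>dotp n y v\<close> is needed.\<close>

lemma mgf_half_square: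
  assumes v: "nrm n v \<noteq> 0" and t: "t < 1/4" and tu: "0 \<le> t \<or> u = v"
  shows "(\<integral>\<^sup>+y. ennreal (exp (if 0 < dotp n y u then t * (2 * (dotp n y v / nrm n v)\<^sup>2) else 0))
    \<partial>std_gaussian_vec n)
    \<le> ennreal ((1 + 1 / sqrt (1 - 4 * t)) / 2)"
proof -
  let ?G = "std_gaussian_vec n"
  interpret prob_space ?G by (rule prob_space_std_gaussian_vec)
  define F where "F = (\<lambda>y. exp (if 0 < dotp n y u then t * (2 * (dotp n y v / nrm n v)\<^sup>2) else 0))"
  have F[measurable]: "F \<in> borel_measurable ?G" unfolding F_def by measurable
  let ?m = "compose {..<n} uminus"
  have Fm: "F (?m y) = exp (if dotp n y u < 0 then t * (2 * (dotp n y v / nrm n v)\<^sup>2) else 0)" for y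
    by (simp add: F_def dotp_uminus)
  have sum: "F y + F (?m y) \<le> 1 + exp (2 * t * (dotp n y v / nrm n v)\<^sup>2)" for y
  \<comment> \<open>Here neither \<open>y\<close> nor its negative is active and the left side is 2.
    The right side reaches 2 because \<open>t\<close> is nonnegative, or because
    \<open>u = v\<close> makes the exponent vanish.\<close>
  proof (cases "dotp n y u = 0")
    case True
    have "0 \<le> 2 * t * (dotp n y v / nrm n v)\<^sup>2"
      using tu True by auto
    then show ?thesis unfolding Fm using True by (simp add: F_def)
  next
    case False
    then show ?thesis unfolding Fm by (auto simp: F_def mult.assoc mult.left_commute)
  qed
  have [measurable]: "(\<lambda>y. F (?m y)) \<in> borel_measurable ?G"
    unfolding Fm by measurable
  have "2 * (\<integral>\<^sup>+y. ennreal (F y) \<partial>?G) = (\<integral>\<^sup>+y. ennreal (F y) \<partial>?G) + (\<integral>\<^sup>+y. ennreal (F (?m y)) \<partial>?G)"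
    by (subst nn_integral_gaussian_uminus[of "\<lambda>y. ennreal (F y)"]) (auto simp: mult_2)
  also have "\<dots> = (\<integral>\<^sup>+y. ennreal (F y) + ennreal (F (?m y)) \<partial>?G)"
    by (subst nn_integral_add) auto
  also have "\<dots> \<le> (\<integral>\<^sup>+y. 1 + ennreal (exp (2 * t * (dotp n y v / nrm n v)\<^sup>2)) \<partial>?G)"
  proof (rule nn_integral_mono)
    fix y
    have "ennreal (F y + F (?m y)) \<le> ennreal (1 + exp (2 * t * (dotp n y v / nrm n v)\<^sup>2))"
      by (rule ennreal_leI[OF sum])
    moreover have "0 \<le> F y" "0 \<le> F (?m y)" by (auto simp: F_def)
    ultimately show "ennreal (F y) + ennreal (F (?m y)) \<le> 1 + ennreal (exp (2 * t * (dotp n y v /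
      nrm n v)\<^sup>2))"
      by (simp add: ennreal_plus)
  qed
  also have "\<dots> = 1 + ennreal (1 / sqrt (1 - 2 * (2 * t)))"
    using t by (subst nn_integral_add) (auto simp: mgf_dotp_square[OF v, of "2 * t"]
      emeasure_space_1)
  also have "\<dots> = ennreal (1 + 1 / sqrt (1 - 4 * t))" using t by (simp add: ennreal_plus)
  also have "\<dots> = 2 * ennreal ((1 + 1 / sqrt (1 - 4 * t)) / 2)"
  proof -
    let ?z = "(1 + 1 / sqrt (1 - 4 * t)) / 2"
    have "ennreal (1 + 1 / sqrt (1 - 4 * t)) = ennreal (2 * ?z)" by (rule arg_cong[where
      f=ennreal]) simp
    also have "\<dots> = ennreal 2 * ennreal ?z" by (rule ennreal_mult) (use t in auto)
    finally show ?thesis by (simp only: ennreal_numeral)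
  qed
  finally have "2 * (\<integral>\<^sup>+y. ennreal (F y) \<partial>?G) \<le> 2 * ennreal ((1 + 1 / sqrt (1 - 4 * t)) / 2)" .
  then show ?thesis
    by (subst (asm) ennreal_mult_le_mult_iff) (auto simp: F_def)
qed

section \<open>Concentration in one layer\<close>

text \<open>An outer probability bound: a measurable superset suffices, so bad events can be
  combined without proving them measurable.\<close>

definition rare :: "'a measure \<Rightarrow> real \<Rightarrow> ('a \<Rightarrow> bool) \<Rightarrow> bool" where
  "rare M p P \<longleftrightarrow> (\<exists>E\<in>sets M. {\<omega> \<in> space M. P \<omega>} \<subseteq> E \<and> measure M E \<le> p)"

lemma rare_weaken:
  assumes "rare M p P" "\<And>\<omega>. \<omega> \<in> space M \<Longrightarrow> Q \<omega> \<Longrightarrow> P \<omega>" "p \<le> q"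
  shows "rare M q Q"
proof -
  obtain E where "E \<in> sets M" "{\<omega> \<in> space M. P \<omega>} \<subseteq> E" "measure M E \<le> p"
    using assms(1) unfolding rare_def by blast
  then have "E \<in> sets M" "{\<omega> \<in> space M. Q \<omega>} \<subseteq> E" "measure M E \<le> q"
    using assms(2,3) by auto
  then show ?thesis unfolding rare_def by blast
qed

lemma rare_ex:
  assumes "finite I" "\<And>i. i \<in> I \<Longrightarrow> rare M p (P i)"
  shows "rare M (real (card I) * p) (\<lambda>\<omega>. \<exists>i\<in>I. P i \<omega>)"
proof -
  obtain E where E: "\<And>i. i \<in> I \<Longrightarrow> E i \<in> sets M \<and> {\<omega> \<in> space M. P i \<omega>} \<subseteq> E i \<and> measure M (E i) \<le> p"
    using assms(2) unfolding rare_def by metis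
  have "measure M (\<Union>i\<in>I. E i) \<le> (\<Sum>i\<in>I. measure M (E i))"
    using E by (intro measure_UNION_le assms(1)) auto
  also have "\<dots> \<le> real (card I) * p" using E by (intro sum_bounded_above) auto
  finally have "measure M (\<Union>i\<in>I. E i) \<le> real (card I) * p" .
  moreover have "(\<Union>i\<in>I. E i) \<in> sets M" using E assms(1) by auto
  moreover have "{\<omega> \<in> space M. \<exists>i\<in>I. P i \<omega>} \<subseteq> (\<Union>i\<in>I. E i)" using E by blast
  ultimately show ?thesis unfolding rare_def by blast
qed

lemma rare_disj:
  assumes "rare M p P" "rare M q Q"
  shows "rare M (p + q) (\<lambda>\<omega>. P \<omega> \<or> Q \<omega>)"
proof -
  obtain E F where E: "E \<in> sets M" "{\<omega> \<in> space M. P \<omega>} \<subseteq> E" "measure M E \<le> p"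
    and F: "F \<in> sets M" "{\<omega> \<in> space M. Q \<omega>} \<subseteq> F" "measure M F \<le> q"
    using assms unfolding rare_def by blast
  have "measure M (E \<union> F) \<le> measure M E + measure M F" by (rule measure_Un_le[OF E(1) F(1)])
  then have "measure M (E \<union> F) \<le> p + q" using E F by linarith
  moreover have "{\<omega> \<in> space M. P \<omega> \<or> Q \<omega>} \<subseteq> E \<union> F" using E F by blast
  ultimately show ?thesis unfolding rare_def using E F by blast
qed

section \<open>The rows of one layer, given the layers below\<close>

lemma init_measure_eq:
  "init_measure d m L = Pi\<^sub>M (free_rows m L) (\<lambda>p. std_gaussian_vec (fan_in d m (fst p)))"
  by (simp add: init_measure_def case_prod_beta')

lemma finite_free_rows: "finite (free_rows m L)"
  by (simp add: free_rows_def)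

lemma measurable_row:
  assumes "(b, r) \<in> free_rows m L"
  shows "(\<lambda>\<omega>. \<omega> (b, r)) \<in> measurable (init_measure d m L) (std_gaussian_vec (fan_in d m b))"
  using measurable_component_singleton[OF assms, of "\<lambda>p. std_gaussian_vec (fan_in d m (fst p))"]
  by (simp add: init_measure_eq)

lemma measurable_entry:
  assumes "(b, r) \<in> free_rows m L" "j < fan_in d m b"
  shows "(\<lambda>\<omega>. \<omega> (b, r) j) \<in> borel_measurable (init_measure d m L)"
  using measurable_comp[OF measurable_row[OF assms(1)] measurable_component_gaussian[OF assms(2)]]
  by (simp add: comp_def)

text \<open>Conditioning by Fubini. Once everything except the rows \<open>{b} \<times> T\<close> is
  fixed, \<open>F\<close> is a fixed function, these rows are independent, and the exponential
  moment of the sum factors into \<open>card T\<close> moments of at most exp K. Markov's inequality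
  finishes.\<close>

lemma layer_chernoff:
  fixes F :: "(nat \<times> nat \<Rightarrow> nat \<Rightarrow> real) \<Rightarrow> (nat \<Rightarrow> real) \<Rightarrow> real"
  assumes T: "finite T" "{b} \<times> T \<subseteq> free_rows m L"
    and meas: "\<And>r. r \<in> T \<Longrightarrow> (\<lambda>\<omega>. F \<omega> (\<omega> (b, r))) \<in> borel_measurable (init_measure d m L)"
    and meas_row: "\<And>\<omega>. F \<omega> \<in> borel_measurable (std_gaussian_vec (fan_in d m b))"
    and below: "\<And>\<omega> \<omega>'. (\<And>l r. l < b \<Longrightarrow> \<omega> (l, r) = \<omega>' (l, r)) \<Longrightarrow> F \<omega> = F \<omega>'"
    and mgf: "\<And>\<omega>. (\<integral>\<^sup>+y. ennreal (exp (F \<omega> y)) \<partial>std_gaussian_vec (fan_in d m b)) \<le> ennreal (exp K)"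
  shows "rare (init_measure d m L) (exp (K * real (card T) - t)) (\<lambda>\<omega>. t \<le> (\<Sum>r\<in>T. F \<omega> (\<omega> (b, r))))"
proof -
  let ?P = "init_measure d m L"
  let ?M = "\<lambda>p. std_gaussian_vec (fan_in d m (fst p))"
  \<comment> \<open>\<open>J\<close> is integrated first, with \<open>I\<close> frozen.
    \<open>I\<close> also contains the layers above \<open>b\<close>, on which \<open>F\<close> does
    not depend.\<close>
  define J where "J = {b} \<times> T"
  define I where "I = free_rows m L - J"
  have IJ: "I \<union> J = free_rows m L" "I \<inter> J = {}" using T(2) by (auto simp: I_def J_def)
  have fin: "finite I" "finite J" using T(1) by (auto simp: I_def J_def finite_free_rows)
  interpret prob_space ?P by (rule prob_space_init_measure)
  interpret pr: product_sigma_finite ?M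
    unfolding product_sigma_finite_def
    by (intro allI prob_space_imp_sigma_finite prob_space_std_gaussian_vec)
  have PIJ: "?P = Pi\<^sub>M (I \<union> J) ?M" by (simp add: IJ init_measure_eq)
  define f where "f = (\<lambda>\<omega>. \<Prod>r\<in>T. ennreal (exp (F \<omega> (\<omega> (b, r)))))"
  have fm: "f \<in> borel_measurable ?P"
    unfolding f_def using meas by (intro borel_measurable_prod_ennreal) auto
  have "(\<integral>\<^sup>+\<omega>. f \<omega> \<partial>?P) = (\<integral>\<^sup>+x. (\<integral>\<^sup>+y. f (merge I J (x, y)) \<partial>Pi\<^sub>M J ?M) \<partial>Pi\<^sub>M I ?M)"
    unfolding PIJ by (rule pr.product_nn_integral_fold[OF IJ(2) fin]) (use fm in \<open>simp add: PIJ\<close>)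
  also have "\<dots> \<le> (\<integral>\<^sup>+x. ennreal (exp K) ^ card T \<partial>Pi\<^sub>M I ?M)"
  proof (rule nn_integral_mono)
    fix x assume x: "x \<in> space (Pi\<^sub>M I ?M)"
    \<comment> \<open>\<open>below\<close> demands agreement at all pairs below layer
      \<open>b\<close>, including those that are not sampled; there both sides are
      \<open>undefined\<close> by extensionality.\<close>
    have Fx: "F (merge I J (x, y)) = F x" for y
    proof (rule below)
      fix l r assume "l < b"
      then show "merge I J (x, y) (l, r) = x (l, r)"
        using x by (auto simp: merge_def J_def space_PiM PiE_def extensional_def)
    qed
    have "(\<integral>\<^sup>+y. f (merge I J (x, y)) \<partial>Pi\<^sub>M J ?M) = (\<integral>\<^sup>+y. (\<Prod>p\<in>J. ennreal (exp (F x (y p)))) \<partial>Pi\<^sub>M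
      J ?M)"
    proof (rule nn_integral_cong)
      fix y
      have "f (merge I J (x, y)) = (\<Prod>r\<in>T. ennreal (exp (F x (y (b, r)))))"
        unfolding f_def Fx by (intro prod.cong refl) (auto simp: merge_def I_def J_def)
      also have "\<dots> = (\<Prod>p\<in>J. ennreal (exp (F x (y p))))"
        unfolding J_def by (rule prod.reindex_bij_witness[of _ snd "\<lambda>r. (b, r)"]) auto
      finally show "f (merge I J (x, y)) = (\<Prod>p\<in>J. ennreal (exp (F x (y p))))" .
    qed
    also have "\<dots> = (\<Prod>p\<in>J. \<integral>\<^sup>+y. ennreal (exp (F x y)) \<partial>?M p)"
      by (rule pr.product_nn_integral_prod[OF fin(2)]) (use meas_row in \<open>auto simp: J_def\<close>)
    also have "\<dots> \<le> (\<Prod>p\<in>J. ennreal (exp K))"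
      by (rule prod_mono_ennreal) (use mgf in \<open>auto simp: J_def\<close>)
    also have "\<dots> = ennreal (exp K) ^ card T" by (simp add: J_def card_cartesian_product)
    finally show "(\<integral>\<^sup>+y. f (merge I J (x, y)) \<partial>Pi\<^sub>M J ?M) \<le> ennreal (exp K) ^ card T" .
  qed
  also have "\<dots> = ennreal (exp (K * real (card T)))"
  proof -
    interpret I: prob_space "Pi\<^sub>M I ?M" by (rule prob_space_PiM) (rule prob_space_std_gaussian_vec)
    show ?thesis by (simp add: I.emeasure_space_1 ennreal_power exp_of_nat_mult[symmetric]
      mult.commute)
  qed
  finally have int: "(\<integral>\<^sup>+\<omega>. f \<omega> \<partial>?P) \<le> ennreal (exp (K * real (card T)))" .
  let ?E = "{\<omega> \<in> space ?P. t \<le> (\<Sum>r\<in>T. F \<omega> (\<omega> (b, r)))}"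
  have [measurable]: "(\<lambda>\<omega>. \<Sum>r\<in>T. F \<omega> (\<omega> (b, r))) \<in> borel_measurable ?P"
    using meas by (intro borel_measurable_sum) auto
  have E: "?E \<in> sets ?P" by measurable
  have "emeasure ?P ?E = (\<integral>\<^sup>+\<omega>. indicator ?E \<omega> \<partial>?P)" using E by simp
  also have "\<dots> \<le> (\<integral>\<^sup>+\<omega>. ennreal (exp (- t)) * f \<omega> \<partial>?P)"
  proof (rule nn_integral_mono)
    fix \<omega> assume "\<omega> \<in> space ?P"
    have fe: "ennreal (exp (- t)) * f \<omega> = ennreal (exp ((\<Sum>r\<in>T. F \<omega> (\<omega> (b, r))) - t))"
      unfolding f_def by (simp add: prod_ennreal exp_sum[OF T(1), symmetric]
        ennreal_mult[symmetric] exp_add[symmetric])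
    show "indicator ?E \<omega> \<le> ennreal (exp (- t)) * f \<omega>"
    proof (cases "\<omega> \<in> ?E")
      case True
      then have "1 \<le> exp ((\<Sum>r\<in>T. F \<omega> (\<omega> (b, r))) - t)" by simp
      then show ?thesis unfolding fe using True by (simp add: ennreal_1[symmetric] ennreal_leI
        del: ennreal_1)
    qed simp
  qed
  also have "\<dots> = ennreal (exp (- t)) * (\<integral>\<^sup>+\<omega>. f \<omega> \<partial>?P)" by (rule nn_integral_cmult[OF fm])
  also have "\<dots> \<le> ennreal (exp (- t)) * ennreal (exp (K * real (card T)))" by (intro mult_left_mono
    int) auto
  also have "\<dots> = ennreal (exp (K * real (card T) - t))"
    by (simp add: ennreal_mult[symmetric] exp_add[symmetric])
  finally have "measure ?P ?E \<le> exp (K * real (card T) - t)"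
    by (simp add: emeasure_eq_measure)
  then show ?thesis unfolding rare_def using E by blast
qed

text \<open>Predictability with the layer as time: layer \<open>b\<close> has not been seen yet.
  Dependence is stated pointwise instead of through a sub-sigma-algebra, because this is the form in
  which \<open>layer_chernoff\<close> consumes it.\<close>

definition adapted ::
    "nat \<Rightarrow> nat \<Rightarrow> nat \<Rightarrow> nat \<Rightarrow> nat \<Rightarrow> ((nat \<times> nat \<Rightarrow> nat \<Rightarrow> real) \<Rightarrow> nat \<Rightarrow> real) \<Rightarrow> bool" where
  "adapted d m L b n u \<longleftrightarrow> (\<forall>j<n. (\<lambda>\<omega>. u \<omega> j) \<in> borel_measurable (init_measure d m L)) \<and>
     (\<forall>\<omega> \<omega>'. (\<forall>l r. l < b \<longrightarrow> \<omega> (l, r) = \<omega>' (l, r)) \<longrightarrow> u \<omega> = u \<omega>')"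

lemma adapted_const: "adapted d m L b n (\<lambda>_. w)"
  by (simp add: adapted_def)

lemma adapted_measurable: "adapted d m L b n u \<Longrightarrow> j < n \<Longrightarrow> (\<lambda>\<omega>. u \<omega> j) \<in> borel_measurable
  (init_measure d m L)"
  by (simp add: adapted_def)

lemma adapted_below:
  "adapted d m L b n u \<Longrightarrow> (\<And>l r. l < b \<Longrightarrow> \<omega> (l, r) = \<omega>' (l, r)) \<Longrightarrow> u \<omega> = u \<omega>'"
  unfolding adapted_def by blast

lemma measurable_nrm_adapted:
  "adapted d m L b n u \<Longrightarrow> (\<lambda>\<omega>. nrm n (u \<omega>)) \<in> borel_measurable (init_measure d m L)"
  unfolding L2_set_def using adapted_measurable[of d m L b n u]
  by (intro borel_measurable_sqrt[THEN measurable_compose[rotated]] borel_measurable_sum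
    borel_measurable_power) auto

lemma measurable_dotp_adapted:
  assumes "adapted d m L b n u" "(b, r) \<in> free_rows m L" "n = fan_in d m b"
  shows "(\<lambda>\<omega>. dotp n (\<omega> (b, r)) (u \<omega>)) \<in> borel_measurable (init_measure d m L)"
  unfolding dotp_def using adapted_measurable[OF assms(1)] measurable_entry[OF assms(2)] assms(3)
  by (intro borel_measurable_sum borel_measurable_times) auto

lemma free_rows_lt: "1 \<le> b \<Longrightarrow> b < L \<Longrightarrow> r < m \<Longrightarrow> (b, r) \<in> free_rows m L"
  by (auto simp: free_rows_def)

text \<open>\<open>curry \<omega>\<close> reads sampled rows only below the last layer, since the
  second half of the last layer is duplicated; hence \<open>l < L\<close>.\<close>

lemma adapted_act:
  assumes "l < L"
  shows "adapted d m L (Suc l) (fan_in d m (Suc l)) (\<lambda>\<omega>. act d m (curry \<omega>) x l)"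
  using assms
proof (induction l)
  case 0
  show ?case by (simp add: adapted_def)
next
  case (Suc l)
  note IH = Suc.IH[OF Suc_lessD[OF Suc.prems]]
  show ?case
    unfolding adapted_def
  proof (intro conjI allI impI)
    fix r assume "r < fan_in d m (Suc (Suc l))"
    then have "r < m" by (simp add: fan_in_def)
    then have fr: "(Suc l, r) \<in> free_rows m L" using Suc.prems by (intro free_rows_lt) auto
    have [measurable]: "(\<lambda>\<omega>. dotp (fan_in d m (Suc l)) (\<omega> (Suc l, r)) (act d m (curry \<omega>) x l))
        \<in> borel_measurable (init_measure d m L)"
      by (rule measurable_dotp_adapted[OF IH fr refl])
    show "(\<lambda>\<omega>. act d m (curry \<omega>) x (Suc l) r) \<in> borel_measurable (init_measure d m L)"
      by (simp add: relu_def)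
  next
    fix \<omega> \<omega>' :: "nat \<times> nat \<Rightarrow> nat \<Rightarrow> real"
    assume *: "\<forall>k r. k < Suc (Suc l) \<longrightarrow> \<omega> (k, r) = \<omega>' (k, r)"
    then have "act d m (curry \<omega>) x l = act d m (curry \<omega>') x l"
      by (intro adapted_below[OF IH]) auto
    with * show "act d m (curry \<omega>) x (Suc l) = act d m (curry \<omega>') x (Suc l)"
      by (simp add: curry_conv)
  qed
qed

lemma adapted_lin:
  assumes "1 \<le> a" "b < L"
  shows "adapted d m L (Suc b) m (\<lambda>\<omega>. lin d m (curry \<omega>) x a w b)"
  using assms
proof (induction b)
  case 0
  show ?case by (simp add: adapted_def)
next
  case (Suc b)
  show ?case
  proof (cases "Suc b \<le> a")
    case True
    then show ?thesis by (simp add: adapted_const)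
  next
    case False
    have IH: "adapted d m L (Suc b) m (\<lambda>\<omega>. lin d m (curry \<omega>) x a w b)"
      by (rule Suc.IH) (use Suc.prems in auto)
    have b: "m = fan_in d m (Suc b)" using False assms(1) by (simp add: fan_in_def)
    have act: "adapted d m L (Suc b) (fan_in d m (Suc b)) (\<lambda>\<omega>. act d m (curry \<omega>) x b)"
      using Suc.prems by (intro adapted_act) simp
    show ?thesis
      unfolding adapted_def
    proof (intro conjI allI impI)
      fix r assume "r < m"
      then have fr: "(Suc b, r) \<in> free_rows m L" using Suc.prems by (intro free_rows_lt) auto
      have [measurable]: "(\<lambda>\<omega>. dotp (fan_in d m (Suc b)) (\<omega> (Suc b, r)) (act d m (curry \<omega>) x b))
          \<in> borel_measurable (init_measure d m L)"
        by (rule measurable_dotp_adapted[OF act fr refl])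
      have [measurable]: "(\<lambda>\<omega>. dotp m (\<omega> (Suc b, r)) (lin d m (curry \<omega>) x a w b))
          \<in> borel_measurable (init_measure d m L)"
        by (rule measurable_dotp_adapted[OF IH fr b])
      show "(\<lambda>\<omega>. lin d m (curry \<omega>) x a w (Suc b) r) \<in> borel_measurable (init_measure d m L)"
        using False by (simp add: curry_conv cong: if_cong)
    next
      fix \<omega> \<omega>' :: "nat \<times> nat \<Rightarrow> nat \<Rightarrow> real"
      assume *: "\<forall>k r. k < Suc (Suc b) \<longrightarrow> \<omega> (k, r) = \<omega>' (k, r)"
      then have "act d m (curry \<omega>) x b = act d m (curry \<omega>') x b"
        by (intro adapted_below[OF act]) auto
      moreover have "lin d m (curry \<omega>) x a w b = lin d m (curry \<omega>') x a w b"
        using * by (intro adapted_below[OF IH]) auto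
      ultimately show "lin d m (curry \<omega>) x a w (Suc b) = lin d m (curry \<omega>') x a w (Suc b)"
        using * by (simp add: curry_conv cong: if_cong)
    qed
  qed
qed

text \<open>Squaring reduces the claim to a polynomial one with factor \<open>y^2\<close>. The
  Taylor coefficient 3/8 is enlarged to 1 to absorb all higher terms up to y = 1/2.\<close>

lemma inverse_sqrt_upper:
  fixes y :: real
  assumes "0 \<le> y" "y \<le> 1/2"
  shows "1 / sqrt (1 - y) \<le> 1 + y / 2 + y\<^sup>2"
proof -
  have "0 \<le> y\<^sup>2 * (5/4 - 5/4 * y - y * y\<^sup>2)"
  proof (intro mult_nonneg_nonneg)
    have "y * y\<^sup>2 \<le> 1/2 * (1/2)\<^sup>2" using assms by (intro mult_mono power_mono) auto
    then show "0 \<le> 5/4 - 5/4 * y - y * y\<^sup>2" using assms by (simp add: power2_eq_square)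
  qed simp
  also have "y\<^sup>2 * (5/4 - 5/4 * y - y * y\<^sup>2) = (1 + y / 2 + y\<^sup>2)\<^sup>2 * (1 - y) - 1"
    by (simp add: power2_eq_square field_simps)
  finally have "sqrt 1 \<le> sqrt ((1 + y / 2 + y\<^sup>2)\<^sup>2 * (1 - y))" by (intro real_sqrt_le_mono) simp
  also have "\<dots> = (1 + y / 2 + y\<^sup>2) * sqrt (1 - y)" using assms by (simp add: real_sqrt_mult)
  finally show ?thesis using assms by (simp add: divide_le_eq)
qed

text \<open>The exact second-order Taylor polynomial is an upper bound: after squaring, the
  difference is \<open>y^3\<close> times a completed square plus a positive constant.\<close>

lemma inverse_sqrt_lower:
  fixes y :: real
  assumes "0 \<le> y"
  shows "1 / sqrt (1 + y) \<le> 1 - y / 2 + 3 / 8 * y\<^sup>2"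
proof -
  have pos: "0 \<le> 1 - y / 2 + 3 / 8 * y\<^sup>2"
  proof -
    have "0 \<le> 3/8 * (y - 2/3)\<^sup>2 + 5/6" by simp
    also have "\<dots> = 1 - y / 2 + 3 / 8 * y\<^sup>2" by (simp add: power2_eq_square algebra_simps)
    finally show ?thesis .
  qed
  have "0 \<le> y * y\<^sup>2 * (9/64 * (y - 5/6)\<^sup>2 + 135/256)"
    using assms by (intro mult_nonneg_nonneg add_nonneg_nonneg) auto
  also have "\<dots> = (1 - y / 2 + 3 / 8 * y\<^sup>2)\<^sup>2 * (1 + y) - 1"
    by (simp add: power2_eq_square field_simps)
  finally have "sqrt 1 \<le> sqrt ((1 - y / 2 + 3 / 8 * y\<^sup>2)\<^sup>2 * (1 + y))" by (intro
    real_sqrt_le_mono) simp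
  also have "\<dots> = (1 - y / 2 + 3 / 8 * y\<^sup>2) * sqrt (1 + y)" using pos by (simp add: real_sqrt_mult)
  finally show ?thesis using assms by (simp add: divide_le_eq)
qed

text \<open>Each summand has mean at most 1, the 2 compensating for the half of the rows that is
  masked out. The mask comes from \<open>u\<close> and may be unrelated to the direction
  \<open>v\<close>, so the bound covers activations and linearised propagation alike.\<close>

lemma active_square_upper_tail:
  assumes b: "1 \<le> b" "b < L" and n: "n = fan_in d m b" and \<epsilon>: "0 < \<epsilon>" "\<epsilon> \<le> 1"
    and u: "adapted d m L b n u" and v: "adapted d m L b n v"
  shows "rare (init_measure d m L) (exp (- (real m * \<epsilon>\<^sup>2 / 32))) (\<lambda>\<omega>. real m * (1 + \<epsilon>) \<le>
      (\<Sum>r<m. if 0 < dotp n (\<omega> (b, r)) (u \<omega>) then 2 * (dotp n (\<omega> (b, r)) (v \<omega>) / nrm n (v \<omega>))\<^sup>2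
        else 0))"
proof -
  let ?P = "init_measure d m L"
  \<comment> \<open>Minimises 8 t^2 - \<epsilon> t, the exponent per row, with value -\<epsilon>^2 /
    32.\<close>
  define t where "t = \<epsilon> / 16"
  have t: "0 < t" "t \<le> 1/16" using \<epsilon> by (auto simp: t_def)
  define F where "F = (\<lambda>\<omega> y. if 0 < dotp n y (u \<omega>) then t * (2 * (dotp n y (v \<omega>) / nrm n (v \<omega>))\<^sup>2)
    else 0)"
  have fr: "{b} \<times> {..<m} \<subseteq> free_rows m L" using b free_rows_lt by auto
  have "rare ?P (exp ((t + 8 * t\<^sup>2) * real (card {..<m}) - t * (real m * (1 + \<epsilon>))))
      (\<lambda>\<omega>. t * (real m * (1 + \<epsilon>)) \<le> (\<Sum>r<m. F \<omega> (\<omega> (b, r))))"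
  proof (rule layer_chernoff[OF _ fr])
    fix r assume "r \<in> {..<m}"
    then have r: "(b, r) \<in> free_rows m L" using fr by auto
    note [measurable] = measurable_dotp_adapted[OF u r n] measurable_dotp_adapted[OF v r n]
      measurable_nrm_adapted[OF v]
    show "(\<lambda>\<omega>. F \<omega> (\<omega> (b, r))) \<in> borel_measurable ?P" unfolding F_def by measurable
  next
    fix \<omega> show "F \<omega> \<in> borel_measurable (std_gaussian_vec (fan_in d m b))"
      unfolding F_def n[symmetric] by measurable
  next
    fix \<omega> \<omega>' :: "nat \<times> nat \<Rightarrow> nat \<Rightarrow> real" assume lt: "\<And>l r. l < b \<Longrightarrow> \<omega> (l, r) = \<omega>' (l, r)"
    have "u \<omega> = u \<omega>'" by (rule adapted_below[OF u]) (erule lt)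
    moreover have "v \<omega> = v \<omega>'" by (rule adapted_below[OF v]) (erule lt)
    ultimately show "F \<omega> = F \<omega>'" by (simp add: F_def cong: if_cong)
  next
    fix \<omega>
    show "(\<integral>\<^sup>+y. ennreal (exp (F \<omega> y)) \<partial>std_gaussian_vec (fan_in d m b)) \<le> ennreal (exp (t + 8 *
      t\<^sup>2))"
    \<comment> \<open>For \<open>v\<close> of norm 0 the quotient is 0 by convention, so the moment
      is 1.\<close>
    proof (cases "nrm n (v \<omega>) = 0")
      case True
      interpret G: prob_space "std_gaussian_vec (fan_in d m b)" by (rule
        prob_space_std_gaussian_vec)
      have "(1::real) \<le> exp (t + 8 * t\<^sup>2)" using t by simp
      then have "ennreal 1 \<le> ennreal (exp (t + 8 * t\<^sup>2))" by (rule ennreal_leI)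
      then show ?thesis by (simp add: F_def True G.emeasure_space_1 cong: if_cong)
    next
      case False
      have "1 / sqrt (1 - 4 * t) \<le> 1 + 4 * t / 2 + (4 * t)\<^sup>2"
        by (rule inverse_sqrt_upper) (use t in auto)
      then have "(1 + 1 / sqrt (1 - 4 * t)) / 2 \<le> 1 + (t + 8 * t\<^sup>2)" by (simp add: power2_eq_square)
      also have "\<dots> \<le> exp (t + 8 * t\<^sup>2)" by (rule exp_ge_add_one_self)
      finally have "ennreal ((1 + 1 / sqrt (1 - 4 * t)) / 2) \<le> ennreal (exp (t + 8 * t\<^sup>2))" by
        (rule ennreal_leI)
      then show ?thesis
        using mgf_half_square[OF False, of t "u \<omega>"] t unfolding F_def n by (auto intro: order_trans)
    qed
  qed simp
  moreover have "(t + 8 * t\<^sup>2) * real (card {..<m}) - t * (real m * (1 + \<epsilon>)) = - (real m * \<epsilon>\<^sup>2 /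
    32)"
    by (simp add: t_def power2_eq_square algebra_simps)
  moreover have "(\<Sum>r<m. F \<omega> (\<omega> (b, r))) = t * (\<Sum>r<m. if 0 < dotp n (\<omega> (b, r)) (u \<omega>) then 2 * (dotp
    n (\<omega> (b, r)) (v \<omega>) / nrm n (v \<omega>))\<^sup>2 else 0)" for \<omega>
    unfolding F_def sum_distrib_left by (intro sum.cong) auto
  ultimately show ?thesis using t by (simp only: mult_le_cancel_left_pos)
qed

text \<open>A lower tail needs a negative exponent, for which the symmetrisation in
  \<open>mgf_half_square\<close> requires mask and direction to coincide. That suffices: only the
  activations themselves are bounded from below. At norm 0 the sum would be 0 by convention, so this
  case is excluded from the event.\<close>

lemma active_square_lower_tail:
  assumes b: "1 \<le> b" "b < L" and n: "n = fan_in d m b" and \<epsilon>: "0 < \<epsilon>"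
    and u: "adapted d m L b n u"
  shows "rare (init_measure d m L) (exp (- (real m * \<epsilon>\<^sup>2 / 12))) (\<lambda>\<omega>. nrm n (u \<omega>) \<noteq> 0 \<and>
      (\<Sum>r<m. if 0 < dotp n (\<omega> (b, r)) (u \<omega>) then 2 * (dotp n (\<omega> (b, r)) (u \<omega>) / nrm n (u \<omega>))\<^sup>2
        else 0)
        \<le> real m * (1 - \<epsilon>))"
proof -
  let ?P = "init_measure d m L"
  let ?X = "\<lambda>\<omega> y. if 0 < dotp n y (u \<omega>) then 2 * (dotp n y (u \<omega>) / nrm n (u \<omega>))\<^sup>2 else 0"
  \<comment> \<open>Minimises 3 t^2 - \<epsilon> t, with value -\<epsilon>^2 / 12.\<close>
  define t where "t = \<epsilon> / 6"
  have t: "0 < t" using \<epsilon> by (auto simp: t_def)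
  define F where "F = (\<lambda>\<omega> y. if nrm n (u \<omega>) = 0 then 0 else t - t * ?X \<omega> y)"
  have fr: "{b} \<times> {..<m} \<subseteq> free_rows m L" using b free_rows_lt by auto
  have Fm: "(\<lambda>\<omega>. F \<omega> (\<omega> (b, r))) \<in> borel_measurable ?P" if "r < m" for r
  proof -
    have r: "(b, r) \<in> free_rows m L" using fr that by auto
    note [measurable] = measurable_dotp_adapted[OF u r n] measurable_nrm_adapted[OF u]
    show ?thesis unfolding F_def by measurable
  qed
  have "rare ?P (exp (3 * t\<^sup>2 * real (card {..<m}) - t * (real m * \<epsilon>)))
      (\<lambda>\<omega>. t * (real m * \<epsilon>) \<le> (\<Sum>r<m. F \<omega> (\<omega> (b, r))))"
  proof (rule layer_chernoff[OF _ fr])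
    show "(\<lambda>\<omega>. F \<omega> (\<omega> (b, r))) \<in> borel_measurable ?P" if "r \<in> {..<m}" for r using Fm that by simp
  next
    fix \<omega> show "F \<omega> \<in> borel_measurable (std_gaussian_vec (fan_in d m b))"
      unfolding F_def n[symmetric] by measurable
  next
    fix \<omega> \<omega>' :: "nat \<times> nat \<Rightarrow> nat \<Rightarrow> real" assume lt: "\<And>l r. l < b \<Longrightarrow> \<omega> (l, r) = \<omega>' (l, r)"
    have "u \<omega> = u \<omega>'" by (rule adapted_below[OF u]) (erule lt)
    then show "F \<omega> = F \<omega>'" by (simp add: F_def cong: if_cong)
  next
    fix \<omega>
    show "(\<integral>\<^sup>+y. ennreal (exp (F \<omega> y)) \<partial>std_gaussian_vec (fan_in d m b)) \<le> ennreal (exp (3 * t\<^sup>2))"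
    proof (cases "nrm n (u \<omega>) = 0")
      case True
      interpret G: prob_space "std_gaussian_vec (fan_in d m b)" by (rule
        prob_space_std_gaussian_vec)
      have "(1::real) \<le> exp (3 * t\<^sup>2)" by simp
      then have "ennreal 1 \<le> ennreal (exp (3 * t\<^sup>2))" by (rule ennreal_leI)
      then show ?thesis by (simp add: F_def True G.emeasure_space_1 cong: if_cong)
    next
      case False
      let ?Y = "\<lambda>y. if 0 < dotp n y (u \<omega>) then (-t) * (2 * (dotp n y (u \<omega>) / nrm n (u \<omega>))\<^sup>2) else 0"
      have "exp (F \<omega> y) = exp t * exp (?Y y)" for y
        using False by (simp add: F_def exp_add[symmetric])
      then have "(\<integral>\<^sup>+y. ennreal (exp (F \<omega> y)) \<partial>std_gaussian_vec n)
        = ennreal (exp t) * (\<integral>\<^sup>+y. ennreal (exp (?Y y)) \<partial>std_gaussian_vec n)"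
        by (subst nn_integral_cmult[symmetric]) (auto simp: ennreal_mult)
      also have "\<dots> \<le> ennreal (exp t) * ennreal ((1 + 1 / sqrt (1 - 4 * (-t))) / 2)"
        by (intro mult_left_mono mgf_half_square[OF False]) (use t in auto)
      also have "\<dots> = ennreal (exp t * ((1 + 1 / sqrt (1 + 4 * t)) / 2))"
        by (subst ennreal_mult[symmetric]) (use t in auto)
      also have "\<dots> \<le> ennreal (exp t * exp (3 * t\<^sup>2 - t))"
      proof (intro ennreal_leI mult_left_mono)
        have "1 / sqrt (1 + 4 * t) \<le> 1 - 4 * t / 2 + 3 / 8 * (4 * t)\<^sup>2"
          by (rule inverse_sqrt_lower) (use t in auto)
        then have "(1 + 1 / sqrt (1 + 4 * t)) / 2 \<le> 1 + (3 * t\<^sup>2 - t)" by (simp add: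
          power2_eq_square)
        also have "\<dots> \<le> exp (3 * t\<^sup>2 - t)" by (rule exp_ge_add_one_self)
        finally show "(1 + 1 / sqrt (1 + 4 * t)) / 2 \<le> exp (3 * t\<^sup>2 - t)" .
      qed simp
      also have "\<dots> = ennreal (exp (3 * t\<^sup>2))" by (simp add: exp_add[symmetric])
      finally show ?thesis unfolding n .
    qed
  qed simp
  then show ?thesis
  proof (rule rare_weaken)
    fix \<omega>
    assume "nrm n (u \<omega>) \<noteq> 0 \<and> (\<Sum>r<m. ?X \<omega> (\<omega> (b, r))) \<le> real m * (1 - \<epsilon>)"
    then have that: "nrm n (u \<omega>) \<noteq> 0"
      "(\<Sum>r<m. ?X \<omega> (\<omega> (b, r))) \<le> real m * (1 - \<epsilon>)" by auto
    have "(\<Sum>r<m. F \<omega> (\<omega> (b, r))) = (\<Sum>r<m. t - t * ?X \<omega> (\<omega> (b, r)))"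
      using that(1) unfolding F_def by (intro sum.cong) auto
    also have "\<dots> = t * (real m - (\<Sum>r<m. ?X \<omega> (\<omega> (b, r))))"
      by (simp only: sum_subtractf sum_distrib_left[symmetric]) (simp add: algebra_simps)
    also have "\<dots> \<ge> t * (real m * \<epsilon>)"
      using that(2) t by (intro mult_left_mono) (auto simp: algebra_simps)
    finally show "t * (real m * \<epsilon>) \<le> (\<Sum>r<m. F \<omega> (\<omega> (b, r)))" .
  next
    show "exp (3 * t\<^sup>2 * real (card {..<m}) - t * (real m * \<epsilon>)) \<le> exp (- (real m * \<epsilon>\<^sup>2 / 12))"
      by (simp add: t_def power2_eq_square algebra_simps)
  qed
qed

text \<open>A chi-square tail at the fixed exponent 1/4, where one row has moment sqrt 2 < e. This
  crude form is enough because \<theta> is used only well above \<open>card T\<close>. As only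
  sampled rows are asked for, it also covers half of the last layer.\<close>

lemma square_sum_tail:
  assumes T: "finite T" "{b} \<times> T \<subseteq> free_rows m L" and n: "n = fan_in d m b"
    and v: "adapted d m L b n v"
  shows "rare (init_measure d m L) (exp (real (card T) - \<theta> / 4)) (\<lambda>\<omega>. \<theta> \<le>
      (\<Sum>r\<in>T. (dotp n (\<omega> (b, r)) (v \<omega>) / nrm n (v \<omega>))\<^sup>2))"
proof -
  let ?P = "init_measure d m L"
  define F where "F = (\<lambda>\<omega> y. 1/4 * (dotp n y (v \<omega>) / nrm n (v \<omega>))\<^sup>2)"
  have "rare ?P (exp (1 * real (card T) - \<theta> / 4)) (\<lambda>\<omega>. \<theta> / 4 \<le> (\<Sum>r\<in>T. F \<omega> (\<omega> (b, r))))"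
  proof (rule layer_chernoff[OF T])
    fix r assume "r \<in> T"
    then have r: "(b, r) \<in> free_rows m L" using T by auto
    note [measurable] = measurable_dotp_adapted[OF v r n] measurable_nrm_adapted[OF v]
    show "(\<lambda>\<omega>. F \<omega> (\<omega> (b, r))) \<in> borel_measurable ?P" unfolding F_def by measurable
  next
    fix \<omega> show "F \<omega> \<in> borel_measurable (std_gaussian_vec (fan_in d m b))"
      unfolding F_def n[symmetric] by measurable
  next
    fix \<omega> \<omega>' :: "nat \<times> nat \<Rightarrow> nat \<Rightarrow> real" assume lt: "\<And>l r. l < b \<Longrightarrow> \<omega> (l, r) = \<omega>' (l, r)"
    have "v \<omega> = v \<omega>'" by (rule adapted_below[OF v]) (erule lt)
    then show "F \<omega> = F \<omega>'" by (simp add: F_def cong: if_cong)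
  next
    fix \<omega>
    show "(\<integral>\<^sup>+y. ennreal (exp (F \<omega> y)) \<partial>std_gaussian_vec (fan_in d m b)) \<le> ennreal (exp 1)"
    proof (cases "nrm n (v \<omega>) = 0")
      case True
      interpret G: prob_space "std_gaussian_vec (fan_in d m b)" by (rule
        prob_space_std_gaussian_vec)
      have "ennreal 1 \<le> ennreal (exp 1)" by (rule ennreal_leI) simp
      then show ?thesis by (simp add: F_def True G.emeasure_space_1)
    next
      case False
      have "1 / sqrt (1 - 2 * (1/4)) \<le> 1 + (1/2) / 2 + (1/2)\<^sup>2"
        using inverse_sqrt_upper[of "1/2"] by simp
      also have "\<dots> \<le> exp 1" using exp_ge_add_one_self[of 1] by (simp add: power2_eq_square)
      finally show ?thesis
        unfolding F_def n using mgf_dotp_square[OF False[unfolded n], of "1/4"] by (simp add: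
          ennreal_leI)
    qed
  qed
  also have "(\<lambda>\<omega>. \<theta> / 4 \<le> (\<Sum>r\<in>T. F \<omega> (\<omega> (b, r)))) = (\<lambda>\<omega>. \<theta> \<le> (\<Sum>r\<in>T. (dotp n (\<omega> (b, r)) (v \<omega>) / nrm
    n (v \<omega>))\<^sup>2))"
    unfolding F_def sum_distrib_left[symmetric] by auto
  finally show ?thesis by simp
qed

text \<open>A Chernoff bound for the count at exponent 1; it has content once \<theta> exceeds the 2
  c m coming from \<open>small_ball_mgf\<close>.\<close>

lemma small_preactivation_tail:
  assumes b: "1 \<le> b" "b < L" and n: "n = fan_in d m b" and c: "0 \<le> c"
    and u: "adapted d m L b n u"
  shows "rare (init_measure d m L) (exp (2 * c * real m - \<theta>)) (\<lambda>\<omega>. \<theta> \<le>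
      real (card {r. r < m \<and> \<bar>dotp n (\<omega> (b, r)) (u \<omega>)\<bar> < c * nrm n (u \<omega>)}))"
proof -
  let ?P = "init_measure d m L"
  define F where "F = (\<lambda>\<omega> y. if \<bar>dotp n y (u \<omega>)\<bar> < c * nrm n (u \<omega>) then 1 else 0 :: real)"
  have fr: "{b} \<times> {..<m} \<subseteq> free_rows m L" using b free_rows_lt by auto
  have "rare ?P (exp (2 * c * real (card {..<m}) - \<theta>)) (\<lambda>\<omega>. \<theta> \<le> (\<Sum>r<m. F \<omega> (\<omega> (b, r))))"
  proof (rule layer_chernoff[OF _ fr])
    fix r assume "r \<in> {..<m}"
    then have r: "(b, r) \<in> free_rows m L" using fr by auto
    note [measurable] = measurable_dotp_adapted[OF u r n] measurable_nrm_adapted[OF u]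
    show "(\<lambda>\<omega>. F \<omega> (\<omega> (b, r))) \<in> borel_measurable ?P" unfolding F_def by measurable
  next
    fix \<omega> show "F \<omega> \<in> borel_measurable (std_gaussian_vec (fan_in d m b))"
      unfolding F_def n[symmetric] by measurable
  next
    fix \<omega> \<omega>' :: "nat \<times> nat \<Rightarrow> nat \<Rightarrow> real" assume lt: "\<And>l r. l < b \<Longrightarrow> \<omega> (l, r) = \<omega>' (l, r)"
    have "u \<omega> = u \<omega>'" by (rule adapted_below[OF u]) (erule lt)
    then show "F \<omega> = F \<omega>'" by (simp add: F_def cong: if_cong)
  next
    fix \<omega>
    show "(\<integral>\<^sup>+y. ennreal (exp (F \<omega> y)) \<partial>std_gaussian_vec (fan_in d m b)) \<le> ennreal (exp (2 * c))"
      unfolding F_def n by (rule small_ball_mgf[OF c])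
  qed simp
  also have "(\<lambda>\<omega>. \<theta> \<le> (\<Sum>r<m. F \<omega> (\<omega> (b, r)))) =
      (\<lambda>\<omega>. \<theta> \<le> real (card {r. r < m \<and> \<bar>dotp n (\<omega> (b, r)) (u \<omega>)\<bar> < c * nrm n (u \<omega>)}))"
    unfolding F_def by (simp add: sum.If_cases Int_def)
  finally show ?thesis by simp
qed

section \<open>The network at a fixed input\<close>

text \<open>\<open>gain / m\<close> is the squared stretch of \<open>v\<close> under a layer masked
  by the signs at \<open>u\<close>, see \<open>nrm_active_layer\<close>. Dividing by the norm makes
  the tail bounds independent of the size of \<open>v\<close>.\<close>

definition gain :: "nat \<Rightarrow> nat \<Rightarrow> (nat \<Rightarrow> nat \<Rightarrow> real) \<Rightarrow> (nat \<Rightarrow> real) \<Rightarrow> (nat \<Rightarrow> real) \<Rightarrow> real" where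
  "gain n m B u v = (\<Sum>r<m. if 0 < dotp n (B r) u then 2 * (dotp n (B r) v / nrm n v)\<^sup>2 else 0)"

definition row_gain :: "nat \<Rightarrow> nat set \<Rightarrow> (nat \<Rightarrow> nat \<Rightarrow> real) \<Rightarrow> (nat \<Rightarrow> real) \<Rightarrow> real" where
  "row_gain n T B v = (\<Sum>r\<in>T. (dotp n (B r) v / nrm n v)\<^sup>2)"

lemma dotp_eq_0_of_nrm: "nrm n v = 0 \<Longrightarrow> dotp n y v = 0"
  by (rule dotp_zero_right) (simp add: L2_set_eq_0_iff)

lemma nrm_active_layer:
  "(nrm m (\<lambda>r. sqrt (2 / real m) * (if 0 < dotp n (B r) u then dotp n (B r) v else 0)))\<^sup>2
    = gain n m B u v / real m * (nrm n v)\<^sup>2"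
proof -
  have "(nrm m (\<lambda>r. sqrt (2 / real m) * (if 0 < dotp n (B r) u then dotp n (B r) v else 0)))\<^sup>2
    = (\<Sum>r<m. (sqrt (2 / real m) * (if 0 < dotp n (B r) u then dotp n (B r) v else 0))\<^sup>2)"
    by (simp add: L2_set_def sum_nonneg)
  also have "\<dots> = (\<Sum>r<m. (if 0 < dotp n (B r) u then 2 * (dotp n (B r) v / nrm n v)\<^sup>2 else 0) *
    ((nrm n v)\<^sup>2 / real m))"
  proof (intro sum.cong refl)
    fix r
    show "(sqrt (2 / real m) * (if 0 < dotp n (B r) u then dotp n (B r) v else 0))\<^sup>2 =
        (if 0 < dotp n (B r) u then 2 * (dotp n (B r) v / nrm n v)\<^sup>2 else 0) * ((nrm n v)\<^sup>2 / real
          m)"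
      using dotp_eq_0_of_nrm[where n=n and v=v and y="B r"]
      by (cases "nrm n v = 0") (auto simp: power_mult_distrib power_divide)
  qed
  also have "\<dots> = gain n m B u v * ((nrm n v)\<^sup>2 / real m)"
    unfolding gain_def by (rule sum_distrib_right[symmetric])
  finally show ?thesis by simp
qed

lemma L2_rows_eq: "(L2_set (\<lambda>r. dotp n (B r) v) T)\<^sup>2 = row_gain n T B v * (nrm n v)\<^sup>2"
proof -
  have "(L2_set (\<lambda>r. dotp n (B r) v) T)\<^sup>2 = (\<Sum>r\<in>T. (dotp n (B r) v)\<^sup>2)"
    by (simp add: L2_set_def sum_nonneg)
  also have "\<dots> = row_gain n T B v * (nrm n v)\<^sup>2"
    unfolding row_gain_def sum_distrib_right
    by (intro sum.cong refl) (use dotp_eq_0_of_nrm[where n=n and v=v] in \<open>auto simp: power_divide\<close>)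
  finally show ?thesis .
qed

text \<open>ReLU as a mask by its own argument: activations then obey
  \<open>nrm_active_layer\<close> with \<open>u = v\<close>, just as \<open>lin\<close> does with
  its own \<open>v\<close>.\<close>

lemma act_Suc_active:
  "act d m A x (Suc l) = (\<lambda>r. sqrt (2 / real m) * (if 0 < dotp (fan_in d m (Suc l)) (A (Suc l) r)
    (act d m A x l)
     then dotp (fan_in d m (Suc l)) (A (Suc l) r) (act d m A x l) else 0))"
  by (auto simp: relu_def fun_eq_iff max_def)

text \<open>At most L factors 1 + 1 / L compound to at most e. The bound 4 is a convenient square:
  norms grow by at most 2.\<close>

lemma power_one_plus_inverse_le:
  assumes "k \<le> L" "0 < L"
  shows "(1 + 1 / real L) ^ k \<le> 4"
proof -
  have "(1 + 1 / real L) ^ k \<le> exp (1 / real L) ^ k"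
    by (intro power_mono exp_ge_add_one_self) auto
  also have "\<dots> = exp (real k / real L)" by (simp add: exp_of_nat_mult[symmetric])
  also have "\<dots> \<le> exp 1" using assms by simp
  also have "\<dots> \<le> 4" using exp_le by simp
  finally show ?thesis .
qed

text \<open>Exactly \<open>s\<close> elements, so that one binomial coefficient counts them; smaller
  supports are enlarged by \<open>s_subset_extend\<close>.\<close>

definition s_subsets :: "nat \<Rightarrow> nat \<Rightarrow> nat set set" where
  "s_subsets m s = {S. S \<subseteq> {..<m} \<and> card S = s}"

lemma finite_s_subsets: "finite (s_subsets m s)"
  unfolding s_subsets_def by simp

lemma card_s_subsets:
  assumes "s \<le> m"
  shows "real (card (s_subsets m s)) \<le> real m ^ s"
proof -
  have "card (s_subsets m s) = m choose s"
    unfolding s_subsets_def using n_subsets[of "{..<m}" s] by simp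
  also have "\<dots> \<le> m ^ s" by (rule binomial_le_pow[OF assms])
  finally have "real (card (s_subsets m s)) \<le> real (m ^ s)" by (rule of_nat_mono)
  then show ?thesis by simp
qed

lemma s_subset_extend:
  assumes "S \<subseteq> {..<m}" "card S \<le> s" "s \<le> m"
  obtains S' where "S \<subseteq> S'" "S' \<in> s_subsets m s"
  using exists_subset_between[of S s "{..<m}"] assms unfolding s_subsets_def by auto

text \<open>The event on which the deterministic analysis at the input \<open>x\<close> applies, reduced to
  finitely many directions \<open>w\<close>.\<close>

definition good_point :: "nat \<Rightarrow> nat \<Rightarrow> nat \<Rightarrow> nat \<Rightarrow> (nat \<Rightarrow> nat \<Rightarrow> nat \<Rightarrow> real) \<Rightarrow> (nat \<Rightarrow> real) \<Rightarrow> bool"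
  where
  "good_point d m L s A x \<longleftrightarrow>
    (\<forall>b\<in>{1..<L}. gain (fan_in d m b) m (A b) (act d m A x (b - 1)) (act d m A x (b - 1)) < real m
      * (1 + 1 / real L)) \<and>
    (\<forall>b\<in>{1..<L}. nrm (fan_in d m b) (act d m A x (b - 1)) \<noteq> 0 \<longrightarrow>
      real m * (1 - 1 / (2 * real L)) < gain (fan_in d m b) m (A b) (act d m A x (b - 1)) (act d m
        A x (b - 1))) \<and>
    (\<forall>b\<in>{1..<L}. real (card {r. r < m \<and> \<bar>dotp (fan_in d m b) (A b r) (act d m A x (b - 1))\<bar>
      < real s / (16 * real m) * nrm (fan_in d m b) (act d m A x (b - 1))}) < real s / 2) \<and>
    (\<forall>b\<in>{2..<L}. \<forall>a\<in>{1..<L}. \<forall>S\<in>s_subsets m s. \<forall>w\<in>lattice_net S.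
      gain m m (A b) (act d m A x (b - 1)) (lin d m A x a w (b - 1)) < real m * (1 + 1 / real L)) \<and>
    (\<forall>b\<in>{2..<L}. \<forall>a\<in>{1..<L}. \<forall>S\<in>s_subsets m s. \<forall>w\<in>lattice_net S. \<forall>T\<in>s_subsets m s.
      row_gain m T (A b) (lin d m A x a w (b - 1)) < real m / (128 * (real L)\<^sup>2))"

text \<open>The gains multiply along the layers, and \<open>seminorm_le_of_net\<close> passes from
  net directions to all sparse ones at the price of a factor 2. The condition that the squared norm
  of \<open>x\<close> is at least 1/2 keeps the activations away from 0, so that small
  preactivations, rare relative to the activation norm, are also rare absolutely.\<close>

lemma good_weights_of_good_point:
  assumes m: "0 < m" and s: "0 < s" "s \<le> m" and L: "2 \<le> L" and R: "0 \<le> R"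
    and E: "E = 6 * R / sqrt (real s)" "8 * real L * E \<le> 1"
    and \<beta>: "real m * E\<^sup>2 \<le> (real s / (32 * real m))\<^sup>2 * real s"
    and x: "nrm d x \<le> 1" "1/2 \<le> (nrm d x)\<^sup>2"
    and good: "good_point d m L s A x"
  shows "good_weights d m L s A x (real s / (32 * real m)) E R"
proof -
  let ?g = "\<lambda>l. gain (fan_in d m (Suc l)) m (A (Suc l)) (act d m A x l) (act d m A x l)"
  note g = good[unfolded good_point_def]
  have up: "?g l < real m * (1 + 1 / real L)"
    if "Suc l < L" for l
    using g[THEN conjunct1, rule_format, of "Suc l"] that by simp
  have low: "real m * (1 - 1 / (2 * real L)) < ?g l"
    if "Suc l < L" "nrm (fan_in d m (Suc l)) (act d m A x l) \<noteq> 0" for l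
    using g[THEN conjunct2, THEN conjunct1, rule_format, of "Suc l"] that by simp
  have few: "real (card {r. r < m \<and> \<bar>dotp (fan_in d m (Suc l)) (A (Suc l) r) (act d m A x l)\<bar>
      < real s / (16 * real m) * nrm (fan_in d m (Suc l)) (act d m A x l)}) < real s / 2"
    if "Suc l < L" for l
    using g[THEN conjunct2, THEN conjunct2, THEN conjunct1, rule_format, of "Suc l"] that by simp
  have lin_up: "gain m m (A b) (act d m A x (b - 1)) (lin d m A x a w (b - 1)) < real m * (1 + 1 /
    real L)"
    if "b \<in> {2..<L}" "a \<in> {1..<L}" "S \<in> s_subsets m s" "w \<in> lattice_net S" for a b S w
    by (rule g[THEN conjunct2, THEN conjunct2, THEN conjunct2, THEN conjunct1,
          THEN bspec, OF that(1), THEN bspec, OF that(2), THEN bspec, OF that(3), THEN bspec, OF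
            that(4)])
  have rows_up: "row_gain m T (A b) (lin d m A x a w (b - 1)) < real m / (128 * (real L)\<^sup>2)"
    if "b \<in> {2..<L}" "a \<in> {1..<L}" "S \<in> s_subsets m s" "w \<in> lattice_net S" "T \<in> s_subsets m s" for
      a b S T w
    by (rule g[THEN conjunct2, THEN conjunct2, THEN conjunct2, THEN conjunct2,
          THEN bspec, OF that(1), THEN bspec, OF that(2), THEN bspec, OF that(3), THEN bspec, OF
            that(4),
          THEN bspec, OF that(5)])
  define N where "N = (\<lambda>l. (nrm (fan_in d m (Suc l)) (act d m A x l))\<^sup>2)"
  have N0: "N 0 = (nrm d x)\<^sup>2" by (simp add: N_def fan_in_def)
  have NS: "N (Suc l) = ?g l / real m * N l" for l
    using nrm_active_layer[of m "fan_in d m (Suc l)" "A (Suc l)" "act d m A x l" "act d m A x l"]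
    by (simp only: N_def act_Suc_active) (simp add: fan_in_def)
  have Nnn: "0 \<le> N l" for l by (simp add: N_def)
  have N_up: "N l \<le> (1 + 1 / real L) ^ l" if "l < L" for l
    using that
  proof (induction l)
    case 0
    show ?case using x(1) power_mono[OF x(1), of 2] by (simp add: N0)
  next
    case (Suc l)
    have "?g l / real m \<le> 1 + 1 / real L"
      using up[OF Suc.prems] m by (simp add: field_simps)
    then have "N (Suc l) \<le> (1 + 1 / real L) * (1 + 1 / real L) ^ l"
      unfolding NS using Suc Nnn[of l] by (intro mult_mono) auto
    then show ?case by simp
  qed
  \<comment> \<open>A linear lower bound as in Bernoulli's inequality. It stays above 1/4, and its
    positivity is needed along the way: the lower gain bound applies only to nonzero
    activations.\<close>
  have N_low: "(1 - real l / (2 * real L)) * (1/2) \<le> N l" if "l < L" for l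
    using that
  proof (induction l)
    case 0
    show ?case using x(2) by (simp add: N0)
  next
    case (Suc l)
    have IH: "(1 - real l / (2 * real L)) * (1/2) \<le> N l" using Suc by simp
    have l1: "real l / (2 * real L) \<le> 1" using Suc.prems by simp
    have "0 < (1 - real l / (2 * real L)) * (1/2)" using Suc.prems by simp
    then have "0 < N l" using IH by (rule less_le_trans)
    then have "nrm (fan_in d m (Suc l)) (act d m A x l) \<noteq> 0" by (auto simp: N_def)
    from low[OF Suc.prems this]
    have g1: "1 - 1 / (2 * real L) \<le> ?g l / real m"
      using m by (simp add: field_simps)
    have "(1 - real (Suc l) / (2 * real L)) * (1/2) \<le> (1 - 1 / (2 * real L)) * ((1 - real l / (2 *
      real L)) * (1/2))"
    proof -
      have "(1 - 1 / (2 * real L)) * (1 - real l / (2 * real L)) - (1 - real (Suc l) / (2 * real L))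
          = 1 / (2 * real L) * (real l / (2 * real L))"
        by (simp add: add_divide_distrib algebra_simps)
      moreover have "0 \<le> 1 / (2 * real L) * (real l / (2 * real L))" by simp
      ultimately have "1 - real (Suc l) / (2 * real L) \<le> (1 - 1 / (2 * real L)) * (1 - real l / (2
        * real L))"
        by linarith
      then have "(1 - real (Suc l) / (2 * real L)) * (1/2)
          \<le> (1 - 1 / (2 * real L)) * (1 - real l / (2 * real L)) * (1/2)"
        by (rule mult_right_mono) simp
      then show ?thesis by (simp only: mult.assoc)
    qed
    also have "\<dots> \<le> ?g l / real m * N l"
    proof (rule mult_mono[OF g1 IH])
      have "1 / (2 * real L) \<le> 1" using L by simp
      then show "0 \<le> ?g l / real m"
        using g1 by linarith
    qed (use l1 in simp)
    finally show ?case by (simp only: NS)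
  qed
  have act_le: "nrm (fan_in d m (Suc l)) (act d m A x l) \<le> 2" if "l < L" for l
  proof (rule power2_le_imp_le)
    show "(nrm (fan_in d m (Suc l)) (act d m A x l))\<^sup>2 \<le> 2\<^sup>2"
      using N_up[OF that] power_one_plus_inverse_le[of l L] that by (simp add: N_def)
  qed simp
  have act_ge: "1/2 \<le> nrm (fan_in d m (Suc l)) (act d m A x l)" if "l < L" for l
  proof (rule power2_le_imp_le)
    have "real l / (2 * real L) \<le> 1/2" using that by (simp add: field_simps)
    then show "(1/2)\<^sup>2 \<le> (nrm (fan_in d m (Suc l)) (act d m A x l))\<^sup>2"
      using N_low[OF that] by (simp add: N_def power2_eq_square)
  qed simp
  have supp_nrm: "L2_set w S = nrm m w" if "S \<in> s_subsets m s" "\<And>i. i \<notin> S \<Longrightarrow> w i = 0" for S w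
    using that by (intro L2_set_supp[symmetric]) (auto simp: s_subsets_def)
  have fS: "finite S" if "S \<in> s_subsets m s" for S
    using that by (auto simp: s_subsets_def intro: finite_subset)
  \<comment> \<open>The gain bounds concern exactly the propagated images of net directions, so they
    can be multiplied for \<open>w\<close> in the net only.\<close>
  have lin_net: "nrm m (lin d m A x a w b) \<le> 2 * L2_set w S"
    if ab: "1 \<le> a" "a \<le> b" "b < L" and S: "S \<in> s_subsets m s" and w: "w \<in> lattice_net S" for a b S w
  proof -
    have "(nrm m (lin d m A x a w b))\<^sup>2 \<le> (1 + 1 / real L) ^ (b - a) * (nrm m w)\<^sup>2"
      using ab(2,3)
    proof (induction b rule: dec_induct)
      case base
      then show ?case by (simp add: lin_le)
    next
      case (step k)
      have n: "fan_in d m (Suc k) = m" using step ab(1) by (simp add: fan_in_def)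
      have "(nrm m (lin d m A x a w (Suc k)))\<^sup>2
          = gain m m (A (Suc k)) (act d m A x k) (lin d m A x a w k) / real m * (nrm m (lin d m A
            x a w k))\<^sup>2"
        using nrm_active_layer[of m m "A (Suc k)" "act d m A x k" "lin d m A x a w k"] step n by
          simp
      also have "\<dots> \<le> (1 + 1 / real L) * ((1 + 1 / real L) ^ (k - a) * (nrm m w)\<^sup>2)"
      proof (rule mult_mono)
        show "gain m m (A (Suc k)) (act d m A x k) (lin d m A x a w k) / real m \<le> 1 + 1 / real L"
          using lin_up[of "Suc k" a S w] step ab S w m by (simp add: field_simps)
        show "(nrm m (lin d m A x a w k))\<^sup>2 \<le> (1 + 1 / real L) ^ (k - a) * (nrm m w)\<^sup>2"
          using step by simp
      qed auto
      also have "\<dots> = (1 + 1 / real L) ^ (Suc k - a) * (nrm m w)\<^sup>2"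
        using step by (simp add: Suc_diff_le)
      finally show ?case .
    qed
    also have "\<dots> \<le> 4 * (nrm m w)\<^sup>2"
      using power_one_plus_inverse_le[of "b - a" L] ab L by (intro mult_right_mono) auto
    also have "\<dots> = (2 * nrm m w)\<^sup>2" by (simp add: power_mult_distrib)
    finally have "nrm m (lin d m A x a w b) \<le> 2 * nrm m w" by (rule power2_le_imp_le) simp
    then show ?thesis using supp_nrm[OF S lattice_net_supp[OF w]] by simp
  qed
  show ?thesis
  proof
    show "0 < m" "0 < s" "s \<le> m" "2 \<le> L" "0 \<le> R" "E = 6 * R / sqrt (real s)" "8 * real L * E \<le> 1"
      "0 \<le> real s / (32 * real m)" "real m * E\<^sup>2 \<le> (real s / (32 * real m))\<^sup>2 * real s"
      by fact+ (simp_all add: \<beta>)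
    show "nrm (fan_in d m (Suc l)) (act d m A x l) \<le> 2" if "l < L" for l by (rule act_le[OF that])
  next
    fix a b S and w :: "nat \<Rightarrow> real"
    assume *: "1 \<le> a" "a \<le> b" "b < L" "S \<subseteq> {..<m}" "card S \<le> s" "\<And>i. i \<notin> S \<Longrightarrow> w i = 0"
    obtain S' where S': "S \<subseteq> S'" "S' \<in> s_subsets m s" using s_subset_extend[OF *(4,5) s(2)] .
    have w: "w i = 0" if "i \<notin> S'" for i using * S' that by auto
    have "nrm m (lin d m A x a w b) \<le> 2 * 2 * L2_set w S'"
      by (rule seminorm_le_of_net[OF fun_seminorm_lin fS[OF S'(2)] _ _ w])
        (use lin_net[OF *(1-3) S'(2)] in auto)
    then show "nrm m (lin d m A x a w b) \<le> 4 * nrm m w" using supp_nrm[OF S'(2) w] by simp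
  next
    fix a b S T and w :: "nat \<Rightarrow> real"
    assume *: "1 \<le> a" "a < b" "b < L" "S \<subseteq> {..<m}" "card S \<le> s" "T \<subseteq> {..<m}" "card T \<le> s"
      "\<And>i. i \<notin> S \<Longrightarrow> w i = 0"
    obtain S' where S': "S \<subseteq> S'" "S' \<in> s_subsets m s" using s_subset_extend[OF *(4,5) s(2)] .
    obtain T' where T': "T \<subseteq> T'" "T' \<in> s_subsets m s" using s_subset_extend[OF *(6,7) s(2)] .
    have w: "w i = 0" if "i \<notin> S'" for i using * S' that by auto
    let ?q = "\<lambda>w. L2_set (\<lambda>r. dotp m (A b r) (lin d m A x a w (b - 1))) T'"
    have net: "?q v \<le> sqrt (real m / 2) / (4 * real L) * L2_set v S'" if v: "v \<in> lattice_net S'"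
      for v
    proof -
      \<comment> \<open>As 128 = 2 * 8^2, this is sqrt (m / 2) / (8 L). The propagation bound 2 and
        the net factor 2 bring it to the required sqrt (m / 2) / (2 L).\<close>
      let ?K = "sqrt (real m / (128 * (real L)\<^sup>2))"
      have "(?q v)\<^sup>2 = row_gain m T' (A b) (lin d m A x a v (b - 1)) * (nrm m (lin d m A x a v (b
        - 1)))\<^sup>2"
        by (rule L2_rows_eq)
      also have "\<dots> \<le> real m / (128 * (real L)\<^sup>2) * (nrm m (lin d m A x a v (b - 1)))\<^sup>2"
        using rows_up[of b a S' v T'] * S' T' v by (intro mult_right_mono) auto
      also have "\<dots> = (?K * nrm m (lin d m A x a v (b - 1)))\<^sup>2"
        by (simp add: power_mult_distrib)
      finally have "?q v \<le> ?K * nrm m (lin d m A x a v (b - 1))" by (rule power2_le_imp_le) simp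
      also have "\<dots> \<le> ?K * (2 * L2_set v S')"
        using lin_net[of a "b - 1" S' v] * S' v by (intro mult_left_mono) auto
      also have "?K = sqrt (real m / 2) / (8 * real L)"
      proof -
        have "real m / (128 * (real L)\<^sup>2) = (real m / 2) / (8 * real L)\<^sup>2" by (simp add:
          power_mult_distrib)
        then show ?thesis by (simp only: real_sqrt_divide) (simp add: real_sqrt_mult)
      qed
      finally show ?thesis by (simp add: mult.commute)
    qed
    have "L2_set (\<lambda>r. dotp m (A b r) (lin d m A x a w (b - 1))) T \<le> ?q w"
      using T' fS by (intro L2_set_mono_set) auto
    also have "\<dots> \<le> 2 * (sqrt (real m / 2) / (4 * real L)) * L2_set w S'"
      by (rule seminorm_le_of_net[OF fun_seminorm_lin_rows fS[OF S'(2)] _ net w]) auto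
    also have "\<dots> = sqrt (real m / 2) / (2 * real L) * nrm m w"
      using supp_nrm[OF S'(2) w] by simp
    finally show "L2_set (\<lambda>r. dotp m (A b r) (lin d m A x a w (b - 1))) T \<le> sqrt (real m / 2) / (2
      * real L) * nrm m w" .
  next
    fix b assume b: "1 \<le> b" "b < L"
    then obtain l where l: "b = Suc l" by (cases b) auto
    have "card {r. r < m \<and> \<bar>dotp (fan_in d m b) (A b r) (act d m A x (b - 1))\<bar> < real s / (32 *
      real m)}
      \<le> card {r. r < m \<and> \<bar>dotp (fan_in d m (Suc l)) (A (Suc l) r) (act d m A x l)\<bar>
      < real s / (16 * real m) * nrm (fan_in d m (Suc l)) (act d m A x l)}"
    proof (rule card_mono)
      \<comment> \<open>The activation norm is at least 1/2, which turns the relative threshold with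
        16 into the absolute one with 32.\<close>
      have "real s / (32 * real m) = real s / (16 * real m) * (1/2)" by simp
      also have "\<dots> \<le> real s / (16 * real m) * nrm (fan_in d m (Suc l)) (act d m A x l)"
        using act_ge[of l] l b by (intro mult_left_mono) auto
      finally show "{r. r < m \<and> \<bar>dotp (fan_in d m b) (A b r) (act d m A x (b - 1))\<bar> < real s / (32
        * real m)}
        \<subseteq> {r. r < m \<and> \<bar>dotp (fan_in d m (Suc l)) (A (Suc l) r) (act d m A x l)\<bar>
          < real s / (16 * real m) * nrm (fan_in d m (Suc l)) (act d m A x l)}"
        unfolding l by auto
    qed simp
    then show "2 * card {r. r < m \<and> \<bar>dotp (fan_in d m b) (A b r) (act d m A x (b - 1))\<bar> < real s /
      (32 * real m)} \<le> s"
      using few[of l] l b by linarith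
  qed
qed

lemma rare_ex_le:
  assumes "finite I" "real (card I) \<le> N" "0 \<le> p" "\<And>i. i \<in> I \<Longrightarrow> rare M p (P i)"
  shows "rare M (N * p) (\<lambda>\<omega>. \<exists>i\<in>I. P i \<omega>)"
  by (rule rare_weaken[OF rare_ex[OF assms(1,4)]]) (use assms in \<open>auto intro: mult_right_mono\<close>)

text \<open>The first three summands come from the network itself, the last two from a union bound over
  the sparse directions.\<close>

definition point_failure :: "nat \<Rightarrow> nat \<Rightarrow> nat \<Rightarrow> real" where
  "point_failure m L s =
    (let p = exp (- (real m / (48 * (real L)\<^sup>2)));
         p' = exp (- (real m / (32 * (real L)\<^sup>2)));
         p'' = exp (- (3 / 8 * real s));
         p3 = exp (real s - real m / (512 * (real L)\<^sup>2))
     in real L * p' + (real L * p + (real L * p'' +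
      (real L * (real L * (real m ^ s * (12 ^ s * p'))) +
       real L * (real L * (real m ^ s * (12 ^ s * (real m ^ s * p3))))))))"

text \<open>Each clause involves one layer \<open>b\<close> and vectors adapted to \<open>b\<close>,
  since supports and net directions are deterministic; the one-layer tails then apply to each. A
  layer index counts L, a set of size \<open>s\<close> counts \<open>m ^ s\<close>, a net
  \<open>12 ^ s\<close>.\<close>

lemma rare_not_good_point:
  assumes s: "s \<le> m" and L: "2 \<le> L"
  shows "rare (init_measure d m L) (point_failure m L s) (\<lambda>\<omega>. \<not> good_point d m L s (curry \<omega>) x)"
proof -
  define p where "p = exp (- (real m / (48 * (real L)\<^sup>2)))"
  define p' where "p' = exp (- (real m / (32 * (real L)\<^sup>2)))"
  define p'' where "p'' = exp (- (3 / 8 * real s))"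
  define p3 where "p3 = exp (real s - real m / (512 * (real L)\<^sup>2))"
  let ?P = "init_measure d m L"
  have act: "adapted d m L b (fan_in d m b) (\<lambda>\<omega>. act d m (curry \<omega>) x (b - 1))" if "1 \<le> b" "b < L"
    for b
    using adapted_act[of "b - 1" L d m x] that by simp
  have lin: "adapted d m L b m (\<lambda>\<omega>. lin d m (curry \<omega>) x a w (b - 1))" if "1 \<le> b" "b < L" "1 \<le> a"
    for a b w
    using adapted_lin[of a "b - 1" L d m x w] that by simp
  have card1: "real (card {1..<L}) \<le> real L" "real (card {2..<L}) \<le> real L" by auto
  have net: "finite (lattice_net S)" "real (card (lattice_net S)) \<le> 12 ^ s" if "S \<in> s_subsets m s"
    for S
    using finite_lattice_net[of S] card_lattice_net[of S] that finite_subset[of S "{..<m}"]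
    by (auto simp: s_subsets_def)
  have pos: "0 \<le> p" "0 \<le> p'" "0 \<le> p''" "0 \<le> p3" by (auto simp: p_def p'_def p''_def p3_def)
  have p_eq: "p = exp (- (real m * (1 / (2 * real L))\<^sup>2 / 12))"
    by (simp add: p_def power_divide power_mult_distrib)
  have p'_eq: "p' = exp (- (real m * (1 / real L)\<^sup>2 / 32))"
    by (simp add: p'_def power_divide)
  have 1: "rare ?P (real L * p') (\<lambda>\<omega>. \<exists>b\<in>{1..<L}. real m * (1 + 1 / real L) \<le>
      gain (fan_in d m b) m (curry \<omega> b) (act d m (curry \<omega>) x (b - 1)) (act d m (curry \<omega>) x (b -
        1)))"
  proof (rule rare_ex_le[OF _ card1(1) pos(2)])
    fix b assume b: "b \<in> {1..<L}"
    show "rare ?P p' (\<lambda>\<omega>. real m * (1 + 1 / real L) \<le>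
      gain (fan_in d m b) m (curry \<omega> b) (act d m (curry \<omega>) x (b - 1)) (act d m (curry \<omega>) x (b -
        1)))"
      by (simp only: gain_def p'_eq curry_conv cong: if_cong,
          rule active_square_upper_tail[OF _ _ refl _ _ act act]) (use b L in auto)
  qed simp
  have 2: "rare ?P (real L * p) (\<lambda>\<omega>. \<exists>b\<in>{1..<L}. nrm (fan_in d m b) (act d m (curry \<omega>) x (b - 1))
    \<noteq> 0 \<and>
      gain (fan_in d m b) m (curry \<omega> b) (act d m (curry \<omega>) x (b - 1)) (act d m (curry \<omega>) x (b - 1))
        \<le> real m * (1 - 1 / (2 * real L)))"
  proof (rule rare_ex_le[OF _ card1(1) pos(1)])
    fix b assume b: "b \<in> {1..<L}"
    show "rare ?P p (\<lambda>\<omega>. nrm (fan_in d m b) (act d m (curry \<omega>) x (b - 1)) \<noteq> 0 \<and>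
      gain (fan_in d m b) m (curry \<omega> b) (act d m (curry \<omega>) x (b - 1)) (act d m (curry \<omega>) x (b - 1))
        \<le> real m * (1 - 1 / (2 * real L)))"
      by (simp only: gain_def p_eq curry_conv cong: if_cong,
          rule active_square_lower_tail[OF _ _ refl _ act]) (use b L in auto)
  qed simp
  have 3: "rare ?P (real L * p'') (\<lambda>\<omega>. \<exists>b\<in>{1..<L}. real s / 2 \<le>
      real (card {r. r < m \<and> \<bar>dotp (fan_in d m b) (curry \<omega> b r) (act d m (curry \<omega>) x (b - 1))\<bar>
      < real s / (16 * real m) * nrm (fan_in d m b) (act d m (curry \<omega>) x (b - 1))}))"
  proof (rule rare_ex_le[OF _ card1(1) pos(3)])
    fix b assume b: "b \<in> {1..<L}"
    \<comment> \<open>The exponent is s / 8 - s / 2 = -3 s / 8; if \<open>m = 0\<close> then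
      \<open>s = 0\<close> as well.\<close>
    have le: "exp (2 * (real s / (16 * real m)) * real m - real s / 2) \<le> p''"
      unfolding p''_def by (cases "m = 0") (use s in auto)
    show "rare ?P p'' (\<lambda>\<omega>. real s / 2 \<le>
      real (card {r. r < m \<and> \<bar>dotp (fan_in d m b) (curry \<omega> b r) (act d m (curry \<omega>) x (b - 1))\<bar>
      < real s / (16 * real m) * nrm (fan_in d m b) (act d m (curry \<omega>) x (b - 1))}))"
      by (rule rare_weaken[OF small_preactivation_tail[OF _ _ refl _ act, of b "real s / (16 *
        real m)" "real s / 2"] _ le])
        (use b in \<open>auto simp: curry_conv\<close>)
  qed simp
  have 4: "rare ?P (real L * (real L * (real m ^ s * (12 ^ s * p'))))
    (\<lambda>\<omega>. \<exists>b\<in>{2..<L}. \<exists>a\<in>{1..<L}. \<exists>S\<in>s_subsets m s. \<exists>w\<in>lattice_net S. real m * (1 + 1 / real L) \<le>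
      gain m m (curry \<omega> b) (act d m (curry \<omega>) x (b - 1)) (lin d m (curry \<omega>) x a w (b - 1)))"
  proof (rule rare_ex_le[OF _ card1(2)], simp, simp add: pos,
      rule rare_ex_le[OF _ card1(1)], simp, simp add: pos,
      rule rare_ex_le[OF finite_s_subsets card_s_subsets[OF s]], simp add: pos,
      rule rare_ex_le[OF net pos(2)], assumption, assumption)
    fix b a S w assume *: "b \<in> {2..<L}" "a \<in> {1..<L}"
    then have n: "m = fan_in d m b" by (simp add: fan_in_def)
    have act': "adapted d m L b m (\<lambda>\<omega>. act d m (curry \<omega>) x (b - 1))"
      using act[of b] * n by (metis atLeastLessThan_iff le_trans one_le_numeral)
    show "rare ?P p' (\<lambda>\<omega>. real m * (1 + 1 / real L) \<le>
      gain m m (curry \<omega> b) (act d m (curry \<omega>) x (b - 1)) (lin d m (curry \<omega>) x a w (b - 1)))"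
      by (simp only: gain_def p'_eq curry_conv cong: if_cong,
          rule active_square_upper_tail[OF _ _ n _ _ act' lin]) (use * L in auto)
  qed
  have 5: "rare ?P (real L * (real L * (real m ^ s * (12 ^ s * (real m ^ s * p3)))))
    (\<lambda>\<omega>. \<exists>b\<in>{2..<L}. \<exists>a\<in>{1..<L}. \<exists>S\<in>s_subsets m s. \<exists>w\<in>lattice_net S. \<exists>T\<in>s_subsets m s.
      real m / (128 * (real L)\<^sup>2) \<le> row_gain m T (curry \<omega> b) (lin d m (curry \<omega>) x a w (b - 1)))"
  proof (rule rare_ex_le[OF _ card1(2)], simp, simp add: pos,
      rule rare_ex_le[OF _ card1(1)], simp, simp add: pos,
      rule rare_ex_le[OF finite_s_subsets card_s_subsets[OF s]], simp add: pos,
      rule rare_ex_le[OF net], assumption, assumption, simp add: pos,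
      rule rare_ex_le[OF finite_s_subsets card_s_subsets[OF s] pos(4)])
    fix b a S w T assume *: "b \<in> {2..<L}" "a \<in> {1..<L}" "T \<in> s_subsets m s"
    then have n: "m = fan_in d m b" by (simp add: fan_in_def)
    have T: "finite T" "card T = s" "{b} \<times> T \<subseteq> free_rows m L"
      using * by (auto simp: s_subsets_def free_rows_def intro: finite_subset)
    have "rare ?P (exp (real (card T) - real m / (128 * (real L)\<^sup>2) / 4)) (\<lambda>\<omega>. real m / (128 *
      (real L)\<^sup>2) \<le>
        row_gain m T (curry \<omega> b) (lin d m (curry \<omega>) x a w (b - 1)))"
      by (simp only: row_gain_def curry_conv, rule square_sum_tail[OF T(1,3) n lin]) (use * in auto)
    then show "rare ?P p3 (\<lambda>\<omega>. real m / (128 * (real L)\<^sup>2) \<le>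
        row_gain m T (curry \<omega> b) (lin d m (curry \<omega>) x a w (b - 1)))"
      by (simp add: p3_def T(2))
  qed
  have total: "point_failure m L s = real L * p' + (real L * p + (real L * p'' +
      (real L * (real L * (real m ^ s * (12 ^ s * p'))) +
       real L * (real L * (real m ^ s * (12 ^ s * (real m ^ s * p3)))))))"
    by (simp only: point_failure_def Let_def p_def p'_def p''_def p3_def)
  show ?thesis
    unfolding total
    by (rule rare_weaken[OF rare_disj[OF 1 rare_disj[OF 2 rare_disj[OF 3 rare_disj[OF 4 5]]]] _
      order_refl])
      (unfold good_point_def not_less[symmetric], blast)
qed

section \<open>Operator norms of the first and the last layer\<close>

lemma rows_operator_bound:
  assumes net: "\<And>w. w \<in> lattice_net {..<n} \<Longrightarrow> row_gain n T B w < 20 * real m"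
    and v: "\<And>i. i \<notin> {..<n} \<Longrightarrow> v i = 0"
  shows "L2_set (\<lambda>r. dotp n (B r) v) T \<le> 2 * sqrt (20 * real m) * nrm n v"
proof (rule seminorm_le_of_net[OF fun_seminorm_rows _ _ _ v])
  fix w assume w: "w \<in> lattice_net {..<n}"
  have "(L2_set (\<lambda>r. dotp n (B r) w) T)\<^sup>2 \<le> 20 * real m * (nrm n w)\<^sup>2"
    unfolding L2_rows_eq using net[OF w] by (intro mult_right_mono) auto
  also have "\<dots> = (sqrt (20 * real m) * nrm n w)\<^sup>2" by (simp add: power_mult_distrib)
  finally show "L2_set (\<lambda>r. dotp n (B r) w) T \<le> sqrt (20 * real m) * nrm n w"
    by (rule power2_le_imp_le) simp
qed auto

text \<open>The threshold 20 m gives the tail exp (m - 5 m), which beats the net of size 12^n <= exp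
  (3 n) whenever n <= m.\<close>

lemma rare_operator:
  assumes T: "finite T" "{b} \<times> T \<subseteq> free_rows m L" "card T \<le> m" and n: "n = fan_in d m b"
  shows "rare (init_measure d m L) (12 ^ n * exp (- (4 * real m)))
    (\<lambda>\<omega>. \<exists>w\<in>lattice_net {..<n}. 20 * real m \<le> row_gain n T (curry \<omega> b) w)"
proof (rule rare_ex_le)
  show "finite (lattice_net {..<n})" by (rule finite_lattice_net) simp
  show "real (card (lattice_net {..<n})) \<le> 12 ^ n" using card_lattice_net[of "{..<n}"] by simp
  fix w
  have "rare (init_measure d m L) (exp (real (card T) - 20 * real m / 4)) (\<lambda>\<omega>. 20 * real m \<le>
    row_gain n T (curry \<omega> b) w)"
    by (simp only: row_gain_def curry_conv, rule square_sum_tail[OF T(1,2) n adapted_const])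
  then show "rare (init_measure d m L) (exp (- (4 * real m))) (\<lambda>\<omega>. 20 * real m \<le> row_gain n T
    (curry \<omega> b) w)"
    by (rule rare_weaken) (use T(3) in auto)
qed simp

section \<open>From the grid to the sphere\<close>

text \<open>With mesh 1 / m the rounding error sqrt d / m, amplified by an operator norm of order
  sqrt m, stays below 1 for \<open>80 * d \<le> m\<close>, while the union bound over the grid costs
  only about d ln m in the exponent.\<close>

definition grid :: "nat \<Rightarrow> nat \<Rightarrow> (nat \<Rightarrow> real) set" where
  "grid d m = (\<lambda>z j. if j < d then real_of_int (z j) / real m else 0) ` ({..<d} \<rightarrow>\<^sub>E {- int m ..
    int m})"

lemma finite_grid: "finite (grid d m)"
  unfolding grid_def by (intro finite_imageI finite_PiE) auto

lemma card_grid: "card (grid d m) \<le> (2 * m + 1) ^ d"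
proof -
  have "card (grid d m) \<le> card ({..<d} \<rightarrow>\<^sub>E {- int m .. int m})"
    unfolding grid_def by (intro card_image_le finite_PiE) auto
  also have "\<dots> = (2 * m + 1) ^ d" by (simp add: card_PiE nat_add_distrib nat_mult_distrib)
  finally show ?thesis .
qed

lemma grid_approx:
  assumes m: "0 < m" and x: "nrm d x \<le> 1"
  obtains z where "z \<in> grid d m" "nrm d z \<le> nrm d x" "nrm d (\<lambda>j. x j - z j) \<le> sqrt (real d) / real
    m"
proof -
  define k where "k = (\<lambda>j\<in>{..<d}. rnd (real m * x j))"
  define z where "z = (\<lambda>j. if j < d then real_of_int (k j) / real m else 0)"
  have xj: "\<bar>x j\<bar> \<le> 1" if "j < d" for j
  proof -
    have "\<bar>x j\<bar> \<le> L2_set (\<lambda>i. \<bar>x i\<bar>) {..<d}" using that by (intro member_le_L2_set) auto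
    also have "\<dots> = nrm d x" by (simp add: L2_set_def)
    finally show ?thesis using x by linarith
  qed
  have kj: "\<bar>real_of_int (k j)\<bar> \<le> real m * \<bar>x j\<bar>" if "j < d" for j
    using rnd_abs_le[of "real m * x j"] that by (simp add: k_def abs_mult)
  have "k j \<in> {- int m .. int m}" if "j < d" for j
  proof -
    have "\<bar>real_of_int (k j)\<bar> \<le> real m * 1"
      using kj[OF that] mult_left_mono[OF xj[OF that], of "real m"] by linarith
    then show ?thesis by auto
  qed
  then have "k \<in> {..<d} \<rightarrow>\<^sub>E {- int m .. int m}" by (auto simp: k_def)
  then have "z \<in> grid d m" unfolding grid_def z_def by blast
  moreover have "nrm d z \<le> nrm d x"
    using kj m by (intro L2_set_mono_abs) (auto simp: z_def abs_divide field_simps)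
  moreover have "nrm d (\<lambda>j. x j - z j) \<le> sqrt (real (card {..<d})) * (1 / real m)"
  proof (rule L2_set_le_const)
    fix j assume "j \<in> {..<d}"
    then have j: "j < d" by simp
    have "\<bar>real m * x j - real_of_int (k j)\<bar> \<le> 1" using rnd_diff_le[of "real m * x j"] j by (simp
      add: k_def)
    moreover have "real m * x j - real_of_int (k j) = real m * (x j - z j)" using m j by (simp
      add: z_def algebra_simps)
    ultimately have "real m * \<bar>x j - z j\<bar> \<le> 1" using m by (simp add: abs_mult)
    then show "\<bar>x j - z j\<bar> \<le> 1 / real m" using m by (simp add: field_simps)
  qed auto
  ultimately show ?thesis using that by simp
qed

lemma act_cong:
  assumes "\<And>k r j. 1 \<le> k \<Longrightarrow> k \<le> l \<Longrightarrow> r < m \<Longrightarrow> j < fan_in d m k \<Longrightarrow> A k r j = B k r j"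
    "\<And>j. j < d \<Longrightarrow> x j = y j" "r < fan_in d m (Suc l)"
  shows "act d m A x l r = act d m B y l r"
  using assms
proof (induction l arbitrary: r)
  case 0
  then show ?case by (simp add: fan_in_def)
next
  case (Suc l)
  have "r < m" using Suc.prems(3) by (simp add: fan_in_def)
  then have "dotp (fan_in d m (Suc l)) (A (Suc l) r) (act d m A x l) = dotp (fan_in d m (Suc l))
    (B (Suc l) r) (act d m B y l)"
    using Suc by (intro dotp_cong Suc.IH) auto
  then show ?case by simp
qed

text \<open>The weight ball recentred at 0. Unlike the ball around the random weights it does not
  depend on the sample, so one countable dense subset serves all samples.\<close>

definition small_perturbations :: "nat \<Rightarrow> nat \<Rightarrow> nat \<Rightarrow> real \<Rightarrow> (nat \<Rightarrow> nat \<Rightarrow> nat \<Rightarrow> real) set" where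
  "small_perturbations d m L R = {\<Delta>. \<forall>l\<in>{1..L}. \<forall>v. nrm m (\<lambda>r. dotp (fan_in d m l) (\<Delta> l r) v) \<le> R
    * nrm (fan_in d m l) v}"

lemma small_perturbationsD:
  "\<Delta> \<in> small_perturbations d m L R \<Longrightarrow> l \<in> {1..L} \<Longrightarrow>
    nrm m (\<lambda>r. dotp (fan_in d m l) (\<Delta> l r) v) \<le> R * nrm (fan_in d m l) v"
  by (simp add: small_perturbations_def)

abbreviation perturb :: "(nat \<Rightarrow> nat \<Rightarrow> nat \<Rightarrow> real) \<Rightarrow> (nat \<Rightarrow> nat \<Rightarrow> nat \<Rightarrow> real) \<Rightarrow> nat \<Rightarrow> nat \<Rightarrow> nat \<Rightarrow>
  real" where
  "perturb A \<Delta> \<equiv> \<lambda>l r j. A l r j + \<Delta> l r j"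

lemma dotp_add_left: "dotp n (\<lambda>j. u j + v j) w = dotp n u w + dotp n v w"
  by (simp add: dotp_def algebra_simps sum.distrib)

text \<open>Coincides with \<open>curry \<omega>\<close> except on the second half of the last
  layer, which repeats the first half.\<close>

definition init_rows :: "nat \<Rightarrow> nat \<Rightarrow> (nat \<times> nat \<Rightarrow> nat \<Rightarrow> real) \<Rightarrow> nat \<Rightarrow> nat \<Rightarrow> nat \<Rightarrow> real" where
  "init_rows m L \<omega> l r = \<omega> (l, if l = L \<and> m div 2 \<le> r then r - m div 2 else r)"

text \<open>The first preactivation at \<open>x\<close> is that of \<open>z\<close> plus
  \<open>\<Delta> 1\<close> applied to \<open>x\<close> plus \<open>A 1\<close> applied to
  \<open>x - z\<close>. The last term has norm at most sqrt (80 d / m) <= 1 <= R, so together they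
  fit into the allowance \<open>2 * R\<close>.\<close>

lemma close_to_grid_point:
  assumes good: "good_weights d m L s A z \<beta> E R" and R1: "1 \<le> R" and d: "80 * d \<le> m"
    and op: "\<And>v. (\<And>i. i \<notin> {..<d} \<Longrightarrow> v i = 0) \<Longrightarrow> nrm m (\<lambda>r. dotp d (A 1 r) v) \<le> 2 * sqrt (20 * real
      m) * nrm d v"
    and x: "nrm d x = 1" "nrm d (\<lambda>j. x j - z j) \<le> sqrt (real d) / real m"
    and \<Delta>: "\<Delta> \<in> small_perturbations d m L R"
    and l: "1 \<le> l" "l < L"
  shows "nrm m (\<lambda>r. act d m (perturb A \<Delta>) x l r - act d m A z l r) \<le> 8 * real L * E"
proof -
  interpret good_weights d m L s A z \<beta> E R by fact
  let ?B = "perturb A \<Delta>"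
  \<comment> \<open>The perturbed network runs on \<open>x\<close>, but its layer 0 is declared to
    be \<open>z\<close>; the discrepancy sits in \<open>p 1\<close>.\<close>
  define h where "h = (\<lambda>l. if l = 0 then z else act d m ?B x l)"
  define p where "p = (\<lambda>l r. if l = 1 then dotp d (\<Delta> 1 r) x + dotp d (A 1 r) (\<lambda>j. x j - z j)
    else dotp m (\<Delta> l r) (h (l - 1)))"
  have \<Delta>1: "nrm m (\<lambda>r. dotp (fan_in d m k) (\<Delta> k r) v) \<le> R * nrm (fan_in d m k) v" if "k \<in> {1..L}"
    for k v
    by (rule small_perturbationsD[OF \<Delta> that])
  have "nrm m (\<lambda>r. h l r - h0 l r) \<le> 8 * real L * E"
  proof (rule perturbed_close[OF _ _ _ _ l, of h p])
    show "h 0 j = z j" for j by (simp add: h_def)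
  next
    fix k r assume k: "Suc k < L" "r < m"
    show "h (Suc k) r = sqrt (2 / real m) * relu (dotp (fan_in d m (Suc k)) (A (Suc k) r) (h k) +
      p (Suc k) r)"
    proof (cases k)
      case 0
      then show ?thesis by (simp add: h_def p_def fan_in_def dotp_diff dotp_add_left add.commute)
    next
      case (Suc j)
      then show ?thesis by (simp add: h_def p_def fan_in_def dotp_add_left)
    qed
  next
    let ?y = "\<lambda>j. if j < d then x j - z j else 0"
    have "nrm m (\<lambda>r. dotp d (A 1 r) (\<lambda>j. x j - z j)) = nrm m (\<lambda>r. dotp d (A 1 r) ?y)"
      by (intro L2_set_cong dotp_cong) auto
    also have "\<dots> \<le> 2 * sqrt (20 * real m) * nrm d ?y" by (rule op) simp
    also have "nrm d ?y = nrm d (\<lambda>j. x j - z j)" by (intro L2_set_cong) auto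
    also have "2 * sqrt (20 * real m) * nrm d (\<lambda>j. x j - z j) \<le> 2 * sqrt (20 * real m) * (sqrt
      (real d) / real m)"
      by (intro mult_left_mono x(2)) simp
    also have "\<dots> = sqrt (80 * real d / real m)"
    proof -
      have "2 * sqrt (20 * real m) * (sqrt (real d) / real m) = sqrt 4 * sqrt (20 * real m) * sqrt
        (real d) / sqrt ((real m)\<^sup>2)"
        by simp
      also have "\<dots> = sqrt (4 * (20 * real m) * real d / (real m)\<^sup>2)"
        by (simp only: real_sqrt_mult real_sqrt_divide)
      also have "4 * (20 * real m) * real d / (real m)\<^sup>2 = 80 * real d / real m"
        using m by (simp add: power2_eq_square)
      finally show ?thesis .
    qed
    also have "\<dots> \<le> 1" using d m by (simp add: field_simps)
    finally have 1: "nrm m (\<lambda>r. dotp d (A 1 r) (\<lambda>j. x j - z j)) \<le> 1" .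
    have "nrm m (\<lambda>r. dotp d (\<Delta> 1 r) x) \<le> R" using \<Delta>1[of 1 x] L x(1) by (simp add: fan_in_def)
    moreover have "nrm m (p 1) \<le> nrm m (\<lambda>r. dotp d (\<Delta> 1 r) x) + nrm m (\<lambda>r. dotp d (A 1 r) (\<lambda>j. x j
      - z j))"
      unfolding p_def by (simp add: L2_set_triangle_ineq)
    ultimately show "nrm m (p 1) \<le> 2 * R" using 1 R1 by linarith
  next
    fix k assume k: "1 \<le> k" "Suc k < L"
    then have "p (Suc k) = (\<lambda>r. dotp m (\<Delta> (Suc k) r) (h k))" by (simp add: p_def fun_eq_iff)
    then show "nrm m (p (Suc k)) \<le> R * nrm m (h k)"
      using \<Delta>1[of "Suc k" "h k"] k by (simp add: fan_in_def)
  qed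
  then show ?thesis using l by (simp add: h_def)
qed

text \<open>Below the last layer the two networks at \<open>x\<close> are compared through the
  initial network at a grid point. The last layer, with its dependent rows, is passed by Lipschitz
  continuity of ReLU and the operator norm alone, so it costs a constant factor just once.\<close>

lemma perturbation_bound:
  assumes even: "even m" and R1: "1 \<le> R" and d: "80 * d \<le> m" "0 < d"
    and good: "\<And>z. z \<in> grid d m \<Longrightarrow> nrm d z \<le> 1 \<Longrightarrow> 1/2 \<le> (nrm d z)\<^sup>2 \<Longrightarrow> good_weights d m L s (curry \<omega>)
      z \<beta> (6 * R / sqrt (real s)) R"
    and op1: "\<And>v. (\<And>i. i \<notin> {..<d} \<Longrightarrow> v i = 0) \<Longrightarrow> nrm m (\<lambda>r. dotp d (\<omega> (1, r)) v) \<le> 2 * sqrt (20 *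
      real m) * nrm d v"
    and opL: "\<And>v. (\<And>i. i \<notin> {..<m} \<Longrightarrow> v i = 0) \<Longrightarrow>
      L2_set (\<lambda>r. dotp m (\<omega> (L, r)) v) {..<m div 2} \<le> 2 * sqrt (20 * real m) * nrm m v"
    and L: "2 \<le> L" and x: "nrm d x = 1"
    and \<Delta>: "\<Delta> \<in> small_perturbations d m L R"
    and l: "l \<in> {1..L}"
  shows "nrm m (\<lambda>r. act d m (perturb (init_rows m L \<omega>) \<Delta>) x l r - act d m (init_rows m L \<omega>) x l r)
    \<le> 420 * (real L * (6 * R / sqrt (real s)))"
proof -
  define E where "E = 6 * R / sqrt (real s)"
  let ?A = "init_rows m L \<omega>"
  let ?B = "perturb ?A \<Delta>"
  have m: "0 < m" using d by linarith
  obtain z where z: "z \<in> grid d m" "nrm d z \<le> nrm d x" "nrm d (\<lambda>j. x j - z j) \<le> sqrt (real d) /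
    real m"
    using grid_approx[OF m, where d=d and x=x] x by auto
  have small: "sqrt (real d) / real m \<le> 1/4"
  proof -
    have "real d \<le> (real m / 4)\<^sup>2"
    proof -
      have "16 * real d \<le> 80 * real d" by simp
      also have "\<dots> \<le> real m" using d by linarith
      also have "\<dots> \<le> real m * real m" using m by simp
      finally show ?thesis by (simp add: power2_eq_square)
    qed
    with real_le_lsqrt[of "real m / 4" "real d"] have "sqrt (real d) \<le> real m / 4" by simp
    then show ?thesis using m by (simp add: field_simps)
  qed
  have "nrm d x = nrm d (\<lambda>j. z j + (x j - z j))" by simp
  also have "\<dots> \<le> nrm d z + nrm d (\<lambda>j. x j - z j)" by (rule L2_set_triangle_ineq)
  \<comment> \<open>The grid point is within 1/4 of the sphere; (3/4)^2 = 9/16 leaves room for the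
    1/2 required by \<open>good\<close>.\<close>
  finally have "3/4 \<le> nrm d z" using x z small by linarith
  then have "(3/4)\<^sup>2 \<le> (nrm d z)\<^sup>2" by (rule power_mono) simp
  then have z2: "1/2 \<le> (nrm d z)\<^sup>2" by (simp add: power2_eq_square)
  have gw: "good_weights d m L s (curry \<omega>) z \<beta> E R"
    unfolding E_def by (rule good[OF z(1) _ z2]) (use z x in simp)
  interpret good_weights d m L s "curry \<omega>" z \<beta> E R by (rule gw)
  have op: "nrm m (\<lambda>r. dotp d (curry \<omega> 1 r) v) \<le> 2 * sqrt (20 * real m) * nrm d v" if "\<And>i. i \<notin>
    {..<d} \<Longrightarrow> v i = 0" for v
    using op1[OF that] by (simp only: curry_conv)
  have eqA: "act d m ?A x k r = act d m (perturb (curry \<omega>) (\<lambda>_ _ _. 0)) x k r" if "k < L" "r <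
    fan_in d m (Suc k)" for k r
    by (rule act_cong) (use that in \<open>auto simp: init_rows_def\<close>)
  have eqB: "act d m ?B x k r = act d m (perturb (curry \<omega>) \<Delta>) x k r" if "k < L" "r < fan_in d m
    (Suc k)" for k r
    by (rule act_cong) (use that in \<open>auto simp: init_rows_def\<close>)
  \<comment> \<open>With the zero perturbation, the unperturbed network at \<open>x\<close> is
    itself an instance of \<open>close_to_grid_point\<close>.\<close>
  have zero: "(\<lambda>_ _ _. 0) \<in> small_perturbations d m L R"
    using R by (simp add: small_perturbations_def dotp_def L2_set_constant)
  have Bz: "nrm m (\<lambda>r. act d m ?B x k r - act d m (curry \<omega>) z k r) \<le> 8 * real L * E"
    and Az: "nrm m (\<lambda>r. act d m ?A x k r - act d m (curry \<omega>) z k r) \<le> 8 * real L * E"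
    if k: "1 \<le> k" "k < L" for k
  proof -
    have n: "fan_in d m (Suc k) = m" using k by (simp add: fan_in_def)
    have "nrm m (\<lambda>r. act d m ?B x k r - act d m (curry \<omega>) z k r) =
        nrm m (\<lambda>r. act d m (perturb (curry \<omega>) \<Delta>) x k r - act d m (curry \<omega>) z k r)"
      using eqB[OF k(2)] n by (intro L2_set_cong) auto
    also have "\<dots> \<le> 8 * real L * E"
      by (rule close_to_grid_point[OF gw R1 d(1) op x z(3) \<Delta> k])
    finally show "nrm m (\<lambda>r. act d m ?B x k r - act d m (curry \<omega>) z k r) \<le> 8 * real L * E" .
    have "nrm m (\<lambda>r. act d m ?A x k r - act d m (curry \<omega>) z k r) =
        nrm m (\<lambda>r. act d m (perturb (curry \<omega>) (\<lambda>_ _ _. 0)) x k r - act d m (curry \<omega>) z k r)"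
      using eqA[OF k(2)] n by (intro L2_set_cong) auto
    also have "\<dots> \<le> 8 * real L * E"
      by (rule close_to_grid_point[OF gw R1 d(1) op x z(3) zero k])
    finally show "nrm m (\<lambda>r. act d m ?A x k r - act d m (curry \<omega>) z k r) \<le> 8 * real L * E" .
  qed
  have BA: "nrm m (\<lambda>r. act d m ?B x k r - act d m ?A x k r) \<le> 16 * (real L * E)" if k: "1 \<le> k" "k
    < L" for k
  proof -
    have "nrm m (\<lambda>r. act d m ?B x k r - act d m ?A x k r) =
        nrm m (\<lambda>r. (act d m ?B x k r - act d m (curry \<omega>) z k r) + - (act d m ?A x k r - act d m
          (curry \<omega>) z k r))"
      by simp
    also have "\<dots> \<le> nrm m (\<lambda>r. act d m ?B x k r - act d m (curry \<omega>) z k r) + nrm m (\<lambda>r. act d m ?A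
      x k r - act d m (curry \<omega>) z k r)"
      by (rule order_trans[OF L2_set_triangle_ineq]) (simp only: L2_set_uminus order_refl)
    finally show ?thesis using Bz[OF k] Az[OF k] by linarith
  qed
  have LE: "0 \<le> real L * E" using E_nonneg by simp
  show ?thesis
  proof (cases "l < L")
    case True
    have "1 \<le> l" using l by simp
    then show ?thesis using BA[OF _ True] LE unfolding E_def[symmetric] by fastforce
  next
    case False
    then have lL: "l = L" using l by simp
    obtain k where k: "L = Suc k" "1 \<le> k" using L by (cases L) auto
    let ?hB = "act d m ?B x k" and ?hA = "act d m ?A x k"
    \<comment> \<open>Cut off at \<open>m\<close>, because the operator bound is stated for vectors
      supported there.\<close>
    define g where "g = (\<lambda>r. if r < m then ?hB r - ?hA r else 0)"
    have n: "fan_in d m (Suc k) = m" using k by (simp add: fan_in_def)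
    have gn: "nrm m g \<le> 16 * (real L * E)"
    proof -
      have "nrm m g = nrm m (\<lambda>r. ?hB r - ?hA r)" by (intro L2_set_cong) (auto simp: g_def)
      then show ?thesis using BA[of k] k by simp
    qed
    have hB: "nrm m ?hB \<le> 3"
    proof -
      have "nrm m ?hB = nrm m (\<lambda>r. act d m (curry \<omega>) z k r + (?hB r - act d m (curry \<omega>) z k r))"
        by simp
      also have "\<dots> \<le> nrm m (act d m (curry \<omega>) z k) + nrm m (\<lambda>r. ?hB r - act d m (curry \<omega>) z k r)"
        by (rule L2_set_triangle_ineq)
      also have "\<dots> \<le> 2 + 1"
        using act_le[of k] Bz[of k] k E(2) n by (intro add_mono) auto
      finally show ?thesis by simp
    qed
    have "nrm m (\<lambda>r. dotp m (?A L r) g) \<le> 4 * sqrt (20 * real m) * nrm m g"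
    proof -
      let ?q = "\<lambda>r. dotp m (\<omega> (L, r)) g"
      have half: "m - m div 2 = m div 2" using even by (auto elim: evenE)
      have "(nrm m (\<lambda>r. dotp m (?A L r) g))\<^sup>2 = (\<Sum>r<m. (dotp m (?A L r) g)\<^sup>2)"
        by (simp add: L2_set_def sum_nonneg)
      also have "\<dots> = (\<Sum>r<m div 2. (dotp m (?A L r) g)\<^sup>2) + (\<Sum>r\<in>{m div 2..<m}. (dotp m (?A L r)
        g)\<^sup>2)"
      proof -
        have un: "{..<m} = {..<m div 2} \<union> {m div 2..<m}" by auto
        show ?thesis by (subst un, rule sum.union_disjoint) auto
      qed
      also have "(\<Sum>r<m div 2. (dotp m (?A L r) g)\<^sup>2) = (\<Sum>r<m div 2. (?q r)\<^sup>2)"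
        by (intro sum.cong) (auto simp: init_rows_def)
      also have "(\<Sum>r\<in>{m div 2..<m}. (dotp m (?A L r) g)\<^sup>2) = (\<Sum>r<m div 2. (?q r)\<^sup>2)"
        by (rule sum.reindex_bij_witness[of _ "\<lambda>r. r + m div 2" "\<lambda>r. r - m div 2"])
          (use half in \<open>auto simp: init_rows_def\<close>)
      also have "(\<Sum>r<m div 2. (?q r)\<^sup>2) + (\<Sum>r<m div 2. (?q r)\<^sup>2) = 2 * (L2_set ?q {..<m div 2})\<^sup>2"
        by (simp add: L2_set_def sum_nonneg)
      \<comment> \<open>Duplicated rows double the squared norm; 2 is relaxed to 4 so that the root
        is rational.\<close>
      also have "\<dots> \<le> 4 * (2 * sqrt (20 * real m) * nrm m g)\<^sup>2"
      proof -
        have "L2_set ?q {..<m div 2} \<le> 2 * sqrt (20 * real m) * nrm m g" by (rule opL) (simp add: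
          g_def)
        then have "(L2_set ?q {..<m div 2})\<^sup>2 \<le> (2 * sqrt (20 * real m) * nrm m g)\<^sup>2"
          by (rule power_mono) simp
        then show ?thesis using zero_le_power2[of "2 * sqrt (20 * real m) * nrm m g"] by linarith
      qed
      also have "\<dots> = (4 * sqrt (20 * real m) * nrm m g)\<^sup>2" by (simp add: power_mult_distrib)
      finally show ?thesis by (rule power2_le_imp_le) simp
    qed
    also have "\<dots> \<le> 4 * sqrt (20 * real m) * (16 * (real L * E))"
      by (intro mult_left_mono gn) simp
    finally have Ag: "nrm m (\<lambda>r. dotp m (?A L r) g) \<le> 4 * sqrt (20 * real m) * (16 * (real L *
      E))" .
    have "nrm m (\<lambda>r. dotp m (\<Delta> L r) ?hB) \<le> R * nrm m ?hB"
      using small_perturbationsD[OF \<Delta>, of L ?hB] n L k(1) by simp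
    also have "\<dots> \<le> R * 3" using hB R by (intro mult_left_mono) auto
    finally have Dh: "nrm m (\<lambda>r. dotp m (\<Delta> L r) ?hB) \<le> 3 * R" by simp
    let ?c = "sqrt (2 / real m)"
    have c0: "0 \<le> ?c" by simp
    have "nrm m (\<lambda>r. act d m ?B x L r - act d m ?A x L r)
        \<le> nrm m (\<lambda>r. ?c * (dotp m (\<Delta> L r) ?hB + dotp m (?A L r) g))"
    proof (rule L2_set_mono_abs)
      fix r
      have "dotp m (?B L r) ?hB = dotp m (?A L r) ?hA + (dotp m (\<Delta> L r) ?hB + dotp m (?A L r) g)"
      proof -
        have "dotp m (?A L r) g = dotp m (?A L r) (\<lambda>j. ?hB j - ?hA j)"
          by (rule dotp_cong) (auto simp: g_def)
        then show ?thesis by (simp add: dotp_add_left dotp_diff)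
      qed
      then have "act d m ?B x L r - act d m ?A x L r =
          ?c * (relu (dotp m (?A L r) ?hA + (dotp m (\<Delta> L r) ?hB + dotp m (?A L r) g)) - relu (dotp
            m (?A L r) ?hA))"
        unfolding k(1) act.simps n by (simp add: right_diff_distrib)
      then show "\<bar>act d m ?B x L r - act d m ?A x L r\<bar> \<le> \<bar>?c * (dotp m (\<Delta> L r) ?hB + dotp m (?A L
        r) g)\<bar>"
        using relu_diff_le c0 by (simp add: abs_mult mult_left_mono)
    qed
    also have "\<dots> = ?c * nrm m (\<lambda>r. dotp m (\<Delta> L r) ?hB + dotp m (?A L r) g)"
      using c0 by (simp add: L2_set_scale)
    also have "\<dots> \<le> ?c * (3 * R + 4 * sqrt (20 * real m) * (16 * (real L * E)))"
      by (intro mult_left_mono order_trans[OF L2_set_triangle_ineq] add_mono Dh Ag c0)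
    also have "\<dots> = ?c * (3 * R) + (?c * sqrt (20 * real m)) * (64 * (real L * E))" by (simp add:
      algebra_simps)
    also have "?c * sqrt (20 * real m) = sqrt 40" using m by (simp add: real_sqrt_mult[symmetric])
    \<comment> \<open>The total is 1 + 6.5 * 64 = 417, rounded up to the 420 of the
      statement.\<close>
    also have "?c * (3 * R) + sqrt 40 * (64 * (real L * E)) \<le> real L * E + 6.5 * (64 * (real L *
      E))"
    proof (intro add_mono mult_right_mono)
      have "?c * (3 * R) = sqrt 2 * 3 * R / sqrt (real m)" by (simp add: real_sqrt_divide)
      also have "\<dots> \<le> 6 * R / sqrt (real m)"
      proof (intro divide_right_mono mult_right_mono)
        have "sqrt 2 \<le> 2" by (rule real_le_lsqrt) auto
        then show "sqrt 2 * 3 \<le> 6" by simp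
      qed (use R in auto)
      also have "\<dots> \<le> 6 * R / sqrt (real s)" using s R by (intro divide_left_mono) auto
      also have "\<dots> = E" by (simp add: E_def)
      also have "\<dots> \<le> real L * E" using L E_nonneg mult_right_mono[of 1 "real L" E] by simp
      finally show "?c * (3 * R) \<le> real L * E" .
      show "sqrt 40 \<le> 6.5" by (rule real_le_lsqrt) (auto simp: power2_eq_square)
      show "0 \<le> 64 * (real L * E)" using LE by simp
    qed
    also have "\<dots> \<le> 420 * (real L * E)" using LE by linarith
    finally show ?thesis by (simp add: lL E_def)
  qed
qed

section \<open>Measurability\<close>

text \<open>One point from every basic open set that meets \<open>S\<close>. The points must lie in
  \<open>S\<close> itself: the unit sphere has no interior, so a dense subset of the ambient space
  could miss it.\<close>

lemma countable_dense_subset: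
  fixes S :: "'a::second_countable_topology set"
  obtains T where "countable T" "T \<subseteq> S" "S \<subseteq> closure T"
proof -
  obtain B :: "'a set set" where B: "countable B" "topological_basis B"
    using ex_countable_basis by blast
  define f where "f = (\<lambda>U. SOME x. x \<in> U \<inter> S)"
  have f: "f U \<in> U \<inter> S" if "U \<inter> S \<noteq> {}" for U
    unfolding f_def by (rule someI_ex) (use that in blast)
  let ?T = "f ` {U \<in> B. U \<inter> S \<noteq> {}}"
  show ?thesis
  proof
    show "countable ?T" using B(1) by (intro countable_image) (auto intro: countable_subset)
    show "?T \<subseteq> S" using f by blast
    show "S \<subseteq> closure ?T"
    proof
      fix x assume x: "x \<in> S"
      show "x \<in> closure ?T"
        unfolding closure_iff_nhds_not_empty
      proof (intro allI impI)
        fix A V :: "'a set" assume V: "V \<subseteq> A" "open V" "x \<in> V"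
        obtain U where U: "U \<in> B" "x \<in> U" "U \<subseteq> V" using topological_basisE[OF B(2) V(2,3)] by blast
        then have "U \<inter> S \<noteq> {}" using x by blast
        then have "f U \<in> ?T" "f U \<in> A" using f[of U] U V by auto
        then show "?T \<inter> A \<noteq> {}" by blast
      qed
    qed
  qed
qed

section \<open>Continuity in perturbation and input\<close>

lemma continuous_on_dotp:
  assumes "\<And>j. j < n \<Longrightarrow> continuous_on S (\<lambda>p. u p j)" "\<And>j. j < n \<Longrightarrow> continuous_on S (\<lambda>p. v p j)"
  shows "continuous_on S (\<lambda>p. dotp n (u p) (v p))"
  unfolding dotp_def using assms by (intro continuous_on_sum continuous_on_mult) auto

lemma continuous_on_act:
  "continuous_on UNIV (\<lambda>p :: (nat \<Rightarrow> nat \<Rightarrow> nat \<Rightarrow> real) \<times> (nat \<Rightarrow> real). act d m (perturb A (fst p))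
    (snd p) l r)"
proof (induction l arbitrary: r)
  case 0
  have "continuous_on UNIV (\<lambda>p :: (nat \<Rightarrow> nat \<Rightarrow> nat \<Rightarrow> real) \<times> (nat \<Rightarrow> real). snd p)"
    by (intro continuous_intros)
  from continuous_on_product_then_coordinatewise[OF this] show ?case by simp
next
  case (Suc l)
  have "continuous_on UNIV (\<lambda>p :: (nat \<Rightarrow> nat \<Rightarrow> nat \<Rightarrow> real) \<times> (nat \<Rightarrow> real). fst p)"
    by (intro continuous_intros)
  then have *: "continuous_on UNIV (\<lambda>p :: (nat \<Rightarrow> nat \<Rightarrow> nat \<Rightarrow> real) \<times> (nat \<Rightarrow> real). fst p (Suc l) r
    j)" for j
    by (rule continuous_on_product_then_coordinatewise[OF
      continuous_on_product_then_coordinatewise[OF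
          continuous_on_product_then_coordinatewise]])
  have "continuous_on UNIV (\<lambda>p :: (nat \<Rightarrow> nat \<Rightarrow> nat \<Rightarrow> real) \<times> (nat \<Rightarrow> real).
      dotp (fan_in d m (Suc l)) (perturb A (fst p) (Suc l) r) (act d m (perturb A (fst p)) (snd p)
        l))"
    by (intro continuous_on_dotp continuous_on_add continuous_on_const * Suc.IH)
  then show ?case
    unfolding act.simps relu_def by (intro continuous_on_mult continuous_on_const continuous_on_max)
qed

section \<open>Measurability in the sample\<close>

lemma measurable_init_rows:
  assumes "even m" "l \<in> {1..L}" "r < m" "j < fan_in d m l"
  shows "(\<lambda>\<omega>. init_rows m L \<omega> l r j) \<in> borel_measurable (init_measure d m L)"
proof -
  have "(l, if l = L \<and> m div 2 \<le> r then r - m div 2 else r) \<in> free_rows m L"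
    using assms by (auto simp: free_rows_def elim: evenE)
  from measurable_entry[OF this assms(4)] show ?thesis by (simp add: init_rows_def)
qed

lemma measurable_act_perturb:
  assumes "even m" "l \<le> L" "r < fan_in d m (Suc l)"
  shows "(\<lambda>\<omega>. act d m (perturb (init_rows m L \<omega>) \<Delta>) x l r) \<in> borel_measurable (init_measure d m L)"
  using assms(2,3)
proof (induction l arbitrary: r)
  case 0
  then show ?case by simp
next
  case (Suc l)
  have r: "r < m" using Suc.prems by (simp add: fan_in_def)
  have "(\<lambda>\<omega>. dotp (fan_in d m (Suc l)) (perturb (init_rows m L \<omega>) \<Delta> (Suc l) r) (act d m (perturb
    (init_rows m L \<omega>) \<Delta>) x l))
      \<in> borel_measurable (init_measure d m L)"
    unfolding dotp_def using Suc r assms(1)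
    by (intro borel_measurable_sum borel_measurable_times borel_measurable_add
      measurable_init_rows) auto
  then show ?case by (simp add: relu_def)
qed

definition perturbation_event :: "nat \<Rightarrow> nat \<Rightarrow> nat \<Rightarrow> real \<Rightarrow> real \<Rightarrow> (nat \<times> nat \<Rightarrow> nat \<Rightarrow> real) \<Rightarrow> bool"
  where
  "perturbation_event d m L R K \<omega> \<longleftrightarrow> (\<forall>\<Delta>\<in>small_perturbations d m L R. \<forall>x. nrm d x = 1 \<longrightarrow> (\<forall>l\<in>{1..L}.
     nrm m (\<lambda>r. act d m (perturb (init_rows m L \<omega>) \<Delta>) x l r - act d m (init_rows m L \<omega>) x l r) \<le>
       K))"

text \<open>The event is an uncountable intersection over perturbations and inputs; by continuity a
  countable dense set of them suffices.\<close>

lemma sets_perturbation_event: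
  assumes "even m"
  shows "{\<omega> \<in> space (init_measure d m L). perturbation_event d m L R K \<omega>} \<in> sets (init_measure d m
    L)"
proof -
  let ?M = "init_measure d m L"
  let ?S = "small_perturbations d m L R \<times> {x. nrm d x = 1}"
  \<comment> \<open>The initial network is written as a perturbation by zero, so the continuity and
    measurability lemmas for \<open>perturb\<close> cover both terms.\<close>
  let ?f = "\<lambda>\<omega> l p. nrm m (\<lambda>r. act d m (perturb (init_rows m L \<omega>) (fst p)) (snd p) l r
      - act d m (perturb (init_rows m L \<omega>) (\<lambda>_ _ _. 0)) (snd p) l r)"
  obtain T where T: "countable T" "T \<subseteq> ?S" "?S \<subseteq> closure T" by (rule countable_dense_subset)
  have cont: "continuous_on UNIV (?f \<omega> l)" for \<omega> l
  proof -
    have "continuous_on UNIV ((\<lambda>p. act d m (perturb (init_rows m L \<omega>) (fst p)) (snd p) l r) \<circ> (\<lambda>p.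
      ((\<lambda>_ _ _. 0), snd p)))" for r
      by (intro continuous_on_compose continuous_on_subset[OF continuous_on_act]
        continuous_intros) auto
    then have "continuous_on UNIV (\<lambda>p. act d m (perturb (init_rows m L \<omega>) (\<lambda>_ _ _. 0)) (snd p) l
      r)" for r
      by (simp add: comp_def)
    then show ?thesis
      unfolding L2_set_def
      by (intro continuous_on_real_sqrt continuous_on_sum continuous_on_power continuous_on_diff
        continuous_on_act)
  qed
  have "perturbation_event d m L R K \<omega> \<longleftrightarrow> (\<forall>p\<in>T. \<forall>l\<in>{1..L}. ?f \<omega> l p \<le> K)" for \<omega>
  proof
    assume "perturbation_event d m L R K \<omega>"
    then show "\<forall>p\<in>T. \<forall>l\<in>{1..L}. ?f \<omega> l p \<le> K"
      using T(2) by (fastforce simp: perturbation_event_def)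
  next
    assume *: "\<forall>p\<in>T. \<forall>l\<in>{1..L}. ?f \<omega> l p \<le> K"
    have **: "?f \<omega> l p \<le> K" if "l \<in> {1..L}" "p \<in> ?S" for l p
    proof -
      have "closed {p. ?f \<omega> l p \<le> K}"
        using continuous_closed_preimage[OF cont closed_UNIV closed_atMost[of K], of \<omega> l] by (simp
          add: vimage_def)
      moreover have "T \<subseteq> {p. ?f \<omega> l p \<le> K}" using * that by blast
      ultimately have "closure T \<subseteq> {p. ?f \<omega> l p \<le> K}" by (rule closure_minimal[rotated])
      then show ?thesis using T(3) that by blast
    qed
    show "perturbation_event d m L R K \<omega>"
      unfolding perturbation_event_def
    proof (intro ballI allI impI)
      fix \<Delta> x l
      assume "\<Delta> \<in> small_perturbations d m L R" "nrm d x = 1" "l \<in> {1..L}"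
      then show "nrm m (\<lambda>r. act d m (perturb (init_rows m L \<omega>) \<Delta>) x l r - act d m (init_rows m L
        \<omega>) x l r) \<le> K"
        using **[of l "(\<Delta>, x)"] by simp
    qed
  qed
  then have "{\<omega> \<in> space ?M. perturbation_event d m L R K \<omega>} = {\<omega> \<in> space ?M. \<forall>p\<in>T. \<forall>l\<in>{1..L}. ?f \<omega>
    l p \<le> K}"
    by simp
  also have "\<dots> \<in> sets ?M"
  proof -
    have f: "(\<lambda>\<omega>. ?f \<omega> l p) \<in> borel_measurable ?M" if "l \<in> {1..L}" for l p
    proof -
      have n: "fan_in d m (Suc l) = m" using that by (simp add: fan_in_def)
      have "(\<lambda>\<omega>. \<Sum>r<m. (act d m (perturb (init_rows m L \<omega>) (fst p)) (snd p) l r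
          - act d m (perturb (init_rows m L \<omega>) (\<lambda>_ _ _. 0)) (snd p) l r)\<^sup>2) \<in> borel_measurable ?M"
        using that n
        by (intro borel_measurable_sum borel_measurable_power borel_measurable_diff
          measurable_act_perturb[OF assms]) auto
      then show ?thesis unfolding L2_set_def by measurable
    qed
    have one: "{\<omega> \<in> space ?M. ?f \<omega> l p \<le> K} \<in> sets ?M" if l: "l \<in> {1..L}" for l p
    proof -
      note [measurable] = f[OF l]
      show ?thesis by measurable
    qed
    show ?thesis
      by (rule sets.sets_Collect_countable_All'[OF sets.sets_Collect_countable_All'[OF one]])
        (use T(1) in auto)
  qed
  finally show ?thesis .
qed

section \<open>Spectral norms and the weight ball\<close>

lemma vec_norm2_eq_nrm: "dim_vec v = n \<Longrightarrow> vec_norm2 v = nrm n (vec_index v)"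
  by (simp add: vec_norm2_def)

lemma hidden_eq_act:
  assumes W: "W \<in> weight_space d m L" and x: "x \<in> carrier_vec d"
    and A: "\<And>k r j. k \<in> {1..L} \<Longrightarrow> r < m \<Longrightarrow> j < fan_in d m k \<Longrightarrow> A k r j = W k $$ (r, j)"
    and "l \<le> L"
  shows "dim_vec (hidden m W l x) = fan_in d m (Suc l) \<and>
    (\<forall>r<fan_in d m (Suc l). hidden m W l x $ r = act d m A (vec_index x) l r)"
  using \<open>l \<le> L\<close>
proof (induction l)
  case 0
  then show ?case using x by (simp add: fan_in_def)
next
  case (Suc l)
  have Wl: "W (Suc l) \<in> carrier_mat m (fan_in d m (Suc l))"
    using W Suc.prems by (auto simp: weight_space_def PiE_iff)
  have n: "fan_in d m (Suc (Suc l)) = m" by (simp add: fan_in_def)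
  have IH: "dim_vec (hidden m W l x) = fan_in d m (Suc l)"
    "\<And>r. r < fan_in d m (Suc l) \<Longrightarrow> hidden m W l x $ r = act d m A (vec_index x) l r"
    using Suc by auto
  have "(W (Suc l) *\<^sub>v hidden m W l x) $ r = dotp (fan_in d m (Suc l)) (A (Suc l) r) (act d m A
    (vec_index x) l)"
    if "r < m" for r
    using that Wl IH Suc.prems A[of "Suc l" r]
    by (auto simp: scalar_prod_def dotp_def atLeast0LessThan intro!: sum.cong)
  then show ?case using Wl by (simp add: n)
qed

section \<open>The spectral norm as an operator bound\<close>

lemma spectral_norm_bound:
  assumes "v \<in> carrier_vec (dim_col B)"
  shows "vec_norm2 (B *\<^sub>v v) \<le> spectral_norm B * vec_norm2 v"
proof (cases "vec_norm2 v = 0")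
  case True
  then have "vec_norm2 (B *\<^sub>v v) \<le> 0" using vec_norm2_mult_mat_le[OF assms] by simp
  then show ?thesis using True by simp
next
  case False
  define t where "t = vec_norm2 v"
  have t: "0 < t" using False vec_norm2_nonneg[of v] by (simp add: t_def)
  let ?u = "(1 / t) \<cdot>\<^sub>v v"
  have "vec_norm2 ?u = 1" using t by (simp add: vec_norm2_smult t_def[symmetric])
  then have "vec_norm2 (B *\<^sub>v ?u) \<le> spectral_norm B"
    unfolding spectral_norm_def using assms by (intro cSUP_upper bdd_above_spectral_norm) auto
  moreover have "B *\<^sub>v ?u = (1 / t) \<cdot>\<^sub>v (B *\<^sub>v v)"
    by (rule mult_mat_vec[of B "dim_row B" "dim_col B"]) (use assms in auto)
  ultimately have "vec_norm2 (B *\<^sub>v v) / t \<le> spectral_norm B" using t by (simp add: vec_norm2_smult)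
  then show ?thesis using t by (simp add: t_def[symmetric] field_simps)
qed

lemma spectral_norm_le:
  assumes "\<And>v. v \<in> carrier_vec (dim_col B) \<Longrightarrow> vec_norm2 (B *\<^sub>v v) \<le> R * vec_norm2 v" "0 \<le> R"
  shows "spectral_norm B \<le> R"
  unfolding spectral_norm_def
proof (rule cSUP_least)
  have "0\<^sub>v (dim_col B) \<in> {x \<in> carrier_vec (dim_col B). vec_norm2 x \<le> 1}"
    by (simp add: vec_norm2_def L2_set_def)
  then show "{x \<in> carrier_vec (dim_col B). vec_norm2 x \<le> 1} \<noteq> {}" by blast
  fix v assume v: "v \<in> {x \<in> carrier_vec (dim_col B). vec_norm2 x \<le> 1}"
  then have "vec_norm2 (B *\<^sub>v v) \<le> R * vec_norm2 v" using assms by blast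
  also have "\<dots> \<le> R * 1" using v assms by (intro mult_left_mono) auto
  finally show "vec_norm2 (B *\<^sub>v v) \<le> R" by simp
qed

lemma vec_norm2_mult_mat:
  assumes "B \<in> carrier_mat m n" "v \<in> carrier_vec n" "\<And>r j. r < m \<Longrightarrow> j < n \<Longrightarrow> b r j = B $$ (r, j)"
  shows "vec_norm2 (B *\<^sub>v v) = nrm m (\<lambda>r. dotp n (b r) (vec_index v))"
proof -
  have "(B *\<^sub>v v) $ r = dotp n (b r) (vec_index v)" if "r < m" for r
    using assms that by (auto simp: scalar_prod_def dotp_def atLeast0LessThan intro!: sum.cong)
  then show ?thesis
    using assms by (subst vec_norm2_eq_nrm[of _ m]) (auto intro!: L2_set_cong)
qed

lemma init_rows_eq_init_weights:
  assumes "l \<in> {1..L}" "r < m" "j < fan_in d m l"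
  shows "init_rows m L \<omega> l r j = init_weights d m L \<omega> l $$ (r, j)"
  using assms by (simp add: init_rows_def init_weights_def)

text \<open>The bridge between the matrix formulation and the function formulation, by W = W(0) +
  \<Delta> in both directions. An equivalence, not just an implication, carries measurability over
  to the event of the theorem, whose probability is to be bounded from below.\<close>

lemma event_iff_perturbation_event:
  assumes d: "0 < d" and L: "2 \<le> L" and R: "0 \<le> R"
  shows "(\<forall>W \<in> weight_ball d m L R (init_weights d m L \<omega>). \<forall>l \<in> {1..L}.
      (SUP x\<in>unit_sphere d. vec_norm2 (hidden m W l x - hidden m (init_weights d m L \<omega>) l x)) \<le> K)
    \<longleftrightarrow> perturbation_event d m L R K \<omega>"
proof -
  let ?W0 = "init_weights d m L \<omega>" and ?A = "init_rows m L \<omega>"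
  have W0: "?W0 \<in> weight_space d m L" by (rule init_weights_in_weight_space)
  have W0c: "?W0 k \<in> carrier_mat m (fan_in d m k)" if "k \<in> {1..L}" for k
    using W0 that by (auto simp: weight_space_def PiE_iff)
  \<comment> \<open>The sphere is nonempty as \<open>d\<close> is positive; a bound on each value
    bounds the supremum only over a nonempty set.\<close>
  have "unit_vec d 0 \<in> unit_sphere d"
  proof -
    have "(\<Sum>i<d. (unit_vec d 0 $ i)\<^sup>2) = (\<Sum>i<d. if i = 0 then 1 else (0::real))"
      by (intro sum.cong) (auto simp: unit_vec_def)
    then show ?thesis using d by (simp add: unit_sphere_def vec_norm2_def L2_set_def)
  qed
  then have ne: "unit_sphere d \<noteq> {}" by blast
  have norm_eq: "vec_norm2 (hidden m W l x - hidden m ?W0 l x)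
      = nrm m (\<lambda>r. act d m (perturb ?A \<Delta>) (vec_index x) l r - act d m ?A (vec_index x) l r)"
    if W: "W \<in> weight_space d m L" and l: "l \<in> {1..L}" and x: "x \<in> carrier_vec d"
      and \<Delta>: "\<And>k r j. k \<in> {1..L} \<Longrightarrow> r < m \<Longrightarrow> j < fan_in d m k \<Longrightarrow> perturb ?A \<Delta> k r j = W k $$ (r, j)"
    for W l x \<Delta>
  proof -
    have n: "fan_in d m (Suc l) = m" using l by (simp add: fan_in_def)
    have h: "dim_vec (hidden m W l x) = m \<and> (\<forall>r<m. hidden m W l x $ r = act d m (perturb ?A \<Delta>)
      (vec_index x) l r)"
      using hidden_eq_act[OF W x \<Delta>, of l] l n by simp
    have h0: "dim_vec (hidden m ?W0 l x) = m \<and> (\<forall>r<m. hidden m ?W0 l x $ r = act d m ?A (vec_index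
      x) l r)"
      using hidden_eq_act[OF W0 x init_rows_eq_init_weights, of l] l n by simp
    show ?thesis
      using h h0 by (subst vec_norm2_eq_nrm[of _ m]) (auto intro!: L2_set_cong)
  qed
  show ?thesis
  proof
    assume ev: "\<forall>W \<in> weight_ball d m L R ?W0. \<forall>l \<in> {1..L}.
      (SUP x\<in>unit_sphere d. vec_norm2 (hidden m W l x - hidden m ?W0 l x)) \<le> K"
    show "perturbation_event d m L R K \<omega>"
      unfolding perturbation_event_def
    proof (intro ballI allI impI)
      fix \<Delta> x l
      assume \<Delta>: "\<Delta> \<in> small_perturbations d m L R" and x: "nrm d x = 1" and l: "l \<in> {1..L}"
      \<comment> \<open>Restricted to \<open>{1..L}\<close> because \<open>weight_space\<close>
        consists of extensional functions.\<close>
      define W where "W = (\<lambda>k\<in>{1..L}. Matrix.mat m (fan_in d m k) (\<lambda>(r, j). perturb ?A \<Delta> k r j))"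
      have W: "W \<in> weight_space d m L" by (auto simp: W_def weight_space_def)
      have Wij: "perturb ?A \<Delta> k r j = W k $$ (r, j)" if "k \<in> {1..L}" "r < m" "j < fan_in d m k"
        for k r j
        using that by (simp add: W_def)
      have "spectral_norm (?W0 k - W k) \<le> R" if k: "k \<in> {1..L}" for k
      proof (rule spectral_norm_le[OF _ R])
        have Wk: "W k \<in> carrier_mat m (fan_in d m k)" using k by (simp add: W_def)
        have c: "?W0 k - W k \<in> carrier_mat m (fan_in d m k)" using Wk by auto
        fix v :: "real Matrix.vec" assume "v \<in> carrier_vec (dim_col (?W0 k - W k))"
        then have v: "v \<in> carrier_vec (fan_in d m k)" by (simp only: carrier_matD(2)[OF c])
        have "vec_norm2 ((?W0 k - W k) *\<^sub>v v) = nrm m (\<lambda>r. dotp (fan_in d m k) (\<lambda>j. - \<Delta> k r j)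
          (vec_index v))"
        proof (rule vec_norm2_mult_mat[OF c v])
          fix r j assume rj: "r < m" "j < fan_in d m k"
          then show "- \<Delta> k r j = (?W0 k - W k) $$ (r, j)"
            using Wij[OF k rj] init_rows_eq_init_weights[OF k rj, of \<omega>] Wk W0c[OF k] by simp
        qed
        also have "\<dots> = nrm m (\<lambda>r. dotp (fan_in d m k) (\<Delta> k r) (vec_index v))"
          by (simp add: dotp_def sum_negf L2_set_uminus)
        also have "\<dots> \<le> R * nrm (fan_in d m k) (vec_index v)" by (rule small_perturbationsD[OF \<Delta> k])
        also have "nrm (fan_in d m k) (vec_index v) = vec_norm2 v"
          using v by (intro vec_norm2_eq_nrm[symmetric]) simp
        finally show "vec_norm2 ((?W0 k - W k) *\<^sub>v v) \<le> R * vec_norm2 v" .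
      qed
      then have "W \<in> weight_ball d m L R ?W0"
        using W L by (simp add: weight_ball_def)
      then have "(SUP x\<in>unit_sphere d. vec_norm2 (hidden m W l x - hidden m ?W0 l x)) \<le> K"
        using ev l by blast
      moreover define y where "y = Matrix.vec d x"
      moreover have y: "y \<in> unit_sphere d"
        using x by (simp add: y_def unit_sphere_def vec_norm2_def L2_set_def)
      moreover have "vec_norm2 (hidden m W l y - hidden m ?W0 l y) \<le> (SUP x\<in>unit_sphere d.
        vec_norm2 (hidden m W l x - hidden m ?W0 l x))"
        by (rule cSUP_upper[OF y bdd_above_hidden_diff[OF W W0 l]])
      moreover have "vec_norm2 (hidden m W l y - hidden m ?W0 l y)
          = nrm m (\<lambda>r. act d m (perturb ?A \<Delta>) (vec_index y) l r - act d m ?A (vec_index y) l r)"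
        by (rule norm_eq[OF W l _ Wij]) (use y in \<open>auto simp: unit_sphere_def\<close>)
      moreover have "nrm m (\<lambda>r. act d m (perturb ?A \<Delta>) (vec_index y) l r - act d m ?A (vec_index
        y) l r)
          = nrm m (\<lambda>r. act d m (perturb ?A \<Delta>) x l r - act d m ?A x l r)"
      proof (rule L2_set_cong[OF refl])
        fix r assume "r \<in> {..<m}"
        then have r: "r < fan_in d m (Suc l)" using l by (simp add: fan_in_def)
        have e: "act d m B (vec_index y) l r = act d m B x l r" for B
          by (rule act_cong[OF _ _ r]) (auto simp: y_def)
        show "act d m (perturb ?A \<Delta>) (vec_index y) l r - act d m ?A (vec_index y) l r
          = act d m (perturb ?A \<Delta>) x l r - act d m ?A x l r" by (simp only: e)
      qed
      ultimately show "nrm m (\<lambda>r. act d m (perturb ?A \<Delta>) x l r - act d m ?A x l r) \<le> K" by linarith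
    qed
  next
    assume ev: "perturbation_event d m L R K \<omega>"
    show "\<forall>W \<in> weight_ball d m L R ?W0. \<forall>l \<in> {1..L}.
      (SUP x\<in>unit_sphere d. vec_norm2 (hidden m W l x - hidden m ?W0 l x)) \<le> K"
    proof (intro ballI)
      fix W l assume Wb: "W \<in> weight_ball d m L R ?W0" and l: "l \<in> {1..L}"
      have W: "W \<in> weight_space d m L" using Wb by (simp add: weight_ball_def)
      define \<Delta> where "\<Delta> = (\<lambda>k r j. W k $$ (r, j) - ?A k r j)"
      have \<Delta>: "\<Delta> \<in> small_perturbations d m L R"
        unfolding small_perturbations_def
      proof (intro CollectI ballI allI)
        fix k and v :: "nat \<Rightarrow> real" assume k: "k \<in> {1..L}"
        have Wk: "W k \<in> carrier_mat m (fan_in d m k)"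
          using W k by (auto simp: weight_space_def PiE_iff)
        then have c: "?W0 k - W k \<in> carrier_mat m (fan_in d m k)" by auto
        let ?v = "Matrix.vec (fan_in d m k) v"
        have "spectral_norm (?W0 k - W k) \<le> (MAX l\<in>{1..L}. spectral_norm (?W0 l - W l))"
          using k by (intro Max_ge) auto
        then have sp: "spectral_norm (?W0 k - W k) \<le> R" using Wb by (simp add: weight_ball_def)
        have "nrm m (\<lambda>r. dotp (fan_in d m k) (\<Delta> k r) v) = nrm m (\<lambda>r. dotp (fan_in d m k) (\<lambda>j. - \<Delta>
          k r j) (vec_index ?v))"
        proof -
          have "dotp (fan_in d m k) (\<lambda>j. - \<Delta> k r j) (vec_index ?v) = - dotp (fan_in d m k) (\<Delta> k r)
            v" for r
            by (simp add: dotp_def sum_negf)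
          then show ?thesis by (simp add: L2_set_uminus)
        qed
        also have "\<dots> = vec_norm2 ((?W0 k - W k) *\<^sub>v ?v)"
        proof (rule vec_norm2_mult_mat[OF c, symmetric])
          fix r j assume rj: "r < m" "j < fan_in d m k"
          then show "- \<Delta> k r j = (?W0 k - W k) $$ (r, j)"
            using init_rows_eq_init_weights[OF k rj, of \<omega>] Wk W0c[OF k] by (simp add: \<Delta>_def)
        qed simp
        also have "\<dots> \<le> spectral_norm (?W0 k - W k) * vec_norm2 ?v"
          by (rule spectral_norm_bound) (simp only: carrier_matD(2)[OF c] vec_carrier)
        also have "\<dots> \<le> R * vec_norm2 ?v" by (intro mult_right_mono sp vec_norm2_nonneg)
        also have "vec_norm2 ?v = nrm (fan_in d m k) v" by (simp add: vec_norm2_def L2_set_def)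
        finally show "nrm m (\<lambda>r. dotp (fan_in d m k) (\<Delta> k r) v) \<le> R * nrm (fan_in d m k) v" .
      qed
      show "(SUP x\<in>unit_sphere d. vec_norm2 (hidden m W l x - hidden m ?W0 l x)) \<le> K"
      proof (rule cSUP_least[OF ne])
        fix x assume x: "x \<in> unit_sphere d"
        then have xd: "x \<in> carrier_vec d" and x1: "nrm d (vec_index x) = 1"
          by (auto simp: unit_sphere_def vec_norm2_def)
        have "vec_norm2 (hidden m W l x - hidden m ?W0 l x)
          = nrm m (\<lambda>r. act d m (perturb ?A \<Delta>) (vec_index x) l r - act d m ?A (vec_index x) l r)"
          by (rule norm_eq[OF W l xd]) (simp add: \<Delta>_def)
        also have "\<dots> \<le> K" using ev \<Delta> x1 l unfolding perturbation_event_def by blast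
        finally show "vec_norm2 (hidden m W l x - hidden m ?W0 l x) \<le> K" .
      qed
    qed
  qed
qed

section \<open>Choice of the sparsity\<close>

lemma exp_one_gt: "5/2 \<le> exp (1::real)"
  using exp_lower_Taylor_quadratic[of 1] by simp

lemma twelve_le_exp: "12 \<le> exp (3::real)"
proof -
  have "(5/2::real) ^ 3 \<le> exp 1 ^ 3" by (intro power_mono exp_one_gt) simp
  also have "\<dots> = exp 3" by (simp add: exp_of_nat_mult[symmetric])
  finally show ?thesis by (simp add: power3_eq_cube)
qed

lemma twelve_power_le: "(12::real) ^ k \<le> exp (3 * real k)"
proof -
  have "(12::real) ^ k \<le> exp 3 ^ k" by (intro power_mono twelve_le_exp) simp
  also have "\<dots> = exp (3 * real k)" by (simp add: exp_of_nat_mult[symmetric] mult.commute)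
  finally show ?thesis .
qed

text \<open>Seven terms, each at most exp (-7 H) where exp H = L / \<delta>. Every factor L is paid
  for by exp H, which explains the 8 H and 9 H in the assumptions; \<open>6 * (s * l)\<close> covers
  two choices of \<open>s\<close>-subsets, a net and the exp s of the chi-square tail.\<close>

lemma failure_probability_le:
  fixes d m L s :: nat and \<delta> :: real
  defines "l \<equiv> ln (real m)" and "H \<equiv> ln (real L / \<delta>)"
  assumes m: "3 \<le> m" and d: "d \<le> m" and L: "2 \<le> L" and \<delta>: "0 < \<delta>" "\<delta> < 1"
    and l: "1 \<le> l" and H: "1/2 \<le> H"
    and K: "2 * (real d * l) + 9 * H + 6 * (real s * l) \<le> real m / (512 * (real L)\<^sup>2)"
    and K': "2 * (real d * l) + 8 * H \<le> 3 / 8 * real s"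
    and K'': "7 * H \<le> real m"
  shows "(2 * real m + 1) ^ d * point_failure m L s +
    (12 ^ d * exp (- (4 * real m)) + 12 ^ m * exp (- (4 * real m))) \<le> \<delta>"
proof -
  define p where "p = exp (- (real m / (48 * (real L)\<^sup>2)))"
  define p' where "p' = exp (- (real m / (32 * (real L)\<^sup>2)))"
  define p'' where "p'' = exp (- (3 / 8 * real s))"
  define p3 where "p3 = exp (real s - real m / (512 * (real L)\<^sup>2))"
  let ?D = "exp (- (7 * H))"
  have em: "real m = exp l" using m by (simp add: l_def)
  have "0 < real L / \<delta>" using L \<delta> by simp
  then have eH: "exp H = real L / \<delta>" by (simp add: H_def)
  have LH: "real L \<le> exp H"
    using L \<delta> by (simp add: eH field_simps)
  \<comment> \<open>One exp (-H) is at most \<delta>, and since \<open>H\<close> is at least 1/2,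
    the remaining exp (-6 H) is at most 1 / 12.\<close>
  have D: "8 * ?D \<le> \<delta>"
  proof -
    have "12 \<le> exp (6 * H)" using twelve_le_exp H by (intro order_trans[OF twelve_le_exp]) simp
    then have "8 * exp H \<le> exp (6 * H) * exp H" by (intro mult_right_mono) auto
    also have "\<dots> = exp (7 * H)" by (simp add: exp_add[symmetric])
    finally have "8 * exp H \<le> exp (7 * H)" .
    moreover have "1 / \<delta> \<le> exp H" using L \<delta> by (simp add: eH field_simps)
    ultimately have "8 / \<delta> \<le> exp (7 * H)" using \<delta> by simp
    then have "8 / exp (7 * H) \<le> \<delta>" using \<delta> by (simp add: field_simps)
    then show ?thesis by (simp add: exp_minus inverse_eq_divide)
  qed
  \<comment> \<open>From \<open>m \<ge> 3\<close>, 2 m + 1 <= 3 m <= m^2, so the grid costs 2 d ln m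
    in the exponent.\<close>
  have G: "(2 * real m + 1) ^ d \<le> exp (2 * (real d * l))"
  proof -
    have "2 * real m + 1 \<le> 3 * real m" using m by simp
    also have "\<dots> \<le> real m * real m" using m by (intro mult_right_mono) auto
    also have "\<dots> = exp (2 * l)" by (simp add: em exp_add[symmetric])
    finally have "(2 * real m + 1) ^ d \<le> exp (2 * l) ^ d" by (intro power_mono) auto
    also have "\<dots> = exp (2 * (real d * l))" by (simp add: exp_of_nat_mult[symmetric]
      mult.left_commute mult.commute)
    finally show ?thesis .
  qed
  have ms: "real m ^ s = exp (real s * l)" by (simp add: em exp_of_nat_mult)
  note tw = twelve_power_le[of s]
  have L2: "0 < (real L)\<^sup>2" using L by simp
  have pl: "p' \<le> exp (- (real m / (512 * (real L)\<^sup>2)))" "p \<le> exp (- (real m / (512 * (real L)\<^sup>2)))"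
    unfolding p_def p'_def using L2 by (auto simp: field_simps intro!: divide_left_mono)
  have sl: "real s \<le> real s * l" using l mult_left_mono[of 1 l "real s"] by simp
  have dl: "0 \<le> real d * l" using l by simp
  let ?G = "(2 * real m + 1) ^ d"
  have T1: "?G * (real L * q) \<le> ?D" if "q \<le> exp (- y)" "2 * (real d * l) + 8 * H \<le> y" "0 \<le> q" for
    q y
  proof -
    have "?G * (real L * q) \<le> exp (2 * (real d * l)) * (exp H * exp (- y))"
      using that by (intro mult_mono G LH) auto
    also have "\<dots> = exp (2 * (real d * l) + H - y)" by (simp add: exp_add[symmetric])
    also have "\<dots> \<le> ?D" using that by simp
    finally show ?thesis .
  qed
  have 1: "?G * (real L * p') \<le> ?D" "?G * (real L * p) \<le> ?D"
  proof -
    have "0 \<le> real s * l" using l by simp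
    then have kk: "2 * (real d * l) + 8 * H \<le> real m / (512 * (real L)\<^sup>2)" using K H by linarith
    show "?G * (real L * p') \<le> ?D" by (rule T1[OF pl(1) kk]) (simp add: p'_def)
    show "?G * (real L * p) \<le> ?D" by (rule T1[OF pl(2) kk]) (simp add: p_def)
  qed
  have 2: "?G * (real L * p'') \<le> ?D"
    by (rule T1[of _ "3 / 8 * real s"]) (use K' in \<open>auto simp: p''_def\<close>)
  have 3: "?G * (real L * (real L * (real m ^ s * (12 ^ s * p')))) \<le> ?D"
  proof -
    have "?G * (real L * (real L * (real m ^ s * (12 ^ s * p'))))
      \<le> exp (2 * (real d * l)) * (exp H * (exp H * (exp (real s * l) * (exp (3 * real s) * exp (-
        (real m / (512 * (real L)\<^sup>2)))))))"
      unfolding ms using pl(1) by (intro mult_mono G LH tw) (auto simp: p'_def)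
    also have "\<dots> = exp (2 * (real d * l) + 2 * H + real s * l + 3 * real s - real m / (512 * (real
      L)\<^sup>2))"
      by (simp add: exp_add[symmetric] algebra_simps)
    also have "\<dots> \<le> ?D" using K sl by simp
    finally show ?thesis .
  qed
  have 4: "?G * (real L * (real L * (real m ^ s * (12 ^ s * (real m ^ s * p3))))) \<le> ?D"
  proof -
    have "?G * (real L * (real L * (real m ^ s * (12 ^ s * (real m ^ s * p3)))))
      \<le> exp (2 * (real d * l)) * (exp H * (exp H * (exp (real s * l) * (exp (3 * real s) * (exp
        (real s * l) * p3)))))"
      unfolding ms by (intro mult_mono G LH tw) (auto simp: p3_def)
    also have "\<dots> = exp (2 * (real d * l) + 2 * H + 2 * (real s * l) + 4 * real s - real m / (512 *
      (real L)\<^sup>2))"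
      unfolding p3_def by (simp add: exp_add[symmetric] algebra_simps)
    also have "\<dots> \<le> ?D" using K sl by simp
    finally show ?thesis .
  qed
  have 5: "12 ^ k * exp (- (4 * real m)) \<le> ?D" if "k \<le> m" for k
  proof -
    have "(12::real) ^ k * exp (- (4 * real m)) \<le> exp (3 * real k) * exp (- (4 * real m))"
      by (intro mult_right_mono twelve_power_le) simp
    also have "\<dots> = exp (3 * real k - 4 * real m)" by (simp add: exp_add[symmetric])
    also have "\<dots> \<le> ?D" using that K'' by simp
    finally show ?thesis .
  qed
  have total: "point_failure m L s = real L * p' + (real L * p + (real L * p'' +
      (real L * (real L * (real m ^ s * (12 ^ s * p'))) +
       real L * (real L * (real m ^ s * (12 ^ s * (real m ^ s * p3)))))))"
    by (simp only: point_failure_def Let_def p_def p'_def p''_def p3_def)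
  show ?thesis
    unfolding total distrib_left using 1 2 3 4 5[OF d] 5[OF order_refl] D
    by (smt (verit) exp_gt_zero)
qed

text \<open>\<open>s\<close> is about m / (12800 L^2 ln m). It must be small enough for the entropy
  s ln m to stay below a fraction of m / L^2, and large enough that s^4 dominates m^3 R^2 and that s
  dominates both d ln m and ln (L / \<delta>).\<close>

lemma parameter_choice:
  fixes d m L :: nat and R \<delta> :: real
  assumes d: "0 < d" and m: "2 \<le> m" and L: "2 \<le> L" and R: "1 \<le> R" and \<delta>: "0 < \<delta>" "\<delta> < 1"
    and big: "10 ^ 24 * real L ^ 11 * real d * ln (real m) ^ 5 * ln (real L / \<delta>) * R ^ 2 \<le> real m"
  obtains s where "0 < s" "s \<le> m" "8 * real L * (6 * R / sqrt (real s)) \<le> 1"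
    "real m * (6 * R / sqrt (real s))\<^sup>2 \<le> (real s / (32 * real m))\<^sup>2 * real s"
    "80 * d \<le> m"
    "real L * (6 * R / sqrt (real s)) \<le> 960 * (real L ^ 2 * sqrt (ln (real m) / real m) * R)"
    "(2 * real m + 1) ^ d * point_failure m L s +
     (12 ^ d * exp (- (4 * real m)) + 12 ^ m * exp (- (4 * real m))) \<le> \<delta>"
proof -
  define l where "l = ln (real m)"
  define H where "H = ln (real L / \<delta>)"
  note big = big[folded l_def H_def]
  have half: "1/2 \<le> ln (2::real)" using ln2_ge_two_thirds by linarith
  have "2 \<le> real L / \<delta>" using L \<delta> by (simp add: field_simps)
  then have "ln 2 \<le> H" unfolding H_def by (subst ln_le_cancel_iff) auto
  then have H: "1/2 \<le> H" using half by linarith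
  have "ln 2 \<le> l" unfolding l_def using m by (subst ln_le_cancel_iff) auto
  then have l0: "1/2 \<le> l" using half by linarith
  have L1: "1 \<le> real L" "1 \<le> real d" using L d by auto
  \<comment> \<open>Bootstrap: with only \<open>l\<close> and \<open>H\<close> at least 1/2, the
    hypothesis forces m >= 10^6, and this improves the first bound to
    \<open>l \<ge> 1\<close>.\<close>
  have "10 ^ 24 * 1 * 1 * (1/2) ^ 5 * (1/2) * 1 \<le> 10 ^ 24 * real L ^ 11 * real d * l ^ 5 * H * R ^
    2"
    using L1 l0 H R by (intro mult_mono power_mono one_le_power) auto
  moreover have "(10::real) ^ 6 \<le> 10 ^ 24 * 1 * 1 * (1/2) ^ 5 * (1/2) * 1" by (simp add:
    power_divide)
  ultimately have m3: "10 ^ 6 \<le> real m" using big by linarith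
  have l: "1 \<le> l"
  proof -
    have "exp 1 \<le> real m" using exp_le m3 by simp
    then show ?thesis unfolding l_def using m by (subst ln_ge_iff) auto
  qed
  \<comment> \<open>\<open>A\<close>, \<open>B\<close> and \<open>C\<close> extract the three
    separate consequences of the hypothesis: \<open>A\<close> for the sign-change condition,
    \<open>B\<close> for the grid, \<open>C\<close> for the failure probability.\<close>
  have A: "10 ^ 23 * (real L ^ 8 * l ^ 4 * R\<^sup>2) \<le> real m"
  proof -
    have "10 ^ 23 * (real L ^ 8 * l ^ 4 * R\<^sup>2) \<le> 10 ^ 24 * real L ^ 8 * 1 * l ^ 4 * (1/2) * R\<^sup>2"
      using L1 l R by simp
    also have "\<dots> \<le> 10 ^ 24 * real L ^ 11 * real d * l ^ 5 * H * R\<^sup>2"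
      using L1 l H R by (intro mult_mono power_increasing order_refl) auto
    finally show ?thesis using big by linarith
  qed
  have B: "10 ^ 23 * (real L ^ 4 * real d * l\<^sup>2) \<le> real m"
  proof -
    have "10 ^ 23 * (real L ^ 4 * real d * l\<^sup>2) \<le> 10 ^ 24 * real L ^ 4 * real d * l\<^sup>2 * (1/2) * 1"
      using L1 l R by simp
    also have "\<dots> \<le> 10 ^ 24 * real L ^ 11 * real d * l ^ 5 * H * R\<^sup>2"
      using L1 l H R by (intro mult_mono power_increasing order_refl one_le_power) auto
    finally show ?thesis using big by linarith
  qed
  have C: "10 ^ 23 * (real L ^ 4 * l * H) \<le> real m"
  proof -
    have "10 ^ 23 * (real L ^ 4 * l * H) \<le> 10 ^ 24 * real L ^ 4 * 1 * l ^ 1 * H * 1"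
      using L1 l R H by simp
    also have "\<dots> \<le> 10 ^ 24 * real L ^ 11 * real d * l ^ 5 * H * R\<^sup>2"
      using L1 l H R by (intro mult_mono power_increasing order_refl one_le_power) auto
    finally show ?thesis using big by linarith
  qed
  define Y where "Y = (real L)\<^sup>2 * l"
  have Y: "1 \<le> Y" unfolding Y_def using L1 l mult_mono[of 1 "(real L)\<^sup>2" 1 l] by (simp add:
    one_le_power)
  have A': "10 ^ 23 * (Y ^ 4 * R\<^sup>2) \<le> real m"
    using A by (simp add: Y_def power_mult_distrib power_mult[symmetric])
  have YL: "(real L)\<^sup>2 \<le> Y" "(real L)\<^sup>2 * Y = real L ^ 4 * l" "Y * Y = real L ^ 4 * l\<^sup>2"
    using l mult_left_mono[of 1 l "(real L)\<^sup>2"] by (auto simp: Y_def power2_eq_square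
      power4_eq_xxxx mult_ac)
  \<comment> \<open>The real target for \<open>s\<close>. As \<open>u \<ge> 2\<close>, rounding down
    loses at most half, hence the 25600 in the lower bound.\<close>
  define u where "u = real m / (12800 * Y)"
  have R2: "1 \<le> R\<^sup>2" using R by (simp add: one_le_power)
  have u2: "2 \<le> u"
  proof -
    have "Y * 1 \<le> Y ^ 4 * R\<^sup>2" using Y R2 self_le_power[of Y 4] by (intro mult_mono) auto
    then have "25600 * Y \<le> real m" using A' Y by simp
    then show ?thesis using Y by (simp add: u_def field_simps)
  qed
  define s where "s = nat \<lfloor>u\<rfloor>"
  have s_up: "real s \<le> u" using u2 by (simp add: s_def)
  have s_lo: "u / 2 \<le> real s" using u2 unfolding s_def by linarith
  have s0: "0 < s" using s_lo u2 by (cases "s = 0") auto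
  have s_lo': "real m / (25600 * Y) \<le> real s" using s_lo by (simp add: u_def)
  have mpos: "0 < real m" using m by simp
  have s_m: "real s \<le> real m"
  proof -
    have "u \<le> real m / 1" unfolding u_def using Y by (intro divide_left_mono) auto
    then show ?thesis using s_up by simp
  qed
  have N3: "8 * real L * (6 * R / sqrt (real s)) \<le> 1"
  proof -
    have "(48 * real L * R)\<^sup>2 = 2304 * ((real L)\<^sup>2 * R\<^sup>2)" by (simp add: power_mult_distrib)
    also have "\<dots> \<le> real m / (25600 * Y)"
    proof -
      have "(real L)\<^sup>2 * R\<^sup>2 * Y \<le> Y ^ 4 * R\<^sup>2"
      proof -
        have "(real L)\<^sup>2 * Y \<le> Y * Y" using YL Y by (intro mult_right_mono) auto
        also have "\<dots> \<le> Y ^ 4" using Y power_increasing[of 2 4 Y] by (simp add: power2_eq_square)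
        finally show ?thesis using mult_right_mono[of "(real L)\<^sup>2 * Y" "Y ^ 4" "R\<^sup>2"] by (simp
          add: mult_ac)
      qed
      then have "2304 * ((real L)\<^sup>2 * R\<^sup>2) * (25600 * Y) \<le> real m" using A' by simp
      then show ?thesis using Y by (simp add: pos_le_divide_eq)
    qed
    also have "\<dots> \<le> real s" by (rule s_lo')
    finally have "48 * real L * R \<le> sqrt (real s)" by (rule real_le_rsqrt)
    then show ?thesis using s0 by (simp add: field_simps)
  qed
  \<comment> \<open>Cleared of denominators this is 36 * 1024 * m^3 R^2 <= s^4. With s >= m / (25600
    Y) it follows from A', as 36864 * 25600^4 is below 10^23.\<close>
  have N4: "real m * (6 * R / sqrt (real s))\<^sup>2 \<le> (real s / (32 * real m))\<^sup>2 * real s"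
  proof -
    have "36864 * real m ^ 3 * R\<^sup>2 * (25600 * Y) ^ 4 \<le> real m ^ 4"
    proof -
      have "36864 * 25600 ^ 4 * (Y ^ 4 * R\<^sup>2) \<le> real m" using A' Y by simp
      then have "real m ^ 3 * (36864 * 25600 ^ 4 * (Y ^ 4 * R\<^sup>2)) \<le> real m ^ 3 * real m"
        by (intro mult_left_mono) auto
      then show ?thesis by (simp add: power_mult_distrib power4_eq_xxxx power3_eq_cube mult_ac)
    qed
    then have "36864 * real m ^ 3 * R\<^sup>2 \<le> real m ^ 4 / (25600 * Y) ^ 4"
      using Y by (simp add: pos_le_divide_eq)
    also have "\<dots> = (real m / (25600 * Y)) ^ 4" by (simp add: power_divide)
    also have "\<dots> \<le> real s ^ 4" using s_lo' Y by (intro power_mono) auto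
    finally have "36864 * real m ^ 3 * R\<^sup>2 \<le> real s ^ 4" .
    then have "36 * R\<^sup>2 * real m * (1024 * (real m)\<^sup>2) \<le> real s ^ 3 * real s"
      by (simp add: power4_eq_xxxx power3_eq_cube power2_eq_square mult_ac)
    then have "36 * R\<^sup>2 * real m / real s \<le> real s ^ 3 / (1024 * (real m)\<^sup>2)"
      using s0 mpos by (simp add: divide_le_eq le_divide_eq)
    then show ?thesis
      using s0 by (simp add: power_divide power_mult_distrib power3_eq_cube power2_eq_square
        mult_ac)
  qed
  have dl: "10 ^ 20 * (Y * (real d * l)) \<le> real m"
  proof -
    have "Y * (real d * l) \<le> real L ^ 4 * real d * l\<^sup>2"
    proof -
      have "(real L)\<^sup>2 \<le> real L ^ 4" using L1 by (intro power_increasing) auto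
      then have "(real L)\<^sup>2 * (real d * l\<^sup>2) \<le> real L ^ 4 * (real d * l\<^sup>2)" by (intro
        mult_right_mono) auto
      then show ?thesis by (simp add: Y_def power2_eq_square mult_ac)
    qed
    then show ?thesis using B mpos by simp
  qed
  have Hl: "10 ^ 20 * (Y * H) \<le> real m"
  proof -
    have "(real L)\<^sup>2 \<le> real L ^ 4" using L1 by (intro power_increasing) auto
    then have "Y * H \<le> real L ^ 4 * l * H" using l H unfolding Y_def by (intro mult_right_mono) auto
    then show ?thesis using C mpos by simp
  qed
  have ge: "real d * l \<le> Y * (real d * l)" "H \<le> Y * H"
    using Y l H mult_right_mono[of 1 Y "real d * l"] mult_right_mono[of 1 Y H] by auto
  have d_dl: "real d \<le> real d * l" using l mult_left_mono[of 1 l "real d"] by simp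
  have N5: "80 * d \<le> m"
  proof -
    have "80 * real d \<le> real m" using dl ge d_dl by simp
    then show ?thesis by linarith
  qed
  \<comment> \<open>1 / s <= 25600 L^2 ln m / m, whose root is 160 L sqrt (ln m / m); 960 is 6 *
    160.\<close>
  have N7: "real L * (6 * R / sqrt (real s)) \<le> 960 * (real L ^ 2 * sqrt (l / real m) * R)"
  proof -
    have "1 / real s \<le> 25600 * Y / real m"
      using s_lo' s0 mpos Y by (simp add: field_simps)
    then have "sqrt (1 / real s) \<le> sqrt (25600 * Y / real m)" by (rule real_sqrt_le_mono)
    also have "25600 * Y / real m = (160 * real L)\<^sup>2 * (l / real m)" by (simp add: Y_def
      power_mult_distrib)
    also have "sqrt \<dots> = 160 * real L * sqrt (l / real m)" by (simp only: real_sqrt_mult[of "(160 *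
      real L)\<^sup>2"] real_sqrt_abs)
    finally have "1 / sqrt (real s) \<le> 160 * real L * sqrt (l / real m)" by (simp add:
      real_sqrt_divide)
    then have "real L * (6 * R) * (1 / sqrt (real s)) \<le> real L * (6 * R) * (160 * real L * sqrt (l
      / real m))"
      using R by (intro mult_left_mono) auto
    then show ?thesis by (simp add: power2_eq_square mult_ac)
  qed
  have K: "2 * (real d * l) + 9 * H + 6 * (real s * l) \<le> real m / (512 * (real L)\<^sup>2)"
  proof -
    define M where "M = real m / (real L)\<^sup>2"
    have L2: "0 < (real L)\<^sup>2" using L by simp
    have a: "10 ^ 20 * (real d * l) \<le> M"
    proof -
      have "10 ^ 20 * (real d * l) * (real L)\<^sup>2 \<le> real m"
      proof -
        have "10 ^ 20 * ((real L)\<^sup>2 * (real d * l)) \<le> 10 ^ 20 * (Y * (real d * l))"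
          using l by (intro mult_left_mono mult_right_mono YL(1)) auto
        then show ?thesis using dl by (simp only: mult_ac)
      qed
      then show ?thesis using L2 by (simp add: M_def pos_le_divide_eq)
    qed
    have b: "10 ^ 20 * H \<le> M"
    proof -
      have "10 ^ 20 * H * (real L)\<^sup>2 \<le> real m"
      proof -
        have "10 ^ 20 * ((real L)\<^sup>2 * H) \<le> 10 ^ 20 * (Y * H)"
          using H by (intro mult_left_mono mult_right_mono YL(1)) auto
        then show ?thesis using Hl by (simp only: mult_ac)
      qed
      then show ?thesis using L2 by (simp add: M_def pos_le_divide_eq)
    qed
    have c: "real s * l \<le> M / 12800"
    proof -
      have "real s * l \<le> u * l" using s_up l by (intro mult_right_mono) auto
      also have "\<dots> = M / 12800" using l L by (simp add: u_def Y_def M_def)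
      finally show ?thesis .
    qed
    have "0 \<le> M" by (simp add: M_def)
    then have "2 * (real d * l) + 9 * H + 6 * (real s * l) \<le> M / 512" using a b c by simp
    then show ?thesis by (simp add: M_def mult.commute)
  qed
  have K': "2 * (real d * l) + 8 * H \<le> 3 / 8 * real s"
  proof -
    have "100 * (real d * l) \<le> real m / (25600 * Y)"
      using dl Y mpos by (simp add: pos_le_divide_eq mult_ac)
    moreover have "100 * H \<le> real m / (25600 * Y)"
      using Hl Y mpos by (simp add: pos_le_divide_eq mult_ac)
    ultimately have "100 * (real d * l) \<le> real s" "100 * H \<le> real s" using s_lo' by linarith+
    then show ?thesis by linarith
  qed
  have K'': "7 * H \<le> real m" 
  proof -
    have "100000000000000000000 * (Y * H) \<le> real m" using Hl by simp
    then show ?thesis using ge(2) H by linarith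
  qed
  have m3': "3 \<le> m" using m3 by simp
  have dm: "d \<le> m" using N5 by linarith
  show ?thesis
  proof (rule that)
    show "s \<le> m" using s_m by simp
    show "real L * (6 * R / sqrt (real s)) \<le> 960 * (real L ^ 2 * sqrt (ln (real m) / real m) * R)"
      using N7 by (simp only: l_def)
  qed (rule s0 N3 N4 N5 failure_probability_le[OF m3' dm L \<delta>, folded l_def H_def, OF l H K K' K''])+
qed

theorem lemma16:
  "\<exists>c C :: real. c > 0 \<and> C > 0 \<and>
     (\<forall>(d :: nat) (m :: nat) (L :: nat) (R :: real) (\<delta> :: real).
        d > 0 \<longrightarrow> m > 0 \<longrightarrow> even m \<longrightarrow> L \<ge> 2 \<longrightarrow> R \<ge> 1 \<longrightarrow> 0 < \<delta> \<longrightarrow> \<delta> < 1 \<longrightarrow>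
        real m \<ge> c * real L ^ 11 * real d * ln (real m) ^ 5 * ln (real L / \<delta>) * R ^ 2 \<longrightarrow>
        \<P>(\<omega> in init_measure d m L.
            \<forall>W \<in> weight_ball d m L R (init_weights d m L \<omega>). \<forall>l \<in> {1..L}.
              (SUP x\<in>unit_sphere d.
                 vec_norm2 (hidden m W l x - hidden m (init_weights d m L \<omega>) l x))
              \<le> C * real L ^ 2 * sqrt (ln (real m) / real m) * R) \<ge> 1 - \<delta>)"
proof (intro exI conjI allI impI)
  \<comment> \<open>403200 = 420 * 960, from \<open>perturbation_bound\<close> and
    \<open>parameter_choice\<close>.\<close>
  show "(0::real) < 10 ^ 24" "(0::real) < 403200" by simp_all
  fix d m L :: nat and R \<delta> :: real
  assume d: "d > 0" and m0: "m > 0" and even: "even m" and L: "L \<ge> 2" and R: "R \<ge> 1"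
    and \<delta>: "0 < \<delta>" "\<delta> < 1"
    and big: "real m \<ge> 10 ^ 24 * real L ^ 11 * real d * ln (real m) ^ 5 * ln (real L / \<delta>) * R ^ 2"
  let ?M = "init_measure d m L"
  let ?K = "403200 * real L ^ 2 * sqrt (ln (real m) / real m) * R"
  interpret prob_space ?M by (rule prob_space_init_measure)
  have m2: "2 \<le> m" using m0 even by (cases "m = 1") auto
  obtain s where s: "0 < s" "s \<le> m" and N3: "8 * real L * (6 * R / sqrt (real s)) \<le> 1"
    and N4: "real m * (6 * R / sqrt (real s))\<^sup>2 \<le> (real s / (32 * real m))\<^sup>2 * real s"
    and N5: "80 * d \<le> m"
    and N7: "real L * (6 * R / sqrt (real s)) \<le> 960 * (real L ^ 2 * sqrt (ln (real m) / real m) *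
      R)"
    and prob: "(2 * real m + 1) ^ d * point_failure m L s +
     (12 ^ d * exp (- (4 * real m)) + 12 ^ m * exp (- (4 * real m))) \<le> \<delta>"
    by (rule parameter_choice[OF d m2 L R \<delta> big])
  have n1: "d = fan_in d m 1" and nL: "m = fan_in d m L" using L by (auto simp: fan_in_def)
  have fr1: "{1} \<times> {..<m} \<subseteq> free_rows m L" and frL: "{L} \<times> {..<m div 2} \<subseteq> free_rows m L"
    using L by (auto simp: free_rows_def)
  have gridc: "real (card (grid d m)) \<le> (2 * real m + 1) ^ d"
  proof -
    have "real (card (grid d m)) \<le> real ((2 * m + 1) ^ d)" by (rule of_nat_mono[OF card_grid])
    then show ?thesis by (simp add: add.commute)
  qed
  let ?bad1 = "\<lambda>\<omega>. \<exists>z\<in>grid d m. \<not> good_point d m L s (curry \<omega>) z"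
  let ?bad2 = "\<lambda>\<omega>. \<exists>w\<in>lattice_net {..<d}. 20 * real m \<le> row_gain d {..<m} (curry \<omega> 1) w"
  let ?bad3 = "\<lambda>\<omega>. \<exists>w\<in>lattice_net {..<m}. 20 * real m \<le> row_gain m {..<m div 2} (curry \<omega> L) w"
  \<comment> \<open>Three kinds of failure: a bad grid point, a large first layer, and a large
    sampled half of the last layer.\<close>
  have "rare ?M \<delta> (\<lambda>\<omega>. ?bad1 \<omega> \<or> ?bad2 \<omega> \<or> ?bad3 \<omega>)"
  proof (rule rare_weaken[OF rare_disj[OF rare_ex_le rare_disj[OF rare_operator rare_operator]] _
    prob])
    show "finite (grid d m)" by (rule finite_grid)
    show "real (card (grid d m)) \<le> (2 * real m + 1) ^ d" by (rule gridc)
    show "rare ?M (point_failure m L s) (\<lambda>\<omega>. \<not> good_point d m L s (curry \<omega>) z)" for z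
      by (rule rare_not_good_point[OF s(2) L])
    show "d = fan_in d m 1" "m = fan_in d m L" by (fact n1 nL)+
    show "{1} \<times> {..<m} \<subseteq> free_rows m L" "{L} \<times> {..<m div 2} \<subseteq> free_rows m L" by (fact fr1 frL)+
  qed (auto simp: point_failure_def Let_def)
  then obtain E where E: "E \<in> sets ?M" "{\<omega> \<in> space ?M. ?bad1 \<omega> \<or> ?bad2 \<omega> \<or> ?bad3 \<omega>} \<subseteq> E" "measure
    ?M E \<le> \<delta>"
    unfolding rare_def by blast
  have event: "perturbation_event d m L R ?K \<omega>" if \<omega>: "\<omega> \<in> space ?M - E" for \<omega>
  proof -
    have good1: "good_point d m L s (curry \<omega>) z" if "z \<in> grid d m" for z
      using E(2) \<omega> that by blast
    have good2: "row_gain d {..<m} (\<lambda>r. \<omega> (1, r)) w < 20 * real m" if "w \<in> lattice_net {..<d}" for w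
      using E(2) \<omega> that by (force simp: not_less[symmetric] curry_def)
    have good3: "row_gain m {..<m div 2} (\<lambda>r. \<omega> (L, r)) w < 20 * real m" if "w \<in> lattice_net
      {..<m}" for w
      using E(2) \<omega> that by (force simp: not_less[symmetric] curry_def)
    show ?thesis
      unfolding perturbation_event_def
    proof (intro ballI allI impI)
      fix \<Delta> x l
      assume \<Delta>: "\<Delta> \<in> small_perturbations d m L R" and x: "nrm d x = 1" and l: "l \<in> {1..L}"
      have "nrm m (\<lambda>r. act d m (perturb (init_rows m L \<omega>) \<Delta>) x l r - act d m (init_rows m L \<omega>) x l
        r)
        \<le> 420 * (real L * (6 * R / sqrt (real s)))"
      proof (rule perturbation_bound[OF even R N5 d _ _ _ L x \<Delta> l])
        show "good_weights d m L s (curry \<omega>) z (real s / (32 * real m)) (6 * R / sqrt (real s)) R"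
          if "z \<in> grid d m" "nrm d z \<le> 1" "1/2 \<le> (nrm d z)\<^sup>2" for z
          by (rule good_weights_of_good_point[OF m0 s L _ refl N3 N4 that(2,3) good1[OF that(1)]])
            (use R in simp)
        show "nrm m (\<lambda>r. dotp d (\<omega> (1, r)) v) \<le> 2 * sqrt (20 * real m) * nrm d v"
          if "\<And>i. i \<notin> {..<d} \<Longrightarrow> v i = 0" for v
          by (rule rows_operator_bound[OF good2 that])
        show "L2_set (\<lambda>r. dotp m (\<omega> (L, r)) v) {..<m div 2} \<le> 2 * sqrt (20 * real m) * nrm m v"
          if "\<And>i. i \<notin> {..<m} \<Longrightarrow> v i = 0" for v
          by (rule rows_operator_bound[OF good3 that])
      qed
      also have "\<dots> \<le> 420 * (960 * (real L ^ 2 * sqrt (ln (real m) / real m) * R))"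
        by (intro mult_left_mono N7) simp
      finally show "nrm m (\<lambda>r. act d m (perturb (init_rows m L \<omega>) \<Delta>) x l r - act d m (init_rows m
        L \<omega>) x l r) \<le> ?K"
        by (simp add: mult.assoc)
    qed
  qed
  have "1 - \<delta> \<le> 1 - prob E" using E(3) by simp
  also have "\<dots> = prob (space ?M - E)" by (rule prob_compl[OF E(1), symmetric])
  \<comment> \<open>Monotonicity needs the larger set to be measurable; this is where
    \<open>sets_perturbation_event\<close> enters.\<close>
  also have "\<dots> \<le> prob {\<omega> \<in> space ?M. perturbation_event d m L R ?K \<omega>}"
    by (rule finite_measure_mono[OF _ sets_perturbation_event[OF even]]) (use event in auto)
  finally show "1 - \<delta> \<le> \<P>(\<omega> in ?M. \<forall>W \<in> weight_ball d m L R (init_weights d m L \<omega>). \<forall>l \<in> {1..L}.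
      (SUP x\<in>unit_sphere d. vec_norm2 (hidden m W l x - hidden m (init_weights d m L \<omega>) l x)) \<le> ?K)"
    using R by (subst event_iff_perturbation_event[OF d L]) auto
qed

end
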